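(* Let $N\ge 2$, let $\Omega\subseteq\mathbb{R}^N$ be a bounded domain, let $p\in(1,+\infty)$ and $r\in(1,p^* )$. Let $\{u_n\}\subseteq W^{1,p}_{\mathrm{loc}}(\Omega)$ and $\{f_n\}\subseteq L^{r'}_{\mathrm{loc}}(\Omega)$ be such that, for all $n\in\mathbb{N}$, $u_n$ is a distributional solution to $$-\Delta_p u_n=f_n(x)\quad\text{in }\Omega.$$ Suppose that: (1) $\{\nabla u_n\}$ is bounded in $L^p_{\mathrm{loc}}(\Omega)$; (2) $\{f_n\}$ is bounded in $L^{r'}_{\mathrm{loc}}(\Omega)$; (3) $u_n\to u$ in $L^p_{\mathrm{loc}}(\Omega)\cap L^r_{\mathrm{loc}}(\Omega)$ for some $u \in L^p_{\mathrm{loc}}(\Omega)\cap L^r_{\mathrm{loc}}(\Omega)$. Then $\{\nabla u_n\}$ admits a strongly convergent subsequence in $L^p_{\mathrm{loc}}(\Omega)$.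
   Context: $\Delta_p u:=\mathrm{div}(|\nabla u|^{p-2}\nabla u)$ is the $p$-Laplacian. $p^*:=\frac{Np}{N-p}$ if $p<N$ and $p^*:=\infty$ if $p\ge N$; $r':=\frac{r}{r-1}$. A distributional solution to $-\Delta_p u=f(x)$ in $\Omega$, with $f\in L^1_{\mathrm{loc}}(\Omega)$, is a function $u\in W^{1,p}_{\mathrm{loc}}(\Omega)$ such that $\int_\Omega|\nabla u|^{p-2}\nabla u\cdot\nabla\varphi\,dx=\int_\Omega f\varphi\,dx$ for all $\varphi\in C^\infty_c(\Omega)$. Boundedness (resp. convergence) in $L^s_{\mathrm{loc}}(\Omega)$ means boundedness (resp. convergence) in $L^s(K)$ for every compact $K\subseteq\Omega$. *)

theory Defs
  imports "HOL-Analysis.Analysis"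
begin

definition conj_exp :: "real \<Rightarrow> real" where
  "conj_exp r = r / (r - 1)"

definition sobolev_exp :: "nat \<Rightarrow> real \<Rightarrow> ereal" where
  "sobolev_exp N p = (if p < real N then ereal (real N * p / (real N - p)) else \<infinity>)"

(* Functions on an open set \<Omega> are represented by total functions of which only the values
   on \<Omega> matter.  The exponent s is finite; Lp s K is used for 1 \<le> s. *)

definition Lp :: "real \<Rightarrow> 'a::euclidean_space set \<Rightarrow> ('a \<Rightarrow> 'b::euclidean_space) set" where
  "Lp s K = {f \<in> borel_measurable (lebesgue_on K).
               integrable (lebesgue_on K) (\<lambda>x. norm (f x) powr s)}"

definition Lp_norm :: "real \<Rightarrow> 'a::euclidean_space set \<Rightarrow> ('a \<Rightarrow> 'b::euclidean_space) \<Rightarrow> real" where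
  "Lp_norm s K f = (LINT x|lebesgue_on K. norm (f x) powr s) powr (1 / s)"

definition Lp_loc :: "real \<Rightarrow> 'a::euclidean_space set \<Rightarrow> ('a \<Rightarrow> 'b::euclidean_space) set" where
  "Lp_loc s \<Omega> = {f. \<forall>K. compact K \<and> K \<subseteq> \<Omega> \<longrightarrow> f \<in> Lp s K}"

(* Since the Bochner integral of a non-integrable function is 0, membership in the space
   is part of the next two notions and cannot be read off from Lp_norm. *)

definition bounded_Lp_loc ::
    "real \<Rightarrow> 'a::euclidean_space set \<Rightarrow> (nat \<Rightarrow> 'a \<Rightarrow> 'b::euclidean_space) \<Rightarrow> bool" where
  "bounded_Lp_loc s \<Omega> F \<longleftrightarrow>
     (\<forall>n. F n \<in> Lp_loc s \<Omega>) \<and>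
     (\<forall>K. compact K \<and> K \<subseteq> \<Omega> \<longrightarrow> (\<exists>C. \<forall>n. Lp_norm s K (F n) \<le> C))"

definition converges_Lp_loc ::
    "real \<Rightarrow> 'a::euclidean_space set \<Rightarrow> (nat \<Rightarrow> 'a \<Rightarrow> 'b::euclidean_space) \<Rightarrow> ('a \<Rightarrow> 'b) \<Rightarrow> bool" where
  "converges_Lp_loc s \<Omega> F g \<longleftrightarrow>
     (\<forall>n. F n \<in> Lp_loc s \<Omega>) \<and> g \<in> Lp_loc s \<Omega> \<and>
     (\<forall>K. compact K \<and> K \<subseteq> \<Omega> \<longrightarrow> (\<lambda>n. Lp_norm s K (\<lambda>x. F n x - g x)) \<longlonglongrightarrow> 0)"

definition gradient :: "('a::euclidean_space \<Rightarrow> real) \<Rightarrow> 'a \<Rightarrow> 'a" where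
  "gradient f x = (THE D. GDERIV f x :> D)"

lemma gradient_eqI:
  assumes "GDERIV f x :> D"
  shows "gradient f x = D"
  unfolding gradient_def
proof (rule the_equality)
  fix E assume "GDERIV f x :> E"
  with assms have "(\<lambda>h. h \<bullet> E) = (\<lambda>h. h \<bullet> D)"
    unfolding gderiv_def by (metis has_derivative_unique)
  then show "E = D"
    by (metis inner_commute vector_eq_ldot)
qed (fact assms)

primrec Ck :: "nat \<Rightarrow> ('a::euclidean_space \<Rightarrow> real) \<Rightarrow> bool" where
  "Ck 0 f \<longleftrightarrow> continuous_on UNIV f"
| "Ck (Suc k) f \<longleftrightarrow>
     (\<forall>x. f differentiable (at x)) \<and> (\<forall>b\<in>Basis. Ck k (\<lambda>x. gradient f x \<bullet> b))"

(* The elements of C\<^sub>c\<^sup>\<infinity>(\<Omega>), extended by 0 to the whole space. *)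
definition test_functions :: "'a::euclidean_space set \<Rightarrow> ('a \<Rightarrow> real) set" where
  "test_functions \<Omega> =
     {\<phi>. (\<forall>k. Ck k \<phi>) \<and> compact (closure {x. \<phi> x \<noteq> 0}) \<and> closure {x. \<phi> x \<noteq> 0} \<subseteq> \<Omega>}"

definition has_weak_gradient ::
    "'a::euclidean_space set \<Rightarrow> ('a \<Rightarrow> real) \<Rightarrow> ('a \<Rightarrow> 'a) \<Rightarrow> bool" where
  "has_weak_gradient \<Omega> u G \<longleftrightarrow>
     u \<in> Lp_loc 1 \<Omega> \<and> G \<in> Lp_loc 1 \<Omega> \<and>
     (\<forall>\<phi>\<in>test_functions \<Omega>. \<forall>b\<in>Basis.
        (LINT x|lebesgue_on \<Omega>. u x * (gradient \<phi> x \<bullet> b)) =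
        - (LINT x|lebesgue_on \<Omega>. (G x \<bullet> b) * \<phi> x))"

(* A representative: the weak gradient is determined only up to null sets. *)
definition weak_gradient :: "'a::euclidean_space set \<Rightarrow> ('a \<Rightarrow> real) \<Rightarrow> 'a \<Rightarrow> 'a" where
  "weak_gradient \<Omega> u = (SOME G. has_weak_gradient \<Omega> u G)"

definition W1p_loc :: "real \<Rightarrow> 'a::euclidean_space set \<Rightarrow> ('a \<Rightarrow> real) set" where
  "W1p_loc p \<Omega> = {u \<in> Lp_loc p \<Omega>. \<exists>G. has_weak_gradient \<Omega> u G \<and> G \<in> Lp_loc p \<Omega>}"

(* For p < 2 the vector field |\<nabla>u|^(p-2) \<nabla>u is 0 where \<nabla>u = 0, as usual. *)
definition p_laplace_solution ::
    "real \<Rightarrow> 'a::euclidean_space set \<Rightarrow> ('a \<Rightarrow> real) \<Rightarrow> ('a \<Rightarrow> real) \<Rightarrow> bool" where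
  "p_laplace_solution p \<Omega> f u \<longleftrightarrow>
     f \<in> Lp_loc 1 \<Omega> \<and> u \<in> W1p_loc p \<Omega> \<and>
     (\<forall>\<phi>\<in>test_functions \<Omega>.
        (LINT x|lebesgue_on \<Omega>.
           ((norm (weak_gradient \<Omega> u x) powr (p - 2)) *\<^sub>R weak_gradient \<Omega> u x) \<bullet> gradient \<phi> x) =
        (LINT x|lebesgue_on \<Omega>. f x * \<phi> x))"

end

theory Submission
  imports Defs
begin

text \<open>
The idea is that the gradients themselves, and not only a subsequence, form a Cauchy sequence in
$L^p$ on every compact set; a subsequence is extracted only to produce the limit function.
Write $A(\xi) = |\xi|^{p-2}\xi$ for the flux of the $p$-Laplacian (\<open>p_flux\<close>).  Fix a compact set and a cutoff
$\varphi \in C_c^\infty(\Omega)$ with $\varphi \ge 1$ on it.  Subtracting the equations for $u_n$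
and $u_m$ and testing with $\varphi (u_n - u_m)$ gives
\[ \int \varphi\,(A(\nabla u_n) - A(\nabla u_m)) \cdot (\nabla u_n - \nabla u_m)
   = \int (f_n - f_m)\,\varphi\,(u_n - u_m)
   - \int (u_n - u_m)\,(A(\nabla u_n) - A(\nabla u_m)) \cdot \nabla\varphi . \]
On the right, $f_n$ is bounded in $L^{r'}$ and $u_n$ is Cauchy in $L^r$, while $A(\nabla u_n)$ is
bounded in $L^{p'}$ (as $|A(\xi)|^{p'} = |\xi|^p$) and $u_n$ is Cauchy in $L^p$; so both terms tend
to $0$ as $n, m \to \infty$.  The left-hand integrand is nonnegative, and strict monotonicity of $A$
turns its smallness into smallness of $|\nabla u_n - \nabla u_m|^p$.

Three points carry the work.

First, $\varphi(u_n - u_m)$ is only a Sobolev function.  The lemma \<open>weak_equation_product_test\<close>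
justifies it as a test function by mollifying $u_n - u_m$.  Every term of the weak equation is then a
pairing with a mollified function, and the limit rests on $\int h\,(\rho_k * v) \to \int h v$ for $h$ and
$v$ in conjugate Lebesgue spaces (\<open>mollify_pairing_tendsto\<close>), a consequence of the density of compactly
supported continuous functions and of Fubini's theorem.

Second, monotonicity is used in the soft form $|\xi - \eta|^p \le C_\delta\,(A(\xi) - A(\eta)) \cdot
(\xi - \eta) + \delta\,(|\xi|^p + |\eta|^p)$ (\<open>norm_diff_powr_le_flux_gap\<close>).  It follows from strict
monotonicity by homogeneity and compactness of the unit sphere, and it treats $p < 2$ and $p \ge 2$
alike.  Since the gradients are bounded in $L^p$, an arbitrarily small multiple of
$|\xi|^p + |\eta|^p$ is harmless.

Third, a sequence which is Cauchy in $L^p$ on every compact set has a subsequence converging in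
$L^p_{\mathrm{loc}}$ (\<open>Lp_loc_Cauchy_imp_convergent_subsequence\<close>).  This is the Riesz--Fischer
argument carried out along an exhaustion of $\Omega$ by compact sets.

Fubini's theorem is applied to Borel functions on the product, whereas the data are only Lebesgue
measurable; so the estimates are proved for Borel representatives that vanish outside a compact
neighbourhood, and transferred at the end.
\<close>

section \<open>Smooth functions and cutoffs\<close>

lemma differentiable_imp_GDERIV_gradient:
  fixes f :: "'a::euclidean_space \<Rightarrow> real"
  assumes "f differentiable (at x)"
  shows "GDERIV f x :> gradient f x"
proof -
  obtain f' where f': "(f has_derivative f') (at x)"
    using assms by (auto simp: differentiable_def)
  interpret bounded_linear f' using f' by (rule has_derivative_bounded_linear)
  have "f' h = h \<bullet> (\<Sum>b\<in>Basis. f' b *\<^sub>R b)" for h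
  proof -
    have "f' h = f' (\<Sum>b\<in>Basis. (h \<bullet> b) *\<^sub>R b)" by (simp add: euclidean_representation)
    also have "\<dots> = (\<Sum>b\<in>Basis. (h \<bullet> b) * f' b)" by (simp add: sum scaleR)
    finally show ?thesis by (simp add: inner_sum_right mult.commute)
  qed
  then have "f' = (\<lambda>h. h \<bullet> (\<Sum>b\<in>Basis. f' b *\<^sub>R b))" by blast
  with f' have "GDERIV f x :> (\<Sum>b\<in>Basis. f' b *\<^sub>R b)" by (simp add: gderiv_def)
  then show ?thesis using gradient_eqI by metis
qed

lemma GDERIV_imp_differentiable: "GDERIV f x :> D \<Longrightarrow> f differentiable (at x)"
  by (auto simp: gderiv_def differentiable_def)

lemma Ck_SucI:
  assumes "\<And>x. GDERIV f x :> D x" and "\<And>b. b \<in> Basis \<Longrightarrow> Ck k (\<lambda>x. D x \<bullet> b)"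
  shows "Ck (Suc k) f"
proof -
  have "gradient f = D" using assms(1) gradient_eqI by blast
  then show ?thesis using assms GDERIV_imp_differentiable[OF assms(1)] by simp
qed

lemma Ck_Suc_imp_GDERIV: "Ck (Suc k) f \<Longrightarrow> GDERIV f x :> gradient f x"
  by (simp add: differentiable_imp_GDERIV_gradient)

lemma Ck_Suc_imp_Ck: "Ck (Suc k) f \<Longrightarrow> Ck k f"
proof (induction k arbitrary: f)
  case 0
  then show ?case
    by (auto intro!: continuous_at_imp_continuous_on differentiable_imp_continuous_within)
next
  case (Suc k)
  then show ?case by (metis Ck.simps(2))
qed

lemma Ck_const: "Ck k (\<lambda>x. c)"
proof (induction k arbitrary: c)
  case (Suc k)
  show ?case by (rule Ck_SucI [where D = "\<lambda>x. 0"]) (use GDERIV_const Suc in auto)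
qed simp

lemma Ck_inner: "Ck k (\<lambda>x. x \<bullet> c)"
proof (cases k)
  case (Suc k)
  have "GDERIV (\<lambda>x. x \<bullet> c) x :> c" for x :: 'a
    unfolding gderiv_def by (auto intro!: derivative_eq_intros)
  then show ?thesis unfolding Suc by (rule Ck_SucI) (rule Ck_const)
qed (auto intro!: continuous_intros)

lemma Ck_add: "Ck k f \<Longrightarrow> Ck k g \<Longrightarrow> Ck k (\<lambda>x. f x + g x)"
proof (induction k arbitrary: f g)
  case (Suc k)
  show ?case
  proof (rule Ck_SucI)
    show "GDERIV (\<lambda>x. f x + g x) x :> gradient f x + gradient g x" for x
      using Suc.prems by (intro GDERIV_add Ck_Suc_imp_GDERIV)
  qed (use Suc in \<open>auto simp: inner_add_left\<close>)
qed (auto intro!: continuous_intros)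

lemma Ck_mult: "Ck k f \<Longrightarrow> Ck k g \<Longrightarrow> Ck k (\<lambda>x. f x * g x)"
proof (induction k arbitrary: f g)
  case (Suc k)
  show ?case
  proof (rule Ck_SucI)
    show "GDERIV (\<lambda>x. f x * g x) x :> f x *\<^sub>R gradient g x + g x *\<^sub>R gradient f x" for x
      using Suc.prems by (intro GDERIV_mult Ck_Suc_imp_GDERIV)
  next
    fix b :: 'a assume "b \<in> Basis"
    then show "Ck k (\<lambda>x. (f x *\<^sub>R gradient g x + g x *\<^sub>R gradient f x) \<bullet> b)"
      using Suc.prems Suc.prems[THEN Ck_Suc_imp_Ck]
      by (auto simp: inner_add_left intro!: Ck_add Suc.IH)
  qed
qed (auto intro!: continuous_intros)

lemma Ck_sum: "(\<And>i. i \<in> I \<Longrightarrow> Ck k (f i)) \<Longrightarrow> Ck k (\<lambda>x. \<Sum>i\<in>I. f i x)"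
  by (induction I rule: infinite_finite_induct) (auto intro: Ck_const Ck_add)

lemma Ck_reflect: "Ck k f \<Longrightarrow> Ck k (\<lambda>y. f (x - y))"
proof (induction k arbitrary: f)
  case 0
  then show ?case
    by (auto intro!: continuous_on_compose2[where g = f and t = UNIV] continuous_intros)
next
  case (Suc k)
  show ?case
  proof (rule Ck_SucI)
    fix y
    have 1: "(f has_derivative (\<lambda>h. h \<bullet> gradient f (x - y))) (at (x - y))"
      using Ck_Suc_imp_GDERIV[OF Suc.prems] by (simp add: gderiv_def)
    have 2: "((\<lambda>y. x - y) has_derivative (\<lambda>h. - h)) (at y)"
      by (auto intro!: derivative_eq_intros)
    show "GDERIV (\<lambda>y. f (x - y)) y :> - gradient f (x - y)"
      using has_derivative_compose[OF 2 1] by (simp add: gderiv_def)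
  next
    fix b :: 'a assume b: "b \<in> Basis"
    have "Ck k (\<lambda>y. (-1) * (gradient f (x - y) \<bullet> b))"
      by (rule Ck_mult[OF Ck_const]) (use Suc b in \<open>auto intro!: Suc.IH\<close>)
    then show "Ck k (\<lambda>y. - gradient f (x - y) \<bullet> b)" by simp
  qed
qed

text \<open>
The family $e^{-1/t}/t^m$, extended by $0$ to $t \le 0$, is closed under differentiation up to linear
combinations (\<open>DERIV_flat\<close>).  Treating all $m$ together lets one induction on the order of
differentiability prove smoothness of the bump functions.
\<close>

definition flat :: "nat \<Rightarrow> real \<Rightarrow> real" where
  "flat m t = (if t \<le> 0 then 0 else exp (- (1 / t)) / t ^ m)"

text \<open>
Exponential decay beats every power: $e^{1/t} \ge (1/(nt))^n$ with $n = m + 2$.  The quadratic bound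
says that the function is differentiable at $0$ with derivative $0$.
\<close>

lemma flat_bound: "\<bar>flat m t\<bar> \<le> real ((m + 2) ^ (m + 2)) * t\<^sup>2"
proof (cases "t \<le> 0")
  case False
  then have t: "t > 0" by simp
  let ?n = "m + 2"
  have "(1 / (t * real ?n)) ^ ?n \<le> (1 + (1 / t) / real ?n) ^ ?n"
    using t by (intro power_mono) (auto simp: field_simps)
  also have "\<dots> \<le> exp (1 / t)"
    by (rule exp_ge_one_plus_x_over_n_power_n) (use t in \<open>auto intro: order_trans[of _ 0]\<close>)
  finally have "inverse (exp (1 / t)) \<le> inverse ((1 / (t * real ?n)) ^ ?n)"
    using t by (intro le_imp_inverse_le) auto
  then have "exp (- (1 / t)) \<le> (t * real ?n) ^ ?n"
    by (simp add: exp_minus power_one_over)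
  then have "exp (- (1 / t)) / t ^ m \<le> (t * real ?n) ^ ?n / t ^ m"
    using t by (intro divide_right_mono) auto
  also have "\<dots> = real (?n ^ ?n) * t\<^sup>2"
    using t by (simp only: power_mult_distrib power_add of_nat_power) (simp add: power2_eq_square field_simps)
  finally show ?thesis using t by (simp add: flat_def)
qed (simp add: flat_def)

lemma DERIV_flat: "DERIV (flat m) t :> flat (m + 2) t - real m * flat (m + 1) t"
proof -
  consider "t < 0" | "t = 0" | "t > 0" by linarith
  then show ?thesis
  proof cases
    case 1
    have "DERIV (flat m) t :> 0"
      by (rule DERIV_cong_ev[THEN iffD2, OF refl _ refl DERIV_const[where k = 0]])
        (use 1 eventually_nhds_in_open[of "{..<0}" t] in \<open>auto elim!: eventually_mono simp: flat_def\<close>)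
    then show ?thesis using 1 by (simp add: flat_def)
  next
    case 2
    have "(\<lambda>h. (flat m (0 + h) - flat m 0) / h) \<midarrow>0\<rightarrow> 0"
    proof (rule Lim_null_comparison)
      show "\<forall>\<^sub>F h in at 0. norm ((flat m (0 + h) - flat m 0) / h) \<le> real ((m + 2) ^ (m + 2)) * \<bar>h\<bar>"
      proof (rule eventually_mono[OF eventually_neq_at_within[of 0]])
        fix h :: real assume "h \<noteq> 0"
        then show "norm ((flat m (0 + h) - flat m 0) / h) \<le> real ((m + 2) ^ (m + 2)) * \<bar>h\<bar>"
          using flat_bound[of m h] by (simp add: flat_def[of m 0] divide_simps power2_eq_square mult.assoc)
      qed
      show "((\<lambda>h. real ((m + 2) ^ (m + 2)) * \<bar>h\<bar>) \<longlongrightarrow> 0) (at (0::real))"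
        by (auto intro!: tendsto_eq_intros)
    qed
    then have "DERIV (flat m) 0 :> 0" by (simp add: DERIV_def)
    then show ?thesis using 2 by (simp add: flat_def)
  next
    case 3
    have "DERIV (\<lambda>t. exp (- (1 / t)) / t ^ m) t :>
        (exp (- (1 / t)) * (1 / t\<^sup>2) * t ^ m - exp (- (1 / t)) * (real m * t ^ (m - 1))) / (t ^ m * t ^ m)"
      using 3 by (auto intro!: derivative_eq_intros simp: power2_eq_square)
    also have "real m * t ^ (m - 1) = real m * t ^ m / t"
      using 3 by (cases m) auto
    also have "(exp (- (1 / t)) * (1 / t\<^sup>2) * t ^ m - exp (- (1 / t)) * (real m * t ^ m / t)) / (t ^ m * t ^ m)
        = flat (m + 2) t - real m * flat (m + 1) t"
      using 3 by (simp add: flat_def power_add field_simps power2_eq_square)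
    finally have *: "DERIV (\<lambda>t. exp (- (1 / t)) / t ^ m) t :> flat (m + 2) t - real m * flat (m + 1) t" .
    show ?thesis
      by (rule DERIV_cong_ev[THEN iffD2, OF refl _ refl *])
        (use 3 eventually_nhds_in_open[of "{0<..}" t] in \<open>auto elim!: eventually_mono simp: flat_def\<close>)
  qed
qed

definition bump :: "real \<Rightarrow> 'a::euclidean_space \<Rightarrow> 'a \<Rightarrow> real" where
  "bump e a x = flat 0 (e\<^sup>2 - (x - a) \<bullet> (x - a))"

lemma Ck_flat_ball: "Ck k (\<lambda>x::'a::euclidean_space. flat m (c - (x - a) \<bullet> (x - a)))"
proof (induction k arbitrary: m)
  case 0
  have "continuous_on UNIV (flat m)"
    by (intro continuous_at_imp_continuous_on) (metis DERIV_flat DERIV_isCont)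
  then show ?case
    by (auto intro!: continuous_on_compose2[where g = "flat m" and t = UNIV] continuous_intros)
next
  case (Suc k)
  let ?q = "\<lambda>x::'a. c - (x - a) \<bullet> (x - a)"
  show ?case
  proof (rule Ck_SucI)
    fix x :: 'a
    have "GDERIV ?q x :> (-2) *\<^sub>R (x - a)"
      unfolding gderiv_def by (auto intro!: derivative_eq_intros simp: inner_commute algebra_simps)
    then show "GDERIV (\<lambda>x. flat m (?q x)) x :>
        (flat (m + 2) (?q x) - real m * flat (m + 1) (?q x)) *\<^sub>R ((-2) *\<^sub>R (x - a))"
      by (rule GDERIV_DERIV_compose) (rule DERIV_flat)
  next
    fix b :: 'a
    have "Ck k (\<lambda>x. (flat (m + 2) (?q x) + (- real m) * flat (m + 1) (?q x)) * ((-2) * (x \<bullet> b + (- (a \<bullet> b)))))"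
      by (intro Ck_mult Ck_add Ck_const Ck_inner Suc.IH)
    then show "Ck k (\<lambda>x. ((flat (m + 2) (?q x) - real m * flat (m + 1) (?q x)) *\<^sub>R ((-2) *\<^sub>R (x - a))) \<bullet> b)"
      by (simp only: inner_diff_left[where z = b] inner_scaleR_left add_uminus_conv_diff mult_minus_left)
  qed
qed

lemma Ck_bump: "Ck k (bump e a)"
  unfolding bump_def[abs_def] by (rule Ck_flat_ball)

lemma bump_nonneg: "0 \<le> bump e a x"
  by (simp add: bump_def flat_def)

lemma bump_pos_iff: "0 < e \<Longrightarrow> 0 < bump e a x \<longleftrightarrow> dist a x < e"
proof -
  assume e: "0 < e"
  have "(norm (x - a))\<^sup>2 < e\<^sup>2 \<longleftrightarrow> norm (x - a) < e"
    using e by (meson norm_ge_zero power2_less_imp_less power_strict_mono less_imp_le pos2)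
  then have "(x - a) \<bullet> (x - a) < e\<^sup>2 \<longleftrightarrow> dist a x < e"
    by (simp only: dot_square_norm dist_norm norm_minus_commute)
  then show ?thesis by (auto simp: bump_def flat_def)
qed

lemma test_functionsI:
  assumes "\<And>k. Ck k \<phi>" "compact K" "\<And>x. x \<notin> K \<Longrightarrow> \<phi> x = 0" "K \<subseteq> \<Omega>"
  shows "\<phi> \<in> test_functions \<Omega>"
proof -
  have "closure {x. \<phi> x \<noteq> 0} \<subseteq> K"
    using assms by (intro closure_minimal) (auto simp: compact_imp_closed)
  moreover from this have "compact (closure {x. \<phi> x \<noteq> 0})"
    using assms(2) by (meson bounded_subset closed_closure compact_eq_bounded_closed)
  ultimately show ?thesis using assms by (auto simp: test_functions_def)
qed

text \<open>
A single compact set outside which both the function and its gradient vanish; working with such a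
set avoids the closure of the support in what follows.
\<close>

lemma test_functionsE:
  assumes "\<phi> \<in> test_functions \<Omega>"
  obtains K where "compact K" "K \<subseteq> \<Omega>" "\<And>x. x \<notin> K \<Longrightarrow> \<phi> x = 0" "\<And>x. x \<notin> K \<Longrightarrow> gradient \<phi> x = 0"
proof -
  define K where "K = closure {x. \<phi> x \<noteq> 0}"
  have z: "\<phi> x = 0" if "x \<notin> K" for x
    using that closure_subset[of "{x. \<phi> x \<noteq> 0}"] by (auto simp: K_def)
  have g: "gradient \<phi> x = 0" if x: "x \<notin> K" for x
  proof (rule gradient_eqI)
    have "(\<phi> has_derivative (\<lambda>h. h \<bullet> 0)) (at x)"
    proof (rule has_derivative_transform_within_open[where f = "\<lambda>x. 0"])
      show "open (- K)" by (auto simp: K_def)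
      show "((\<lambda>x. 0) has_derivative (\<lambda>h. h \<bullet> 0)) (at x)" by simp
    qed (use x z in auto)
    then show "GDERIV \<phi> x :> 0" by (simp add: gderiv_def)
  qed
  have "compact K" "K \<subseteq> \<Omega>" using assms by (auto simp: test_functions_def K_def)
  then show ?thesis using z g that by blast
qed

lemma test_functions_outside:
  assumes "\<psi> \<in> test_functions L" "x \<notin> L"
  shows "\<psi> x = 0" "gradient \<psi> x = 0"
proof -
  obtain K where "K \<subseteq> L" "\<And>x. x \<notin> K \<Longrightarrow> \<psi> x = 0" "\<And>x. x \<notin> K \<Longrightarrow> gradient \<psi> x = 0"
    by (rule test_functionsE[OF assms(1)]) blast
  then show "\<psi> x = 0" "gradient \<psi> x = 0" using assms(2) by auto
qed

lemma test_functions_Ck: "\<phi> \<in> test_functions \<Omega> \<Longrightarrow> Ck k \<phi>"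
  by (auto simp: test_functions_def)

lemma test_functions_GDERIV: "\<phi> \<in> test_functions \<Omega> \<Longrightarrow> GDERIV \<phi> x :> gradient \<phi> x"
  by (rule Ck_Suc_imp_GDERIV[OF test_functions_Ck])

lemma test_functions_mono: "\<phi> \<in> test_functions S \<Longrightarrow> S \<subseteq> T \<Longrightarrow> \<phi> \<in> test_functions T"
  by (auto simp: test_functions_def)

lemma test_functions_mult:
  assumes "\<phi> \<in> test_functions \<Omega>" "\<And>k. Ck k g"
  shows "(\<lambda>x. \<phi> x * g x) \<in> test_functions \<Omega>"
proof -
  obtain K where K: "compact K" "K \<subseteq> \<Omega>" "\<And>x. x \<notin> K \<Longrightarrow> \<phi> x = 0"
    by (rule test_functionsE[OF assms(1)]) blast
  show ?thesis
  proof (rule test_functionsI[where K = K])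
    show "Ck k (\<lambda>x. \<phi> x * g x)" for k
      by (intro Ck_mult test_functions_Ck[OF assms(1)] assms(2))
    show "\<phi> x * g x = 0" if "x \<notin> K" for x using K(3)[OF that] by simp
  qed (use K in auto)
qed

lemma test_functions_gradient_component:
  assumes "\<phi> \<in> test_functions \<Omega>" "b \<in> Basis"
  shows "(\<lambda>x. gradient \<phi> x \<bullet> b) \<in> test_functions \<Omega>"
proof -
  obtain K where K: "compact K" "K \<subseteq> \<Omega>" "\<And>x. x \<notin> K \<Longrightarrow> gradient \<phi> x = 0"
    by (rule test_functionsE[OF assms(1)]) blast
  show ?thesis
  proof (rule test_functionsI[of _ K])
    show "Ck k (\<lambda>x. gradient \<phi> x \<bullet> b)" for k
      using test_functions_Ck[OF assms(1), of "Suc k"] assms(2) by auto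
  qed (use K in auto)
qed

lemma test_functions_continuous: "\<phi> \<in> test_functions \<Omega> \<Longrightarrow> continuous_on UNIV \<phi>"
  using test_functions_Ck[of \<phi> \<Omega> 0] by simp

lemma test_functions_gradient_continuous:
  assumes "\<phi> \<in> test_functions \<Omega>" shows "continuous_on UNIV (gradient \<phi>)"
proof -
  have "continuous_on UNIV (\<lambda>x. \<Sum>b\<in>Basis. (gradient \<phi> x \<bullet> b) *\<^sub>R b)"
    by (intro continuous_intros test_functions_continuous[OF test_functions_gradient_component[OF assms]])
  then show ?thesis by (simp add: euclidean_representation)
qed

text \<open>
Finitely many bumps cover the compact set.  Their sum is positive there, hence bounded below, and can
be rescaled to be at least $1$ on the set.
\<close>

lemma exists_cutoff:
  fixes \<Omega> K :: "'a::euclidean_space set"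
  assumes "open \<Omega>" "compact K" "K \<subseteq> \<Omega>"
  obtains \<phi> where "\<phi> \<in> test_functions \<Omega>" "\<And>x. 0 \<le> \<phi> x" "\<And>x. x \<in> K \<Longrightarrow> 1 \<le> \<phi> x"
proof -
  have "\<exists>e>0. cball x e \<subseteq> \<Omega>" if "x \<in> K" for x
    using assms that open_contains_cball by blast
  then obtain e where e: "\<And>x. x \<in> K \<Longrightarrow> 0 < e x" "\<And>x. x \<in> K \<Longrightarrow> cball x (e x) \<subseteq> \<Omega>" by metis
  obtain I where I: "I \<subseteq> K" "finite I" "K \<subseteq> (\<Union>a\<in>I. ball a (e a))"
    using compactE_image[OF assms(2), of K "\<lambda>a. ball a (e a)"] e(1) by force
  define \<psi> where "\<psi> x = (\<Sum>a\<in>I. bump (e a) a x)" for x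
  have pos: "0 < \<psi> x" if "x \<in> K" for x
  proof -
    have "x \<in> (\<Union>a\<in>I. ball a (e a))" using I(3) that by blast
    then obtain a where a: "a \<in> I" "dist a x < e a" by auto
    then have "0 < bump (e a) a x" using bump_pos_iff[of "e a" a x] e(1)[of a] I(1) by auto
    also have "\<dots> \<le> \<psi> x" unfolding \<psi>_def
      by (rule member_le_sum) (use a I bump_nonneg in auto)
    finally show ?thesis .
  qed
  have Ck: "Ck k \<psi>" for k unfolding \<psi>_def[abs_def] by (intro Ck_sum Ck_bump)
  obtain c where c: "c > 0" "\<And>x. x \<in> K \<Longrightarrow> c \<le> \<psi> x"
  proof (cases "K = {}")
    case False
    then obtain x0 where "x0 \<in> K" "\<And>x. x \<in> K \<Longrightarrow> \<psi> x0 \<le> \<psi> x"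
      using continuous_attains_inf[OF assms(2), of \<psi>] Ck[of 0] by (auto intro: continuous_on_subset)
    then show ?thesis using pos[of x0] that[of "\<psi> x0"] by simp
  qed (use that[of 1] in auto)
  show ?thesis
  proof (rule that)
    show "(\<lambda>x. \<psi> x * (1 / c)) \<in> test_functions \<Omega>"
    proof (rule test_functionsI[where K = "\<Union>a\<in>I. cball a (e a)"])
      fix x assume x: "x \<notin> (\<Union>a\<in>I. cball a (e a))"
      have "bump (e a) a x = 0" if "a \<in> I" for a
        using x that bump_pos_iff[of "e a" a x] bump_nonneg[of "e a" a x] e(1) I by fastforce
      then show "\<psi> x * (1 / c) = 0" by (simp add: \<psi>_def)
    next
      show "Ck k (\<lambda>x. \<psi> x * (1 / c))" for k by (intro Ck_mult Ck_const Ck)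
      show "(\<Union>a\<in>I. cball a (e a)) \<subseteq> \<Omega>" using I(1) e(2) by blast
      show "compact (\<Union>a\<in>I. cball a (e a))" using I(2) by (intro compact_UN) auto
    qed
    show "0 \<le> \<psi> x * (1 / c)" for x using c by (simp add: \<psi>_def sum_nonneg bump_nonneg)
    show "1 \<le> \<psi> x * (1 / c)" if "x \<in> K" for x using c that by (simp add: field_simps)
  qed
qed

text \<open>
The cutoff lives on \<open>K'\<close>, and the collar of width \<open>e\<close> around \<open>K'\<close> stays inside the compact set \<open>L\<close>:
the mollifications with radius at most \<open>e\<close> then see only values on \<open>L\<close> at points where the cutoff is
nonzero.
\<close>

lemma exists_cutoff_with_collar:
  fixes \<Omega> K :: "'a::euclidean_space set"
  assumes "open \<Omega>" "compact K" "K \<subseteq> \<Omega>"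
  obtains \<phi> K' L e where "compact L" "L \<subseteq> \<Omega>" "K \<subseteq> K'" "K' \<subseteq> L" "0 < e" "\<And>x. x \<in> K' \<Longrightarrow> cball x e \<subseteq> L"
    "\<phi> \<in> test_functions K'" "\<And>x. 0 \<le> \<phi> x" "\<And>x. x \<in> K \<Longrightarrow> 1 \<le> \<phi> x"
proof -
  obtain \<phi> where \<phi>: "\<phi> \<in> test_functions \<Omega>" "\<And>x. 0 \<le> \<phi> x" "\<And>x. x \<in> K \<Longrightarrow> 1 \<le> \<phi> x"
    by (rule exists_cutoff[OF assms]) blast
  obtain K' where K': "compact K'" "K' \<subseteq> \<Omega>" "\<And>x. x \<notin> K' \<Longrightarrow> \<phi> x = 0"
    by (rule test_functionsE[OF \<phi>(1)]) blast
  obtain e where e: "0 < e" "(\<Union>x\<in>K'. cball x e) \<subseteq> \<Omega>"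
    by (rule compact_subset_open_imp_cball_epsilon_subset[OF K'(1) assms(1) K'(2)])
  define L where "L = {x + y |x y. x \<in> K' \<and> y \<in> cball 0 e}"
  have collar: "cball x e \<subseteq> L" if "x \<in> K'" for x
  proof
    fix z assume "z \<in> cball x e"
    then have "z = x + (z - x)" "z - x \<in> cball 0 e" by (auto simp: dist_norm norm_minus_commute)
    then show "z \<in> L" using that unfolding L_def by blast
  qed
  show ?thesis
  proof (rule that[of L K' e \<phi>])
    show "compact L" unfolding L_def by (intro compact_sums K' compact_cball)
    show "L \<subseteq> \<Omega>"
    proof
      fix z assume "z \<in> L"
      then obtain x y where "z = x + y" "x \<in> K'" "y \<in> cball 0 e" by (auto simp: L_def)
      then have "z \<in> cball x e" "x \<in> K'" by (auto simp: dist_norm)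
      then show "z \<in> \<Omega>" using e(2) by blast
    qed
    show "K \<subseteq> K'"
    proof
      fix x assume "x \<in> K"
      then show "x \<in> K'" using \<phi>(3)[of x] K'(3)[of x] by force
    qed
    show "K' \<subseteq> L"
    proof
      fix x assume "x \<in> K'"
      moreover have "x \<in> cball x e" using e(1) by simp
      ultimately show "x \<in> L" using collar by blast
    qed
    show "\<phi> \<in> test_functions K'"
      by (rule test_functionsI[OF test_functions_Ck[OF \<phi>(1)] K'(1,3) order_refl])
  qed (use e collar \<phi> in auto)
qed

section \<open>Mollification\<close>

lemma compact_support_uniformly_continuous:
  fixes f :: "'a::euclidean_space \<Rightarrow> 'b::real_normed_vector"
  assumes "continuous_on UNIV f" "compact K" "\<And>x. x \<notin> K \<Longrightarrow> f x = 0" "0 < e"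
  obtains d where "0 < d" "\<And>x y. dist x y < d \<Longrightarrow> dist (f x) (f y) < e"
proof -
  obtain R where R: "K \<subseteq> cball 0 R"
    using compact_imp_bounded[OF assms(2)] by (auto simp: bounded_iff subset_iff)
  have "uniformly_continuous_on (cball 0 (R + 1)) f"
    using assms(1) by (intro compact_uniformly_continuous) (auto intro: continuous_on_subset)
  then obtain d where d: "0 < d" "\<And>x y. x \<in> cball 0 (R + 1) \<Longrightarrow> y \<in> cball 0 (R + 1) \<Longrightarrow> dist y x < d \<Longrightarrow> dist (f y) (f x) < e"
    using assms(4) unfolding uniformly_continuous_on_def by blast
  show ?thesis
  proof (rule that)
    show "0 < min d 1" using d by simp
    fix x y :: 'a assume xy: "dist x y < min d 1"
    show "dist (f x) (f y) < e"
    proof (cases "x \<in> cball 0 (R + 1) \<and> y \<in> cball 0 (R + 1)")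
      case True
      then show ?thesis using d xy by simp
    next
      case False
      have "x \<notin> K \<and> y \<notin> K"
      proof -
        have "norm x \<le> norm y + dist x y" "norm y \<le> norm x + dist x y"
          by (simp_all add: dist_norm norm_triangle_sub norm_minus_commute)
             (metis norm_minus_commute norm_triangle_sub)
        then have "norm x > R \<and> norm y > R" using False xy by auto
        then show ?thesis using R by auto
      qed
      then show ?thesis using assms by simp
    qed
  qed
qed

lemma compact_support_bounded:
  fixes f :: "'a::euclidean_space \<Rightarrow> 'b::real_normed_vector"
  assumes "continuous_on UNIV f" "compact K" "\<And>x. x \<notin> K \<Longrightarrow> f x = 0"
  obtains B where "0 < B" "\<And>x. norm (f x) \<le> B"
proof -
  have "bounded (f ` K)"
    using assms by (intro compact_imp_bounded compact_continuous_image) (auto intro: continuous_on_subset)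
  then obtain B where B: "0 < B" "\<forall>y\<in>f ` K. norm y \<le> B" by (auto simp: bounded_pos)
  have "norm (f x) \<le> B" for x using B assms(3)[of x] by (cases "x \<in> K") auto
  then show ?thesis using that B by blast
qed

lemma continuous_imp_borel: "continuous_on UNIV f \<Longrightarrow> f \<in> borel_measurable borel"
  for f :: "'a::euclidean_space \<Rightarrow> 'b::euclidean_space"
  by (rule borel_measurable_continuous_onI)

lemma test_functions_borel:
  "\<phi> \<in> test_functions \<Omega> \<Longrightarrow> \<phi> \<in> borel_measurable borel"
  "\<phi> \<in> test_functions \<Omega> \<Longrightarrow> gradient \<phi> \<in> borel_measurable borel"
  by (auto intro: continuous_imp_borel test_functions_continuous test_functions_gradient_continuous)

lemma test_functions_bounded:
  assumes "\<phi> \<in> test_functions \<Omega>"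
  obtains B where "0 < B" "\<And>x. \<bar>\<phi> x\<bar> \<le> B"
proof -
  obtain K where K: "compact K" "\<And>x. x \<notin> K \<Longrightarrow> \<phi> x = 0"
    by (rule test_functionsE[OF assms]) blast
  show ?thesis
    by (rule compact_support_bounded[OF test_functions_continuous[OF assms] K])
       (use that in auto)
qed

lemma test_functions_gradient_bounded:
  assumes "\<phi> \<in> test_functions \<Omega>"
  obtains B where "0 < B" "\<And>x. norm (gradient \<phi> x) \<le> B"
proof -
  obtain K where K: "compact K" "\<And>x. x \<notin> K \<Longrightarrow> gradient \<phi> x = 0"
    by (rule test_functionsE[OF assms]) blast
  show ?thesis
    by (rule compact_support_bounded[OF test_functions_gradient_continuous[OF assms] K])
       (use that in auto)
qed

text \<open>
The gradient is uniformly continuous because it has compact support, so the error of the first-order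
expansion is $o(|h|)$ uniformly in the base point.  This is what permits differentiation under the
integral sign against a merely integrable function.
\<close>

lemma test_functions_uniformly_differentiable:
  fixes \<phi> :: "'a::euclidean_space \<Rightarrow> real"
  assumes "\<phi> \<in> test_functions \<Omega>" "0 < e"
  obtains d where "0 < d"
    "\<And>x h. norm h < d \<Longrightarrow> \<bar>\<phi> (x + h) - \<phi> x - h \<bullet> gradient \<phi> x\<bar> \<le> e * norm h"
proof -
  obtain K where K: "compact K" "\<And>x. x \<notin> K \<Longrightarrow> gradient \<phi> x = 0"
    by (rule test_functionsE[OF assms(1)]) blast
  obtain d where d: "0 < d" "\<And>x y. dist x y < d \<Longrightarrow> dist (gradient \<phi> x) (gradient \<phi> y) < e"
    using compact_support_uniformly_continuous[OF test_functions_gradient_continuous[OF assms(1)] K assms(2)]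
    by blast
  show ?thesis
  proof (rule that[OF d(1)])
    fix x h :: 'a assume h: "norm h < d"
    have "norm (\<phi> (x + h) - \<phi> x - ((x + h) - x) \<bullet> gradient \<phi> x) \<le> norm ((x + h) - x) * e"
    proof (rule differentiable_bound_linearization[where S = "ball x d" and f' = "\<lambda>y h. h \<bullet> gradient \<phi> y"])
      show "x + t *\<^sub>R ((x + h) - x) \<in> ball x d" if "t \<in> {0..1}" for t
      proof -
        have "t * norm h \<le> 1 * norm h" using that by (intro mult_right_mono) auto
        then show ?thesis using that h by (simp add: dist_norm)
      qed
      show "(\<phi> has_derivative (\<lambda>h. h \<bullet> gradient \<phi> y)) (at y within ball x d)" for y
        using test_functions_GDERIV[OF assms(1)] by (auto simp: gderiv_def intro: has_derivative_at_withinI)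
      show "onorm ((\<lambda>i. i \<bullet> gradient \<phi> y) - (\<lambda>i. i \<bullet> gradient \<phi> x)) \<le> e" if y: "y \<in> ball x d" for y
        unfolding fun_diff_def
      proof (rule onorm_le)
        fix i :: 'a
        have "norm (i \<bullet> (gradient \<phi> y - gradient \<phi> x)) \<le> norm i * norm (gradient \<phi> y - gradient \<phi> x)"
          by (simp add: Cauchy_Schwarz_ineq2)
        also have "\<dots> \<le> norm i * e"
          using d(2)[of y x] y by (intro mult_left_mono) (auto simp: dist_norm norm_minus_commute)
        finally show "norm (i \<bullet> gradient \<phi> y - i \<bullet> gradient \<phi> x) \<le> e * norm i"
          by (simp add: inner_diff_right mult.commute)
      qed
    qed (use d in auto)
    then show "\<bar>\<phi> (x + h) - \<phi> x - h \<bullet> gradient \<phi> x\<bar> \<le> e * norm h" by (simp add: mult.commute)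
  qed
qed

definition mollify :: "('a::euclidean_space \<Rightarrow> real) \<Rightarrow> ('a \<Rightarrow> real) \<Rightarrow> 'a \<Rightarrow> real" where
  "mollify \<rho> v x = (LINT y|lborel. \<rho> (x - y) * v y)"

lemma integrable_mollify:
  assumes "\<rho> \<in> test_functions UNIV" "integrable lborel v"
  shows "integrable lborel (\<lambda>y. \<rho> (x - y) * v y)"
proof -
  obtain B where B: "0 < B" "\<And>x. \<bar>\<rho> x\<bar> \<le> B" using test_functions_bounded[OF assms(1)] by blast
  have [measurable]: "\<rho> \<in> borel_measurable borel" "v \<in> borel_measurable borel"
    using assms test_functions_borel by auto
  show ?thesis
  proof (rule Bochner_Integration.integrable_bound)
    show "integrable lborel (\<lambda>y. B * v y)" using assms by simp
    show "AE y in lborel. norm (\<rho> (x - y) * v y) \<le> norm (B * v y)"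
      using B by (auto simp: abs_mult intro!: mult_right_mono)
  qed measurable
qed

text \<open>
All derivatives fall on the kernel.  The remainder of the difference quotient is the integral of the
remainder of the kernel against $v$, hence small compared with the displacement by uniform
differentiability; \<open>C\<close> absorbs the $L^1$ norm of $v$.
\<close>

lemma GDERIV_mollify:
  fixes \<rho> v :: "'a::euclidean_space \<Rightarrow> real"
  assumes \<rho>: "\<rho> \<in> test_functions UNIV" and v: "integrable lborel v"
  shows "GDERIV (mollify \<rho> v) x :> (\<Sum>b\<in>Basis. mollify (\<lambda>z. gradient \<rho> z \<bullet> b) v x *\<^sub>R b)"
proof -
  let ?D = "\<Sum>b\<in>Basis. mollify (\<lambda>z. gradient \<rho> z \<bullet> b) v x *\<^sub>R b"
  have int: "integrable lborel (\<lambda>y. (gradient \<rho> (x - y) \<bullet> b) * v y)" if "b \<in> Basis" for b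
    using integrable_mollify[OF test_functions_gradient_component[OF \<rho> that] v] .
  have inner: "h \<bullet> ?D = (LINT y|lborel. (h \<bullet> gradient \<rho> (x - y)) * v y)"
    and int': "integrable lborel (\<lambda>y. (h \<bullet> gradient \<rho> (x - y)) * v y)" for h
  proof -
    have eq: "(h \<bullet> gradient \<rho> (x - y)) * v y = (\<Sum>b\<in>Basis. (h \<bullet> b) * ((gradient \<rho> (x - y) \<bullet> b) * v y))" for y
      by (subst euclidean_inner) (simp add: sum_distrib_right mult.assoc)
    show "integrable lborel (\<lambda>y. (h \<bullet> gradient \<rho> (x - y)) * v y)"
      unfolding eq using int by auto
    show "h \<bullet> ?D = (LINT y|lborel. (h \<bullet> gradient \<rho> (x - y)) * v y)"
      unfolding eq using int by (subst Bochner_Integration.integral_sum) (auto simp: inner_sum_right mollify_def mult.commute)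
  qed
  define C where "C = (LINT y|lborel. \<bar>v y\<bar>) + 1"
  have C: "C > 0" unfolding C_def by (intro add_nonneg_pos Bochner_Integration.integral_nonneg) auto
  have "(mollify \<rho> v has_derivative (\<lambda>h. h \<bullet> ?D)) (at x)"
    unfolding has_derivative_at_alt
  proof (intro conjI allI impI)
    show "bounded_linear (\<lambda>h. h \<bullet> ?D)" by (rule bounded_linear_inner_left)
    fix e :: real assume "0 < e"
    then have "0 < e / C" using C by simp
    then obtain d where d: "0 < d"
      "\<And>x h. norm h < d \<Longrightarrow> \<bar>\<rho> (x + h) - \<rho> x - h \<bullet> gradient \<rho> x\<bar> \<le> e / C * norm h"
      by (rule test_functions_uniformly_differentiable[OF \<rho>]) blast
    show "\<exists>d>0. \<forall>y. norm (y - x) < d \<longrightarrow> norm (mollify \<rho> v y - mollify \<rho> v x - (y - x) \<bullet> ?D) \<le> e * norm (y - x)"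
    proof (intro exI[of _ d] conjI allI impI d(1))
      fix z assume z: "norm (z - x) < d"
      let ?r = "\<lambda>y. \<rho> (z - y) - \<rho> (x - y) - (z - x) \<bullet> gradient \<rho> (x - y)"
      have r: "\<bar>?r y\<bar> \<le> e / C * norm (z - x)" for y
        using d(2)[OF z, of "x - y"] by (simp add: algebra_simps)
      have "mollify \<rho> v z - mollify \<rho> v x - (z - x) \<bullet> ?D = (LINT y|lborel. ?r y * v y)"
        unfolding inner unfolding mollify_def using integrable_mollify[OF \<rho> v] int' by (simp add: left_diff_distrib)
      also have "\<bar>\<dots>\<bar> \<le> (LINT y|lborel. (e / C * norm (z - x)) * \<bar>v y\<bar>)"
      proof (rule integral_abs_bound[THEN order_trans], rule integral_mono)
        show "integrable lborel (\<lambda>y. \<bar>?r y * v y\<bar>)"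
          using integrable_mollify[OF \<rho> v] int' by (intro integrable_abs) (simp add: left_diff_distrib)
        show "integrable lborel (\<lambda>y. (e / C * norm (z - x)) * \<bar>v y\<bar>)" using v by simp
        show "\<bar>?r y * v y\<bar> \<le> (e / C * norm (z - x)) * \<bar>v y\<bar>" for y
          using r[of y] by (simp only: abs_mult) (intro mult_right_mono, auto)
      qed
      also have "\<dots> = e * norm (z - x) * ((LINT y|lborel. \<bar>v y\<bar>) / C)" by simp
      also have "\<dots> \<le> e * norm (z - x) * 1"
        using \<open>0 < e\<close> C by (intro mult_left_mono) (auto simp: C_def divide_simps)
      finally show "norm (mollify \<rho> v z - mollify \<rho> v x - (z - x) \<bullet> ?D) \<le> e * norm (z - x)" by simp
    qed
  qed
  then show ?thesis by (simp add: gderiv_def)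
qed

lemma gradient_mollify:
  assumes "\<rho> \<in> test_functions UNIV" "integrable lborel v" "b \<in> Basis"
  shows "gradient (mollify \<rho> v) x \<bullet> b = mollify (\<lambda>z. gradient \<rho> z \<bullet> b) v x"
  using gradient_eqI[OF GDERIV_mollify[OF assms(1,2)]] assms(3) by simp

lemma Ck_mollify:
  assumes "\<rho> \<in> test_functions UNIV" "integrable lborel v"
  shows "Ck k (mollify \<rho> v)"
  using assms(1)
proof (induction k arbitrary: \<rho>)
  case 0
  have "isCont (mollify \<rho> v) x" for x
    using GDERIV_imp_differentiable[OF GDERIV_mollify[OF 0 assms(2)]] 
    by (auto intro: differentiable_imp_continuous_within)
  then show ?case by (simp add: continuous_at_imp_continuous_on)
next
  case (Suc k)
  show ?case
  proof (rule Ck_SucI[OF GDERIV_mollify[OF Suc.prems assms(2)]])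
    fix b :: 'a assume "b \<in> Basis"
    then show "Ck k (\<lambda>x. (\<Sum>b\<in>Basis. mollify (\<lambda>z. gradient \<rho> z \<bullet> b) v x *\<^sub>R b) \<bullet> b)"
      using Suc.IH[OF test_functions_gradient_component[OF Suc.prems]] by simp
  qed
qed

lemma gradient_reflect:
  assumes "\<rho> \<in> test_functions UNIV"
  shows "gradient (\<lambda>y. \<rho> (x - y)) y = - gradient \<rho> (x - y)"
proof (rule gradient_eqI)
  have 1: "(\<rho> has_derivative (\<lambda>h. h \<bullet> gradient \<rho> (x - y))) (at (x - y))"
    using test_functions_GDERIV[OF assms] by (simp add: gderiv_def)
  have 2: "((\<lambda>y. x - y) has_derivative (\<lambda>h. - h)) (at y)"
    by (auto intro!: derivative_eq_intros)
  show "GDERIV (\<lambda>y. \<rho> (x - y)) y :> - gradient \<rho> (x - y)"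
    using has_derivative_compose[OF 2 1] by (simp add: gderiv_def)
qed

lemma test_functions_reflect:
  assumes "\<rho> \<in> test_functions UNIV" "\<And>z. e < norm z \<Longrightarrow> \<rho> z = 0" "cball x e \<subseteq> \<Omega>"
  shows "(\<lambda>y. \<rho> (x - y)) \<in> test_functions \<Omega>"
  by (rule test_functionsI[where K = "cball x e"])
     (use assms in \<open>auto intro!: Ck_reflect test_functions_Ck[OF assms(1)] simp: dist_norm\<close>)

text \<open>
The normalisation is imposed on the reflected kernel, which is the form in which it appears after the
substitution $y = x + z$ in the convolution integral.
\<close>

definition mollifier :: "real \<Rightarrow> ('a::euclidean_space \<Rightarrow> real) \<Rightarrow> bool" where
  "mollifier e \<rho> \<longleftrightarrow> \<rho> \<in> test_functions UNIV \<and> (\<forall>x. 0 \<le> \<rho> x) \<and> (\<forall>x. e < norm x \<longrightarrow> \<rho> x = 0) \<and>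
     has_bochner_integral lborel (\<lambda>x. \<rho> (- x)) 1"

lemma compact_support_integrable:
  fixes f :: "'a::euclidean_space \<Rightarrow> 'b::euclidean_space"
  assumes "continuous_on UNIV f" "compact K" "\<And>x. x \<notin> K \<Longrightarrow> f x = 0"
  shows "integrable lborel f"
proof -
  have "integrable lborel (\<lambda>x. indicator K x *\<^sub>R f x)"
    using assms by (intro borel_integrable_compact) (auto intro: continuous_on_subset)
  also have "(\<lambda>x. indicator K x *\<^sub>R f x) = f"
    using assms(3) by (fastforce simp: indicator_def)
  finally show ?thesis .
qed

lemma exists_mollifier:
  assumes "0 < e"
  shows "\<exists>\<rho> :: 'a::euclidean_space \<Rightarrow> real. mollifier e \<rho>"
proof -
  define \<beta> :: "'a \<Rightarrow> real" where "\<beta> = bump e 0"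
  have cont: "continuous_on UNIV \<beta>" using Ck_bump[of 0 e 0] by (simp add: \<beta>_def)
  have supp: "\<beta> x = 0" if "x \<notin> cball 0 e" for x
    using bump_pos_iff[OF assms, of 0 x] bump_nonneg[of e 0 x] that by (auto simp: \<beta>_def)
  have even: "\<beta> (- x) = \<beta> x" for x by (simp add: \<beta>_def bump_def)
  have int: "integrable lborel \<beta>"
    by (rule compact_support_integrable[OF cont compact_cball supp])
  define I where "I = integral\<^sup>L lborel \<beta>"
  have "0 \<le> I" unfolding I_def by (intro Bochner_Integration.integral_nonneg) (simp add: \<beta>_def bump_nonneg)
  moreover have "I \<noteq> 0"
  proof
    assume "I = 0"
    then have "AE x in lborel. \<beta> x = 0"
      using integral_nonneg_eq_0_iff_AE[OF int] by (simp add: I_def \<beta>_def bump_nonneg)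
    then have "AE x in lborel. x \<notin> ball (0::'a) e"
    proof (rule eventually_mono)
      show "x \<notin> ball 0 e" if "\<beta> x = 0" for x
        using that bump_pos_iff[OF assms, of 0 x] by (simp add: \<beta>_def)
    qed
    then have "ball (0::'a) e \<in> null_sets lborel"
      by (subst AE_iff_null_sets) auto
    then have "measure lborel (ball (0::'a) e) = 0"
      by (simp add: null_sets_def measure_def)
    then show False using content_ball_pos[OF assms, of "0::'a"] by simp
  qed
  ultimately have I: "0 < I" by simp
  have "mollifier e (\<lambda>x. \<beta> x * (1 / I))"
    unfolding mollifier_def
  proof (intro conjI allI impI)
    show "(\<lambda>x. \<beta> x * (1 / I)) \<in> test_functions UNIV"
      by (rule test_functionsI[where K = "cball 0 e"])
         (use supp in \<open>auto simp: \<beta>_def simp del: times_divide_eq_right mult_1_right intro!: Ck_mult Ck_const Ck_bump\<close>)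
    show "0 \<le> \<beta> x * (1 / I)" for x using I by (simp add: \<beta>_def bump_nonneg)
    show "\<beta> x * (1 / I) = 0" if "e < norm x" for x using supp that by simp
    show "has_bochner_integral lborel (\<lambda>x. \<beta> (- x) * (1 / I)) 1"
      using int I by (simp add: has_bochner_integral_iff even I_def)
  qed
  then show ?thesis by blast
qed

section \<open>Conjugate exponents, density, and convergence of mollified pairings\<close>

lemma powr_add_le:
  fixes a b s :: real
  assumes "0 \<le> a" "0 \<le> b" "0 \<le> s"
  shows "(a + b) powr s \<le> 2 powr s * (a powr s + b powr s)"
proof -
  have "(a + b) powr s \<le> (2 * max a b) powr s"
    using assms by (intro powr_mono2) auto
  also have "\<dots> = 2 powr s * (max a b) powr s"
    using assms by (simp add: powr_mult)
  also have "\<dots> \<le> 2 powr s * (a powr s + b powr s)"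
    by (intro mult_left_mono) (auto simp: max_def)
  finally show ?thesis .
qed

text \<open>
Young's inequality for $t|a|$ and $|b|/t$.  The free parameter $t$ replaces Hoelder's inequality: a
large bound on one factor can be offset by a small bound on the other.
\<close>

lemma scaled_Young:
  fixes a b q s t :: real
  assumes "1 < q" "1 < s" "1 / q + 1 / s = 1" "0 < t"
  shows "\<bar>a * b\<bar> \<le> t powr q * \<bar>a\<bar> powr q + t powr (- s) * \<bar>b\<bar> powr s"
proof -
  have "\<bar>a * b\<bar> = (t * \<bar>a\<bar>) * (\<bar>b\<bar> / t)" using assms by (simp add: abs_mult)
  also have "\<dots> \<le> (t * \<bar>a\<bar>) powr q / q + (\<bar>b\<bar> / t) powr s / s"
    using assms by (intro Youngs_inequality) auto
  also have "\<dots> \<le> (t * \<bar>a\<bar>) powr q + (\<bar>b\<bar> / t) powr s"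
    using assms by (intro add_mono divide_le_eq[THEN iffD2]) (auto simp: mult_le_cancel_left1)
  also have "\<dots> = t powr q * \<bar>a\<bar> powr q + t powr (- s) * \<bar>b\<bar> powr s"
    using assms by (simp add: powr_mult powr_divide powr_minus_divide)
  finally show ?thesis .
qed

lemma integrable_conjugate_product:
  fixes h v :: "'a \<Rightarrow> real"
  assumes "1 < q" "1 < s" "1 / q + 1 / s = 1"
    and [measurable]: "h \<in> borel_measurable M" "v \<in> borel_measurable M"
    and h: "integrable M (\<lambda>x. \<bar>h x\<bar> powr q)" and v: "integrable M (\<lambda>x. \<bar>v x\<bar> powr s)"
  shows "integrable M (\<lambda>x. h x * v x)"
proof (rule Bochner_Integration.integrable_bound)
  show "integrable M (\<lambda>x. \<bar>h x\<bar> powr q + \<bar>v x\<bar> powr s)" using h v by simp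
  show "AE x in M. norm (h x * v x) \<le> norm (\<bar>h x\<bar> powr q + \<bar>v x\<bar> powr s)"
    using scaled_Young[OF assms(1-3), of 1] by (intro AE_I2) simp
qed measurable

text \<open>
The soft form of Hoelder's inequality in which it is used throughout: if one factor stays bounded in
$L^q$ and the other one tends to $0$ in the conjugate space, the product tends to $0$ in $L^1$.  The
weight $t$ makes the first term of the scaled Young inequality at most $e/2$, and \<open>d\<close> then makes the
second one at most $e/2$.
\<close>

lemma conjugate_product_small:
  fixes A e q s :: real
  assumes "1 < q" "1 < s" "1 / q + 1 / s = 1" "0 \<le> A" "0 < e"
  obtains d where "0 < d"
    "\<And>(M :: 'a measure) h v. h \<in> borel_measurable M \<Longrightarrow> v \<in> borel_measurable M \<Longrightarrow>
        integrable M (\<lambda>x. \<bar>h x\<bar> powr q) \<Longrightarrow> integrable M (\<lambda>x. \<bar>v x\<bar> powr s) \<Longrightarrow>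
        (LINT x|M. \<bar>h x\<bar> powr q) \<le> A \<Longrightarrow> (LINT x|M. \<bar>v x\<bar> powr s) \<le> d \<Longrightarrow>
        (LINT x|M. \<bar>h x * v x\<bar>) \<le> e"
proof -
  define t where "t = (e / (2 * (A + 1))) powr (1 / q)"
  have t: "0 < t" using assms by (simp add: t_def)
  have tq: "t powr q = e / (2 * (A + 1))" using assms by (simp add: t_def powr_powr)
  show ?thesis
  proof (rule that)
    show "0 < e / 2 * t powr s" using t assms by simp
    fix M :: "'a measure" and h v :: "'a \<Rightarrow> real"
    assume m: "h \<in> borel_measurable M" "v \<in> borel_measurable M"
      and i: "integrable M (\<lambda>x. \<bar>h x\<bar> powr q)" "integrable M (\<lambda>x. \<bar>v x\<bar> powr s)"
      and b: "(LINT x|M. \<bar>h x\<bar> powr q) \<le> A" "(LINT x|M. \<bar>v x\<bar> powr s) \<le> e / 2 * t powr s"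
    have "(LINT x|M. \<bar>h x * v x\<bar>) \<le> (LINT x|M. t powr q * \<bar>h x\<bar> powr q + t powr (- s) * \<bar>v x\<bar> powr s)"
      using i integrable_conjugate_product[OF assms(1-3) m i] scaled_Young[OF assms(1-3) t]
      by (intro integral_mono) auto
    also have "\<dots> = t powr q * (LINT x|M. \<bar>h x\<bar> powr q) + t powr (- s) * (LINT x|M. \<bar>v x\<bar> powr s)"
      using i by simp
    also have "\<dots> \<le> t powr q * (A + 1) + t powr (- s) * (e / 2 * t powr s)"
      using b by (intro add_mono mult_left_mono) auto
    also have "\<dots> = e" using assms t tq by (simp add: powr_minus field_simps)
    finally show "(LINT x|M. \<bar>h x * v x\<bar>) \<le> e" .
  qed
qed

lemma lborel_translate:
  fixes f :: "'a::euclidean_space \<Rightarrow> 'b::{banach, second_countable_topology}"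
  assumes "f \<in> borel_measurable borel"
  shows "integrable lborel (\<lambda>x. f (c + x)) \<longleftrightarrow> integrable lborel f"
    and "(LINT x|lborel. f (c + x)) = (LINT x|lborel. f x)"
proof -
  have "integrable (distr lborel borel ((+) c)) f \<longleftrightarrow> integrable lborel (\<lambda>x. f (c + x))"
    using assms by (intro integrable_distr_eq) auto
  then show "integrable lborel (\<lambda>x. f (c + x)) \<longleftrightarrow> integrable lborel f" by (simp add: lborel_distr_plus)
  have "integral\<^sup>L (distr lborel borel ((+) c)) f = (LINT x|lborel. f (c + x))"
    using assms by (intro integral_distr) auto
  then show "(LINT x|lborel. f (c + x)) = (LINT x|lborel. f x)" by (simp add: lborel_distr_plus)
qed

text \<open>
A measurable function is an almost everywhere limit of continuous functions \<open>G n\<close>.  Clipping at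
height $k$ and cutting off at radius $k + 1$ provides an integrable majorant, so dominated convergence
applies twice: as $k \to \infty$ to the clipped function, and for fixed $k$ as $n \to \infty$.
\<close>

lemma Lp_approx_compact_support:
  fixes v :: "'a::euclidean_space \<Rightarrow> real"
  assumes v[measurable]: "v \<in> borel_measurable borel" and "0 < s"
    and int: "integrable lborel (\<lambda>x. \<bar>v x\<bar> powr s)" and "0 < e"
  obtains g K where "continuous_on UNIV g" "compact K" "\<And>x. x \<notin> K \<Longrightarrow> g x = 0"
    "integrable lborel (\<lambda>x. \<bar>v x - g x\<bar> powr s)" "(LINT x|lborel. \<bar>v x - g x\<bar> powr s) < e"
proof -
  have "v \<in> borel_measurable lebesgue" using v by (intro measurable_completion) simp
  then have "v measurable_on UNIV" by (intro lebesgue_measurable_imp_measurable_on) auto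
  then obtain N G where N: "negligible N" and G: "\<And>n. continuous_on UNIV (G n)"
    and lim: "\<And>x. x \<notin> N \<Longrightarrow> (\<lambda>n. G n x) \<longlonglongrightarrow> v x"
    by (auto simp: measurable_on_def)
  have AE: "AE x in lborel. (\<lambda>n. G n x) \<longlonglongrightarrow> v x"
  proof -
    have "AE x in lebesgue. x \<notin> N"
      using N by (subst AE_iff_null_sets[symmetric]) (auto simp: negligible_iff_null_sets)
    then show ?thesis unfolding AE_completion_iff by eventually_elim (rule lim)
  qed
  define clip where "clip k t = max (- real k) (min (real k) t)" for k t
  define \<theta> where "\<theta> k x = max 0 (min 1 (real k + 1 - norm x))" for k and x :: 'a
  have clip_cont: "continuous_on UNIV (clip k)" for k
    unfolding clip_def[abs_def] by (intro continuous_intros)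
  have \<theta>_cont: "continuous_on UNIV (\<theta> k)" for k
    unfolding \<theta>_def[abs_def] by (intro continuous_intros)
  have \<theta>01: "0 \<le> \<theta> k x" "\<theta> k x \<le> 1" for k x by (auto simp: \<theta>_def)
  have \<theta>0: "\<theta> k x = 0" if "x \<notin> cball 0 (real k + 1)" for k x using that by (auto simp: \<theta>_def)
  have [measurable]: "clip k \<in> borel_measurable borel" "\<theta> k \<in> borel_measurable borel" "G n \<in> borel_measurable borel" for k n
    using clip_cont \<theta>_cont G by (auto intro: continuous_imp_borel)
  have "(\<lambda>k. LINT x|lborel. \<bar>v x - clip k (v x) * \<theta> k x\<bar> powr s) \<longlonglongrightarrow> (LINT x|(lborel :: 'a measure). 0)"
  proof (rule integral_dominated_convergence[where w = "\<lambda>x. \<bar>v x\<bar> powr s"])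
    show "AE x in lborel. (\<lambda>k. \<bar>v x - clip k (v x) * \<theta> k x\<bar> powr s) \<longlonglongrightarrow> 0"
    proof (rule AE_I2, rule tendsto_eventually)
      fix x :: 'a
      obtain k0 where k0: "max \<bar>v x\<bar> (norm x) \<le> real k0" using real_arch_simple by blast
      show "\<forall>\<^sub>F k in sequentially. \<bar>v x - clip k (v x) * \<theta> k x\<bar> powr s = 0"
      proof (rule eventually_sequentiallyI)
        fix k assume "k0 \<le> k"
        then have "max \<bar>v x\<bar> (norm x) \<le> real k" using k0 by (meson of_nat_le_iff order_trans)
        then have "clip k (v x) = v x" "\<theta> k x = 1" by (auto simp: clip_def \<theta>_def)
        then show "\<bar>v x - clip k (v x) * \<theta> k x\<bar> powr s = 0" by simp
      qed
    qed
    show "AE x in lborel. norm (\<bar>v x - clip k (v x) * \<theta> k x\<bar> powr s) \<le> \<bar>v x\<bar> powr s" for k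
    proof (rule AE_I2)
      fix x :: 'a
      have "\<bar>v x - clip k (v x) * \<theta> k x\<bar> \<le> \<bar>v x\<bar>"
      proof (cases "0 \<le> v x")
        case True
        then have "0 \<le> clip k (v x)" "clip k (v x) \<le> v x" by (auto simp: clip_def)
        then have "0 \<le> clip k (v x) * \<theta> k x" "clip k (v x) * \<theta> k x \<le> v x * 1"
          using \<theta>01[of k x] True by (auto intro!: mult_mono mult_nonneg_nonneg simp del: mult_1_right)
        then show ?thesis using True by auto
      next
        case False
        then have "0 \<le> - clip k (v x)" "- clip k (v x) \<le> - v x" by (auto simp: clip_def)
        then have "0 \<le> (- clip k (v x)) * \<theta> k x" "(- clip k (v x)) * \<theta> k x \<le> (- v x) * 1"
          using \<theta>01[of k x] False
          by (intro mult_mono mult_nonneg_nonneg; simp)+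
        then show ?thesis using False by auto
      qed
      then show "norm (\<bar>v x - clip k (v x) * \<theta> k x\<bar> powr s) \<le> \<bar>v x\<bar> powr s"
        using assms(2) by (auto intro!: powr_mono2)
    qed
  qed (use int in measurable)
  then have "\<forall>\<^sub>F k in sequentially. (LINT x|lborel. \<bar>v x - clip k (v x) * \<theta> k x\<bar> powr s) < e"
    using assms(4) by (auto intro: order_tendstoD)
  then obtain k where k: "(LINT x|lborel. \<bar>v x - clip k (v x) * \<theta> k x\<bar> powr s) < e"
    by (auto simp: eventually_sequentially)
  define W where "W x = 2 powr s * (\<bar>v x\<bar> powr s + (real k * indicator (cball 0 (real k + 1)) x) powr s)" for x
  have "integrable lborel (\<lambda>x::'a. real k powr s * indicator (cball 0 (real k + 1)) x)"
    by (intro integrable_mult_right integrable_real_indicator emeasure_lborel_cball_finite) simp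
  then have ind: "integrable lborel (\<lambda>x::'a. (real k * indicator (cball 0 (real k + 1)) x) powr s)"
    by (rule Bochner_Integration.integrable_cong[THEN iffD1, rotated 2])
       (use assms(2) in \<open>auto simp: indicator_def\<close>)
  have W: "integrable lborel W"
    unfolding W_def[abs_def] using int ind by (intro integrable_mult_right Bochner_Integration.integrable_add)
  have dom: "norm (\<bar>v x - clip k (G n x) * \<theta> k x\<bar> powr s) \<le> W x" for n x
  proof -
    have "\<bar>clip k (G n x) * \<theta> k x\<bar> \<le> real k * indicator (cball 0 (real k + 1)) x"
    proof (cases "x \<in> cball 0 (real k + 1)")
      case True
      have "\<bar>clip k (G n x)\<bar> * \<bar>\<theta> k x\<bar> \<le> real k * 1"
        using \<theta>01[of k x] by (intro mult_mono) (auto simp: clip_def)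
      then show ?thesis using True by (simp add: abs_mult)
    qed (simp add: \<theta>0)
    then have "\<bar>v x - clip k (G n x) * \<theta> k x\<bar> \<le> \<bar>v x\<bar> + real k * indicator (cball 0 (real k + 1)) x"
      by linarith
    then have "\<bar>v x - clip k (G n x) * \<theta> k x\<bar> powr s \<le> (\<bar>v x\<bar> + real k * indicator (cball 0 (real k + 1)) x) powr s"
      using assms(2) by (intro powr_mono2) auto
    also have "\<dots> \<le> W x" unfolding W_def using assms(2) by (intro powr_add_le) auto
    finally show ?thesis by simp
  qed
  have lims: "(\<lambda>n. LINT x|lborel. \<bar>v x - clip k (G n x) * \<theta> k x\<bar> powr s) \<longlonglongrightarrow>
      (LINT x|lborel. \<bar>v x - clip k (v x) * \<theta> k x\<bar> powr s)"
  proof (rule integral_dominated_convergence[OF _ _ W])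
    show "AE x in lborel. (\<lambda>n. \<bar>v x - clip k (G n x) * \<theta> k x\<bar> powr s) \<longlonglongrightarrow> \<bar>v x - clip k (v x) * \<theta> k x\<bar> powr s"
      using AE
    proof eventually_elim
      fix x assume "(\<lambda>n. G n x) \<longlonglongrightarrow> v x"
      moreover have "isCont (clip k) (v x)"
        using clip_cont[of k] by (simp add: continuous_on_eq_continuous_at)
      ultimately have "(\<lambda>n. clip k (G n x)) \<longlonglongrightarrow> clip k (v x)"
        by (rule isCont_tendsto_compose[rotated])
      then have "(\<lambda>n. \<bar>v x - clip k (G n x) * \<theta> k x\<bar>) \<longlonglongrightarrow> \<bar>v x - clip k (v x) * \<theta> k x\<bar>"
        by (rule tendsto_rabs[OF tendsto_diff[OF tendsto_const tendsto_mult[OF _ tendsto_const]]])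
      then show "(\<lambda>n. \<bar>v x - clip k (G n x) * \<theta> k x\<bar> powr s) \<longlonglongrightarrow> \<bar>v x - clip k (v x) * \<theta> k x\<bar> powr s"
        by (rule tendsto_powr'[OF _ tendsto_const]) (use assms(2) in simp)
    qed
    show "AE x in lborel. norm (\<bar>v x - clip k (G n x) * \<theta> k x\<bar> powr s) \<le> W x" for n
      using dom by (rule AE_I2)
  qed measurable
  then have "\<forall>\<^sub>F n in sequentially. (LINT x|lborel. \<bar>v x - clip k (G n x) * \<theta> k x\<bar> powr s) < e"
    using k by (auto intro: order_tendstoD)
  then obtain n where n: "(LINT x|lborel. \<bar>v x - clip k (G n x) * \<theta> k x\<bar> powr s) < e"
    by (auto simp: eventually_sequentially)
  show ?thesis
  proof (rule that[OF _ _ _ _ n])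
    show "continuous_on UNIV (\<lambda>x. clip k (G n x) * \<theta> k x)"
      by (intro continuous_on_mult \<theta>_cont continuous_on_compose2[OF clip_cont G]) auto
    show "integrable lborel (\<lambda>x. \<bar>v x - clip k (G n x) * \<theta> k x\<bar> powr s)"
    proof (rule Bochner_Integration.integrable_bound[OF W])
      show "AE x in lborel. norm (\<bar>v x - clip k (G n x) * \<theta> k x\<bar> powr s) \<le> norm (W x)"
        using dom[of _ n] by (intro AE_I2) (simp add: order_trans[OF _ abs_ge_self])
    qed measurable
    show "compact (cball (0 :: 'a) (real k + 1))" by simp
    show "clip k (G n x) * \<theta> k x = 0" if "x \<notin> cball 0 (real k + 1)" for x using \<theta>0[OF that] by simp
  qed
qed

text \<open>
Fubini's theorem writes the pairing with a mollification as an average of the translated pairings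
$H(z) = \int h(x)\,v(z + x)\,dx$.  The double integral converges absolutely since $|H|$ is bounded, by
Young's inequality and translation invariance.
\<close>

lemma integral_mult_mollify:
  fixes h v \<rho> :: "'a::euclidean_space \<Rightarrow> real"
  assumes qs: "1 < q" "1 < s" "1 / q + 1 / s = 1"
    and [measurable]: "h \<in> borel_measurable borel" "v \<in> borel_measurable borel"
    and h: "integrable lborel (\<lambda>x. \<bar>h x\<bar> powr q)" and v: "integrable lborel (\<lambda>x. \<bar>v x\<bar> powr s)"
    and \<rho>: "mollifier e \<rho>"
  shows "integrable lborel (\<lambda>z. \<rho> (- z) * (LINT x|lborel. h x * v (z + x)))"
    and "(LINT x|lborel. h x * mollify \<rho> v x) = (LINT z|lborel. \<rho> (- z) * (LINT x|lborel. h x * v (z + x)))"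
proof -
  have [measurable]: "\<rho> \<in> borel_measurable borel"
    using \<rho> test_functions_borel by (auto simp: mollifier_def)
  have \<rho>0: "0 \<le> \<rho> x" for x using \<rho> by (simp add: mollifier_def)
  have \<rho>i: "integrable lborel (\<lambda>z. \<rho> (- z))" using \<rho> by (auto simp: mollifier_def has_bochner_integral_iff)
  let ?f = "\<lambda>z x. \<rho> (- z) * (h x * v (z + x))"
  let ?C = "(LINT x|lborel. \<bar>h x\<bar> powr q) + (LINT x|lborel. \<bar>v x\<bar> powr s)"
  have vt: "integrable lborel (\<lambda>x. \<bar>v (z + x)\<bar> powr s)"
      "(LINT x|lborel. \<bar>v (z + x)\<bar> powr s) = (LINT x|lborel. \<bar>v x\<bar> powr s)" for z
    using lborel_translate[of "\<lambda>x. \<bar>v x\<bar> powr s" z] v by auto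
  have int: "integrable lborel (\<lambda>x. h x * v (z + x))" for z
    by (rule integrable_conjugate_product[OF qs _ _ h vt(1)]) auto
  have bound: "(LINT x|lborel. \<bar>h x * v (z + x)\<bar>) \<le> ?C" for z
  proof -
    have "(LINT x|lborel. \<bar>h x * v (z + x)\<bar>) \<le> (LINT x|lborel. \<bar>h x\<bar> powr q + \<bar>v (z + x)\<bar> powr s)"
      using int[of z] h vt(1)[of z] scaled_Young[OF qs, of 1] by (intro integral_mono) auto
    then show ?thesis using h vt[of z] by simp
  qed
  have "integrable (lborel \<Otimes>\<^sub>M lborel) (case_prod ?f)"
  proof (rule lborel_pair.Fubini_integrable)
    show "case_prod ?f \<in> borel_measurable (lborel \<Otimes>\<^sub>M lborel)" by measurable
    show "AE z in lborel. integrable lborel (\<lambda>x. case (z, x) of (z, x) \<Rightarrow> ?f z x)"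
      using int by auto
    have eq: "(LINT x|lborel. norm (case (z, x) of (z, x) \<Rightarrow> ?f z x)) = \<rho> (- z) * (LINT x|lborel. \<bar>h x * v (z + x)\<bar>)" for z
      using \<rho>0 by (simp add: abs_mult)
    show "integrable lborel (\<lambda>z. LINT x|lborel. norm (case (z, x) of (z, x) \<Rightarrow> ?f z x))"
      unfolding eq
    proof (rule Bochner_Integration.integrable_bound)
      show "integrable lborel (\<lambda>z. \<rho> (- z) * ?C)" using \<rho>i by simp
      show "AE z in lborel. norm (\<rho> (- z) * (LINT x|lborel. \<bar>h x * v (z + x)\<bar>)) \<le> norm (\<rho> (- z) * ?C)"
        using \<rho>0 bound
        by (intro AE_I2) (auto simp: abs_mult intro!: mult_left_mono order_trans[OF _ abs_ge_self])
    qed measurable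
  qed
  then have "(LINT x|lborel. LINT z|lborel. ?f z x) = (LINT z|lborel. LINT x|lborel. ?f z x)"
    and "integrable lborel (\<lambda>z. LINT x|lborel. ?f z x)"
    by (rule lborel_pair.Fubini_integral, rule lborel_pair.integrable_fst)
  moreover have "(LINT z|lborel. ?f z x) = h x * mollify \<rho> v x" for x
  proof -
    have "mollify \<rho> v x = (LINT z|lborel. \<rho> (x - (x + z)) * v (x + z))"
      unfolding mollify_def by (rule lborel_translate(2)[symmetric]) measurable
    then have "h x * mollify \<rho> v x = (LINT z|lborel. h x * (\<rho> (- z) * v (z + x)))"
      by (simp add: add.commute)
    then show ?thesis by (simp only: mult.left_commute)
  qed
  ultimately show "integrable lborel (\<lambda>z. \<rho> (- z) * (LINT x|lborel. h x * v (z + x)))"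
    and "(LINT x|lborel. h x * mollify \<rho> v x) = (LINT z|lborel. \<rho> (- z) * (LINT x|lborel. h x * v (z + x)))"
    by simp_all
qed

text \<open>
Continuity at $0$ of $z \mapsto \int h(x)\,v(z + x)\,dx$.  It is clear, by uniform continuity, for a
compactly supported continuous function $g$ in place of $v$; replacing $v$ by a good approximation
$g$ costs little uniformly in $z$, because Lebesgue measure is translation invariant.
\<close>

lemma translation_pairing_continuous:
  fixes h v :: "'a::euclidean_space \<Rightarrow> real"
  assumes qs: "1 < q" "1 < s" "1 / q + 1 / s = 1"
    and [measurable]: "h \<in> borel_measurable borel" "v \<in> borel_measurable borel"
    and h: "integrable lborel (\<lambda>x. \<bar>h x\<bar> powr q)" and v: "integrable lborel (\<lambda>x. \<bar>v x\<bar> powr s)"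
    and h1: "integrable lborel h" and "0 < \<eta>"
  obtains d where "0 < d"
    "\<And>z. norm z < d \<Longrightarrow> \<bar>(LINT x|lborel. h x * v (z + x)) - (LINT x|lborel. h x * v x)\<bar> \<le> \<eta>"
proof -
  obtain c where c: "0 < c"
    "\<And>w :: 'a \<Rightarrow> real. w \<in> borel_measurable lborel \<Longrightarrow> integrable lborel (\<lambda>x. \<bar>w x\<bar> powr s) \<Longrightarrow>
       (LINT x|lborel. \<bar>w x\<bar> powr s) \<le> c \<Longrightarrow> (LINT x|lborel. \<bar>h x * w x\<bar>) \<le> \<eta> / 3"
  proof -
    have "0 \<le> (LINT x|lborel. \<bar>h x\<bar> powr q)" "0 < \<eta> / 3"
      using assms by (auto intro: Bochner_Integration.integral_nonneg)
    from conjugate_product_small[OF qs this, where 'a = 'a] obtain c where "0 < c" and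
      "\<And>(M :: 'a measure) h' v. h' \<in> borel_measurable M \<Longrightarrow> v \<in> borel_measurable M \<Longrightarrow>
        integrable M (\<lambda>x. \<bar>h' x\<bar> powr q) \<Longrightarrow> integrable M (\<lambda>x. \<bar>v x\<bar> powr s) \<Longrightarrow>
        (LINT x|M. \<bar>h' x\<bar> powr q) \<le> (LINT x|lborel. \<bar>h x\<bar> powr q) \<Longrightarrow> (LINT x|M. \<bar>v x\<bar> powr s) \<le> c \<Longrightarrow>
        (LINT x|M. \<bar>h' x * v x\<bar>) \<le> \<eta> / 3" by blast
    from this(1) this(2)[OF _ _ h] show ?thesis by (intro that[of c]) auto
  qed
  obtain g K where g: "continuous_on UNIV g" "compact K" "\<And>x. x \<notin> K \<Longrightarrow> g x = 0"
    "integrable lborel (\<lambda>x. \<bar>v x - g x\<bar> powr s)" "(LINT x|lborel. \<bar>v x - g x\<bar> powr s) < c"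
    using Lp_approx_compact_support[of v s c] qs v c(1) by auto
  have [measurable]: "g \<in> borel_measurable borel" using g by (intro continuous_imp_borel)
  define A where "A = (LINT x|lborel. \<bar>h x\<bar>) + 1"
  have A: "0 < A" unfolding A_def by (intro add_nonneg_pos Bochner_Integration.integral_nonneg) auto
  then have "0 < \<eta> / (3 * A)" using assms by simp
  then obtain d where d: "0 < d" "\<And>x y. dist x y < d \<Longrightarrow> dist (g x) (g y) < \<eta> / (3 * A)"
    using compact_support_uniformly_continuous[OF g(1-3)] by metis
  obtain B where B: "\<And>x. \<bar>g x\<bar> \<le> B" using compact_support_bounded[OF g(1-3)] by auto
  have hg: "integrable lborel (\<lambda>x. h x * g (z + x))" for z
  proof (rule Bochner_Integration.integrable_bound)
    show "integrable lborel (\<lambda>x. B * h x)" using h1 by simp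
    show "AE x in lborel. norm (h x * g (z + x)) \<le> norm (B * h x)"
    proof (rule AE_I2)
      fix x :: 'a
      have "\<bar>g (z + x)\<bar> \<le> \<bar>B\<bar>" using B[of "z + x"] by simp
      then have "\<bar>g (z + x)\<bar> * \<bar>h x\<bar> \<le> \<bar>B\<bar> * \<bar>h x\<bar>" by (rule mult_right_mono) simp
      then show "norm (h x * g (z + x)) \<le> norm (B * h x)" by (simp add: abs_mult mult.commute)
    qed
  qed measurable
  have wt: "integrable lborel (\<lambda>x. \<bar>v (z + x) - g (z + x)\<bar> powr s)"
      "(LINT x|lborel. \<bar>v (z + x) - g (z + x)\<bar> powr s) < c" for z
    using lborel_translate[of "\<lambda>x. \<bar>v x - g x\<bar> powr s" z] g(4,5) by auto
  have hw: "integrable lborel (\<lambda>x. h x * (v (z + x) - g (z + x)))" for z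
    by (rule integrable_conjugate_product[OF qs _ _ h wt(1)]) auto
  have w: "\<bar>LINT x|lborel. h x * (v (z + x) - g (z + x))\<bar> \<le> \<eta> / 3" for z
    using wt[of z] by (intro order_trans[OF integral_abs_bound] c(2)) auto
  have split: "(LINT x|lborel. h x * v (z + x)) =
      (LINT x|lborel. h x * (v (z + x) - g (z + x))) + (LINT x|lborel. h x * g (z + x))" for z
    using Bochner_Integration.integral_add[OF hw[of z] hg[of z]] by (simp add: algebra_simps)
  show ?thesis
  proof (rule that[OF d(1)])
    fix z :: 'a assume z: "norm z < d"
    have "(LINT x|lborel. h x * g (z + x)) - (LINT x|lborel. h x * g (0 + x)) = (LINT x|lborel. h x * (g (z + x) - g x))"
      using Bochner_Integration.integral_diff[OF hg[of z] hg[of 0]] by (simp add: algebra_simps)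
    also have "\<bar>\<dots>\<bar> \<le> (LINT x|lborel. \<eta> / (3 * A) * \<bar>h x\<bar>)"
    proof (rule integral_abs_bound[THEN order_trans], rule integral_mono)
      show "integrable lborel (\<lambda>x. \<bar>h x * (g (z + x) - g x)\<bar>)"
        using Bochner_Integration.integrable_diff[OF hg[of z] hg[of 0]] by (simp add: algebra_simps)
      show "\<bar>h x * (g (z + x) - g x)\<bar> \<le> \<eta> / (3 * A) * \<bar>h x\<bar>" for x
      proof -
        have "\<bar>g (z + x) - g x\<bar> \<le> \<eta> / (3 * A)"
          using d(2)[of "z + x" x] z by (simp add: dist_norm)
        then have "\<bar>g (z + x) - g x\<bar> * \<bar>h x\<bar> \<le> \<eta> / (3 * A) * \<bar>h x\<bar>"
          by (rule mult_right_mono) simp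
        then show ?thesis by (simp only: abs_mult mult.commute)
      qed
    qed (use h1 in simp)
    also have "\<dots> = \<eta> / 3 * ((LINT x|lborel. \<bar>h x\<bar>) / A)" by simp
    also have "\<dots> \<le> \<eta> / 3 * 1"
      using A assms by (intro mult_left_mono) (auto simp: A_def divide_simps)
    finally have "\<bar>(LINT x|lborel. h x * g (z + x)) - (LINT x|lborel. h x * g (0 + x))\<bar> \<le> \<eta> / 3" by simp
    then have "\<bar>(LINT x|lborel. h x * v (z + x)) - (LINT x|lborel. h x * v (0 + x))\<bar> \<le> \<eta>"
      using split[of z] split[of 0] w[of z] w[of 0] by linarith
    then show "\<bar>(LINT x|lborel. h x * v (z + x)) - (LINT x|lborel. h x * v x)\<bar> \<le> \<eta>" by simp
  qed
qed

lemma mollify_pairing_tendsto: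
  fixes h v :: "'a::euclidean_space \<Rightarrow> real" and \<rho> :: "nat \<Rightarrow> 'a \<Rightarrow> real"
  assumes qs: "1 < q" "1 < s" "1 / q + 1 / s = 1"
    and m: "h \<in> borel_measurable borel" "v \<in> borel_measurable borel"
    and h: "integrable lborel (\<lambda>x. \<bar>h x\<bar> powr q)" and v: "integrable lborel (\<lambda>x. \<bar>v x\<bar> powr s)"
    and h1: "integrable lborel h"
    and \<rho>: "\<And>n. mollifier (e n) (\<rho> n)" and e: "e \<longlonglongrightarrow> 0"
  shows "(\<lambda>n. LINT x|lborel. h x * mollify (\<rho> n) v x) \<longlonglongrightarrow> (LINT x|lborel. h x * v x)"
proof (rule LIMSEQ_I)
  fix \<eta> :: real assume "0 < \<eta>"
  then have "0 < \<eta> / 2" by simp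
  then obtain d where d: "0 < d"
    "\<And>z. norm z < d \<Longrightarrow> \<bar>(LINT x|lborel. h x * v (z + x)) - (LINT x|lborel. h x * v x)\<bar> \<le> \<eta> / 2"
    by (rule translation_pairing_continuous[OF qs m h v h1]) blast
  obtain n0 where n0: "\<And>n. n0 \<le> n \<Longrightarrow> e n < d"
    using order_tendstoD(2)[OF e d(1)] by (auto simp: eventually_sequentially)
  let ?H = "\<lambda>z. LINT x|lborel. h x * v (z + x)" and ?L = "LINT x|lborel. h x * v x"
  have "norm ((LINT x|lborel. h x * mollify (\<rho> n) v x) - ?L) < \<eta>" if n: "n0 \<le> n" for n
  proof -
    have \<rho>0: "0 \<le> \<rho> n z" for z using \<rho>[of n] by (simp add: mollifier_def)
    have \<rho>i: "integrable lborel (\<lambda>z. \<rho> n (- z))" "(LINT z|lborel. \<rho> n (- z)) = 1"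
      using \<rho>[of n] by (auto simp: mollifier_def has_bochner_integral_iff)
    note H = integral_mult_mollify[OF qs m h v \<rho>[of n]]
    have "(LINT x|lborel. h x * mollify (\<rho> n) v x) - ?L = (LINT z|lborel. \<rho> n (- z) * (?H z - ?L))"
      using H \<rho>i by (simp add: right_diff_distrib)
    also have "\<bar>\<dots>\<bar> \<le> (LINT z|lborel. \<rho> n (- z) * (\<eta> / 2))"
    proof (rule integral_abs_bound[THEN order_trans], rule integral_mono)
      show "integrable lborel (\<lambda>z. \<bar>\<rho> n (- z) * (?H z - ?L)\<bar>)"
        using H(1) \<rho>i by (intro integrable_abs) (simp add: right_diff_distrib)
      show "\<bar>\<rho> n (- z) * (?H z - ?L)\<bar> \<le> \<rho> n (- z) * (\<eta> / 2)" for z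
      proof (cases "norm z < d")
        case True
        then show ?thesis using mult_left_mono[OF d(2) \<rho>0] \<rho>0 by (simp add: abs_mult)
      next
        case False
        then have "\<rho> n (- z) = 0" using \<rho>[of n] n0[OF n] by (auto simp: mollifier_def)
        then show ?thesis by simp
      qed
    qed (use \<rho>i in simp)
    also have "\<dots> = \<eta> / 2" using \<rho>i by simp
    finally show ?thesis using \<open>0 < \<eta>\<close> by simp
  qed
  then show "\<exists>n0. \<forall>n\<ge>n0. norm ((LINT x|lborel. h x * mollify (\<rho> n) v x) - ?L) < \<eta>" by blast
qed

section \<open>Testing a weak equation with a Sobolev function\<close>

lemma integrable_mult_bounded_powr:
  fixes h \<phi> :: "'a \<Rightarrow> real"
  assumes [measurable]: "h \<in> borel_measurable M" "\<phi> \<in> borel_measurable M"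
    and h: "integrable M (\<lambda>x. \<bar>h x\<bar> powr q)" and B: "\<And>x. \<bar>\<phi> x\<bar> \<le> B" and "0 \<le> q"
  shows "integrable M (\<lambda>x. \<bar>h x * \<phi> x\<bar> powr q)"
proof (rule Bochner_Integration.integrable_bound)
  show "integrable M (\<lambda>x. \<bar>h x\<bar> powr q * B powr q)" using h by simp
  show "AE x in M. norm (\<bar>h x * \<phi> x\<bar> powr q) \<le> norm (\<bar>h x\<bar> powr q * B powr q)"
  proof (rule AE_I2)
    fix x
    have "0 \<le> B" using B[of x] by linarith
    have "\<bar>h x * \<phi> x\<bar> powr q \<le> (\<bar>h x\<bar> * B) powr q"
      unfolding abs_mult using assms(5) B[of x] by (intro powr_mono2 mult_left_mono) auto
    then show "norm (\<bar>h x * \<phi> x\<bar> powr q) \<le> norm (\<bar>h x\<bar> powr q * B powr q)"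
      using \<open>0 \<le> B\<close> by (simp add: powr_mult)
  qed
qed measurable

lemma integrable_mult_bounded:
  fixes h \<phi> :: "'a \<Rightarrow> real"
  assumes [measurable]: "\<phi> \<in> borel_measurable M"
    and h: "integrable M h" and B: "\<And>x. \<bar>\<phi> x\<bar> \<le> B"
  shows "integrable M (\<lambda>x. h x * \<phi> x)"
proof (rule Bochner_Integration.integrable_bound)
  show "integrable M (\<lambda>x. h x * B)" using h by simp
  show "AE x in M. norm (h x * \<phi> x) \<le> norm (h x * B)"
    using B by (intro AE_I2) (simp add: abs_mult mult_left_mono order_trans[OF _ abs_ge_self])
qed (use h in measurable)

lemma integrable_inner_bounded:
  fixes F g :: "'a \<Rightarrow> 'b::euclidean_space"
  assumes F: "integrable M F" and [measurable]: "g \<in> borel_measurable M" and B: "\<And>x. norm (g x) \<le> B"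
  shows "integrable M (\<lambda>x. F x \<bullet> g x)"
proof (rule Bochner_Integration.integrable_bound)
  show "integrable M (\<lambda>x. norm (F x) * B)" using F by simp
  show "AE x in M. norm (F x \<bullet> g x) \<le> norm (norm (F x) * B)"
  proof (rule AE_I2)
    fix x
    have "\<bar>F x \<bullet> g x\<bar> \<le> norm (F x) * norm (g x)" by (rule Cauchy_Schwarz_ineq2)
    also have "\<dots> \<le> norm (F x) * B" using B by (intro mult_left_mono) auto
    finally show "norm (F x \<bullet> g x) \<le> norm (norm (F x) * B)" by simp
  qed
qed (use F in measurable)

lemma integrable_powr_inner:
  fixes F :: "'a \<Rightarrow> 'b::euclidean_space"
  assumes [measurable]: "F \<in> borel_measurable M" and i: "integrable M (\<lambda>x. norm (F x) powr p)"
    and "b \<in> Basis" "0 \<le> p"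
  shows "integrable M (\<lambda>x. \<bar>F x \<bullet> b\<bar> powr p)"
proof (rule Bochner_Integration.integrable_bound[OF i])
  show "AE x in M. norm (\<bar>F x \<bullet> b\<bar> powr p) \<le> norm (norm (F x) powr p)"
    using assms(3,4) by (intro AE_I2) (auto intro!: powr_mono2 Basis_le_norm)
qed measurable

lemma mollify_bounded:
  assumes "\<rho> \<in> test_functions UNIV" "integrable lborel v"
  obtains B where "\<And>x. \<bar>mollify \<rho> v x\<bar> \<le> B"
proof -
  obtain B where B: "0 < B" "\<And>x. \<bar>\<rho> x\<bar> \<le> B" by (rule test_functions_bounded[OF assms(1)]) blast
  show ?thesis
  proof (rule that)
    fix x
    show "\<bar>mollify \<rho> v x\<bar> \<le> (LINT y|lborel. B * \<bar>v y\<bar>)"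
      unfolding mollify_def
    proof (rule integral_abs_bound[THEN order_trans], rule integral_mono)
      show "integrable lborel (\<lambda>y. \<bar>\<rho> (x - y) * v y\<bar>)"
        using integrable_mollify[OF assms] by (rule integrable_abs)
      show "\<bar>\<rho> (x - y) * v y\<bar> \<le> B * \<bar>v y\<bar>" for y
        using B by (simp add: abs_mult mult_right_mono)
    qed (use assms in simp)
  qed
qed

lemma integrable_mult_mollify:
  assumes "\<rho> \<in> test_functions UNIV" "integrable lborel v" "integrable lborel h"
  shows "integrable lborel (\<lambda>x. h x * mollify \<rho> v x)"
proof -
  obtain B where B: "\<And>x. \<bar>mollify \<rho> v x\<bar> \<le> B" using mollify_bounded[OF assms(1,2)] by blast
  have "continuous_on UNIV (mollify \<rho> v)" using Ck_mollify[OF assms(1,2), of 0] by simp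
  then have "mollify \<rho> v \<in> borel_measurable lborel" using continuous_imp_borel by auto
  then show ?thesis by (rule integrable_mult_bounded[OF _ assms(3) B])
qed

text \<open>
The function $y \mapsto \rho(x - y)$ is itself a test function, and the weak gradient identity for it
says that differentiating the kernel amounts to mollifying the weak derivative.
\<close>

lemma mollify_weak_derivative:
  fixes w g \<rho> :: "'a::euclidean_space \<Rightarrow> real"
  assumes \<rho>: "\<rho> \<in> test_functions UNIV" "\<And>z. e < norm z \<Longrightarrow> \<rho> z = 0" and x: "cball x e \<subseteq> L"
    and weak: "\<And>\<psi>. \<psi> \<in> test_functions L \<Longrightarrow>
      (LINT y|lborel. w y * (gradient \<psi> y \<bullet> b)) = - (LINT y|lborel. g y * \<psi> y)"
  shows "mollify (\<lambda>z. gradient \<rho> z \<bullet> b) w x = mollify \<rho> g x"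
proof -
  have "(\<lambda>y. \<rho> (x - y)) \<in> test_functions L"
    by (rule test_functions_reflect[OF \<rho> x])
  from weak[OF this] show ?thesis
    unfolding gradient_reflect[OF \<rho>(1)] by (simp add: mollify_def mult.commute)
qed

text \<open>
The equation $-\mathrm{div}\,F = f$ may be tested with $\varphi w$ for a Sobolev function $w$ with weak
gradient $G$.  With $w_n$ a mollification of $w$, the product $\varphi w_n$ is a test function whose
gradient is $\varphi\,\nabla w_n + w_n\,\nabla\varphi$, and $\nabla w_n$ is the mollification of $G$ where
$\varphi \ne 0$.  Every term is thus a pairing with a mollified function, and the limit is taken term by
term; $F$ pairs with $L^p$ and $f$ with $L^r$, whence the two pairs of exponents.
\<close>

lemma weak_equation_product_test:
  fixes w f \<phi> :: "'a::euclidean_space \<Rightarrow> real" and F G :: "'a \<Rightarrow> 'a"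
  assumes pq: "1 < p" "1 < p'" "1 / p' + 1 / p = 1" and rs: "1 < r" "1 < r'" "1 / r' + 1 / r = 1"
    and m[measurable]: "w \<in> borel_measurable borel" "f \<in> borel_measurable borel"
      "F \<in> borel_measurable borel" "G \<in> borel_measurable borel"
    and w: "integrable lborel w" "integrable lborel (\<lambda>x. \<bar>w x\<bar> powr p)" "integrable lborel (\<lambda>x. \<bar>w x\<bar> powr r)"
    and G: "integrable lborel G" "\<And>b. b \<in> Basis \<Longrightarrow> integrable lborel (\<lambda>x. \<bar>G x \<bullet> b\<bar> powr p)"
    and f: "integrable lborel f" "integrable lborel (\<lambda>x. \<bar>f x\<bar> powr r')"
    and F: "integrable lborel F" "\<And>b. b \<in> Basis \<Longrightarrow> integrable lborel (\<lambda>x. \<bar>F x \<bullet> b\<bar> powr p')"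
    and \<phi>: "\<phi> \<in> test_functions K" and e0: "0 < e0" "\<And>x. x \<in> K \<Longrightarrow> cball x e0 \<subseteq> L" and KL: "K \<subseteq> L"
    and weak: "\<And>\<psi> b. \<psi> \<in> test_functions L \<Longrightarrow> b \<in> Basis \<Longrightarrow>
      (LINT y|lborel. w y * (gradient \<psi> y \<bullet> b)) = - (LINT y|lborel. (G y \<bullet> b) * \<psi> y)"
    and eqn: "\<And>\<psi>. \<psi> \<in> test_functions L \<Longrightarrow>
      (LINT x|lborel. F x \<bullet> gradient \<psi> x) = (LINT x|lborel. f x * \<psi> x)"
  shows "(LINT x|lborel. (F x \<bullet> G x) * \<phi> x) + (LINT x|lborel. (F x \<bullet> gradient \<phi> x) * w x)
      = (LINT x|lborel. (f x * \<phi> x) * w x)"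
    and "integrable lborel (\<lambda>x. (F x \<bullet> G x) * \<phi> x)"
proof -
  \<comment> \<open>Radii at most \<open>e0\<close>, so that every mollification stays inside the collar, and tending to 0.\<close>
  define e where "e n = e0 / real (Suc n)" for n
  have e: "0 < e n" "e n \<le> e0" for n using e0(1) by (auto simp: e_def divide_simps)
  have "(\<lambda>n. e0 * (1 / real (Suc n))) \<longlonglongrightarrow> e0 * 0" by (intro tendsto_mult tendsto_const LIMSEQ_Suc lim_1_over_n)
  then have e_lim: "e \<longlonglongrightarrow> 0" by (simp add: e_def[abs_def])
  have "\<exists>\<rho>. mollifier (e n) (\<rho> :: 'a \<Rightarrow> real)" for n using exists_mollifier[OF e(1)] .
  then obtain \<rho> :: "nat \<Rightarrow> 'a \<Rightarrow> real" where \<rho>: "\<And>n. mollifier (e n) (\<rho> n)" by metis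
  have \<rho>t: "\<rho> n \<in> test_functions UNIV" and \<rho>0: "e n < norm z \<Longrightarrow> \<rho> n z = 0" for n z
    using \<rho>[of n] by (auto simp: mollifier_def)
  have \<phi>L: "\<phi> \<in> test_functions L" by (rule test_functions_mono[OF \<phi> KL])
  obtain B where B: "\<And>x. \<bar>\<phi> x\<bar> \<le> B" by (rule test_functions_bounded[OF \<phi>]) blast
  obtain B' where B': "\<And>x. norm (gradient \<phi> x) \<le> B'" by (rule test_functions_gradient_bounded[OF \<phi>]) blast
  have B'b: "\<bar>gradient \<phi> x \<bullet> b\<bar> \<le> B'" if "b \<in> Basis" for x b
    using Basis_le_norm[OF that, of "gradient \<phi> x"] B'[of x] by linarith
  have [measurable]: "\<phi> \<in> borel_measurable borel" "gradient \<phi> \<in> borel_measurable borel"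
    using test_functions_borel[OF \<phi>] by auto
  have Gb: "integrable lborel (\<lambda>x. G x \<bullet> b)" and Fb: "integrable lborel (\<lambda>x. F x \<bullet> b)" for b
    using G(1) F(1) by (auto intro: integrable_inner_left)
  \<comment> \<open>The three coefficients that are paired with mollified functions: with the components of \<open>G\<close>,
      with \<open>w\<close>, and with \<open>w\<close> on the right-hand side.\<close>
  define h1 where "h1 b x = (F x \<bullet> b) * \<phi> x" for b x
  define h2 where "h2 b x = (F x \<bullet> b) * (gradient \<phi> x \<bullet> b)" for b x
  define h3 where "h3 x = f x * \<phi> x" for x
  have [measurable]: "h1 b \<in> borel_measurable borel" "h2 b \<in> borel_measurable borel" "h3 \<in> borel_measurable borel" for b
    unfolding h1_def[abs_def] h2_def[abs_def] h3_def[abs_def] by measurable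
  have h1: "integrable lborel (h1 b)" "integrable lborel (\<lambda>x. \<bar>h1 b x\<bar> powr p')" if "b \<in> Basis" for b
    unfolding h1_def[abs_def] using Fb F(2)[OF that] B pq
    by (auto intro!: integrable_mult_bounded integrable_mult_bounded_powr)
  have h2: "integrable lborel (h2 b)" "integrable lborel (\<lambda>x. \<bar>h2 b x\<bar> powr p')" if "b \<in> Basis" for b
    unfolding h2_def[abs_def] using Fb F(2)[OF that] B'b[OF that] pq
    by (auto intro!: integrable_mult_bounded integrable_mult_bounded_powr)
  have h3: "integrable lborel h3" "integrable lborel (\<lambda>x. \<bar>h3 x\<bar> powr r')"
    unfolding h3_def[abs_def] using f B rs
    by (auto intro!: integrable_mult_bounded integrable_mult_bounded_powr)
  have eq: "(\<Sum>b\<in>Basis. (LINT x|lborel. h1 b x * mollify (\<rho> n) (\<lambda>y. G y \<bullet> b) x) + (LINT x|lborel. h2 b x * mollify (\<rho> n) w x))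
      = (LINT x|lborel. h3 x * mollify (\<rho> n) w x)" for n
  proof -
    let ?w = "mollify (\<rho> n) w"
    have test: "(\<lambda>x. \<phi> x * ?w x) \<in> test_functions L"
      by (rule test_functions_mult[OF \<phi>L Ck_mollify[OF \<rho>t w(1)]])
    have "F x \<bullet> gradient (\<lambda>x. \<phi> x * ?w x) x = (\<Sum>b\<in>Basis. h1 b x * mollify (\<rho> n) (\<lambda>y. G y \<bullet> b) x + h2 b x * ?w x)" for x
    proof -
      have "GDERIV ?w x :> gradient ?w x"
        by (rule Ck_Suc_imp_GDERIV[OF Ck_mollify[OF \<rho>t w(1)]])
      then have "gradient (\<lambda>x. \<phi> x * ?w x) x = \<phi> x *\<^sub>R gradient ?w x + ?w x *\<^sub>R gradient \<phi> x"
        by (intro gradient_eqI GDERIV_mult test_functions_GDERIV[OF \<phi>])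
      moreover have "\<phi> x * (gradient ?w x \<bullet> b) = \<phi> x * mollify (\<rho> n) (\<lambda>y. G y \<bullet> b) x" if b: "b \<in> Basis" for b
      proof (cases "x \<in> K")
        case True
        then have "cball x (e n) \<subseteq> L" using e0(2)[OF True] e(2)[of n] by (meson order_trans subset_cball)
        then show ?thesis
          using mollify_weak_derivative[OF \<rho>t \<rho>0 _ weak[OF _ b]] gradient_mollify[OF \<rho>t w(1) b] by simp
      next
        case False
        then have "\<phi> x = 0" using \<phi> closure_subset[of "{x. \<phi> x \<noteq> 0}"] by (auto simp: test_functions_def)
        then show ?thesis by simp
      qed
      ultimately show ?thesis
        by (subst euclidean_inner) (auto intro!: sum.cong simp: h1_def h2_def inner_add_left algebra_simps)
    qed
    then have "(LINT x|lborel. F x \<bullet> gradient (\<lambda>x. \<phi> x * ?w x) x) =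
        (\<Sum>b\<in>Basis. (LINT x|lborel. h1 b x * mollify (\<rho> n) (\<lambda>y. G y \<bullet> b) x) + (LINT x|lborel. h2 b x * ?w x))"
      using integrable_mult_mollify[OF \<rho>t Gb h1(1)] integrable_mult_mollify[OF \<rho>t w(1) h2(1)] by simp
    moreover have "(LINT x|lborel. f x * (\<phi> x * ?w x)) = (LINT x|lborel. h3 x * ?w x)"
      by (simp add: h3_def mult.assoc)
    ultimately show ?thesis using eqn[OF test] by simp
  qed
  have i1: "integrable lborel (\<lambda>x. h1 b x * (G x \<bullet> b))" if "b \<in> Basis" for b
    using pq h1[OF that] G(2)[OF that] by (intro integrable_conjugate_product[of p' p]) auto
  have i2: "integrable lborel (\<lambda>x. h2 b x * w x)" if "b \<in> Basis" for b
    using pq h2[OF that] w by (intro integrable_conjugate_product[of p' p]) auto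
  have "(\<lambda>n. \<Sum>b\<in>Basis. (LINT x|lborel. h1 b x * mollify (\<rho> n) (\<lambda>y. G y \<bullet> b) x) + (LINT x|lborel. h2 b x * mollify (\<rho> n) w x))
      \<longlonglongrightarrow> (\<Sum>b\<in>Basis. (LINT x|lborel. h1 b x * (G x \<bullet> b)) + (LINT x|lborel. h2 b x * w x))"
    using h1 h2 G(2) w
    by (intro tendsto_sum tendsto_add mollify_pairing_tendsto[OF pq(2,1,3) _ _ _ _ _ \<rho> e_lim]) auto
  moreover have "(\<lambda>n. LINT x|lborel. h3 x * mollify (\<rho> n) w x) \<longlonglongrightarrow> (LINT x|lborel. h3 x * w x)"
    using h3 w by (intro mollify_pairing_tendsto[OF rs(2,1,3) _ _ _ _ _ \<rho> e_lim]) auto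
  ultimately have lim: "(\<Sum>b\<in>Basis. (LINT x|lborel. h1 b x * (G x \<bullet> b)) + (LINT x|lborel. h2 b x * w x)) = (LINT x|lborel. h3 x * w x)"
    unfolding eq by (rule LIMSEQ_unique)
  have s1: "(F x \<bullet> G x) * \<phi> x = (\<Sum>b\<in>Basis. h1 b x * (G x \<bullet> b))" for x
    by (subst euclidean_inner) (auto simp: sum_distrib_right sum_distrib_left h1_def mult_ac intro!: sum.cong)
  have s2: "(F x \<bullet> gradient \<phi> x) * w x = (\<Sum>b\<in>Basis. h2 b x * w x)" for x
    by (subst euclidean_inner) (auto simp: sum_distrib_right sum_distrib_left h2_def mult_ac intro!: sum.cong)
  show "integrable lborel (\<lambda>x. (F x \<bullet> G x) * \<phi> x)" unfolding s1 using i1 by auto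
  show "(LINT x|lborel. (F x \<bullet> G x) * \<phi> x) + (LINT x|lborel. (F x \<bullet> gradient \<phi> x) * w x)
      = (LINT x|lborel. (f x * \<phi> x) * w x)"
    unfolding s1 s2 using lim i1 i2 by (simp add: sum.distrib h3_def)
qed

section \<open>Strict monotonicity of the p-Laplace flux\<close>

definition p_flux :: "real \<Rightarrow> 'a::euclidean_space \<Rightarrow> 'a" where
  "p_flux p \<xi> = (norm \<xi> powr (p - 2)) *\<^sub>R \<xi>"

text \<open>
The integrand of the energy identity; its positivity is the monotonicity of the flux.
\<close>

definition flux_gap :: "real \<Rightarrow> 'a::euclidean_space \<Rightarrow> 'a \<Rightarrow> real" where
  "flux_gap p \<xi> \<eta> = (p_flux p \<xi> - p_flux p \<eta>) \<bullet> (\<xi> - \<eta>)"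

lemma norm_p_flux: "norm (p_flux p \<xi>) = norm \<xi> powr (p - 1)"
proof (cases "\<xi> = 0")
  case False
  then show ?thesis using powr_mult_base[of "norm \<xi>" "p - 2"] by (simp add: p_flux_def mult.commute)
qed (simp add: p_flux_def)

lemma conj_exp_conjugate:
  assumes "1 < p" shows "1 < conj_exp p" "1 / conj_exp p + 1 / p = 1" "(p - 1) * conj_exp p = p"
  using assms by (auto simp: conj_exp_def divide_simps)

lemma p_flux_powr_conj_exp:
  assumes "1 < p" shows "norm (p_flux p \<xi>) powr conj_exp p = norm \<xi> powr p"
  using conj_exp_conjugate(3)[OF assms] by (simp add: norm_p_flux powr_powr)

lemma p_flux_scaleR: "0 < t \<Longrightarrow> p_flux p (t *\<^sub>R \<xi>) = t powr (p - 1) *\<^sub>R p_flux p \<xi>"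
  using powr_mult_base[of t "p - 2"] by (simp add: p_flux_def powr_mult mult_ac)

lemma continuous_p_flux:
  assumes "1 < p"
  shows "continuous_on UNIV (p_flux p :: 'a::euclidean_space \<Rightarrow> 'a)"
proof (rule continuous_at_imp_continuous_on, rule ballI)
  fix \<xi> :: 'a
  show "isCont (p_flux p) \<xi>"
  proof (cases "\<xi> = 0")
    case True
    have "((\<lambda>\<xi> :: 'a. norm \<xi> powr (p - 1)) \<longlongrightarrow> norm (0::'a) powr (p - 1)) (at 0)"
      using assms by (intro tendsto_powr' tendsto_norm tendsto_ident_at tendsto_const) auto
    then have "((\<lambda>\<xi> :: 'a. norm (p_flux p \<xi>)) \<longlongrightarrow> 0) (at 0)" by (simp add: norm_p_flux)
    then have "(p_flux p \<longlongrightarrow> (0::'a)) (at 0)" by (rule tendsto_norm_zero_cancel)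
    moreover have "p_flux p 0 = (0::'a)" by (simp add: p_flux_def)
    ultimately show ?thesis unfolding True isCont_def by metis
  next
    case False
    then show ?thesis unfolding p_flux_def[abs_def] by (intro continuous_intros) auto
  qed
qed

text \<open>
For $p > 1$ both terms are nonnegative: the first vanishes only if the norms agree, and the second, by
Cauchy--Schwarz, vanishes for nonzero vectors only if their directions agree.
\<close>

lemma flux_gap_eq:
  "flux_gap p \<xi> \<eta> = (norm \<xi> powr (p - 1) - norm \<eta> powr (p - 1)) * (norm \<xi> - norm \<eta>)
     + (norm \<xi> powr (p - 2) + norm \<eta> powr (p - 2)) * (norm \<xi> * norm \<eta> - \<xi> \<bullet> \<eta>)"
proof -
  have pw: "norm \<zeta> powr (p - 1) = norm \<zeta> powr (p - 2) * norm \<zeta>" for \<zeta> :: 'a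
    using norm_p_flux[of p \<zeta>] by (simp add: p_flux_def)
  show ?thesis
    unfolding pw
    by (simp add: flux_gap_def p_flux_def inner_diff_left inner_diff_right inner_commute dot_square_norm
        power2_eq_square algebra_simps)
qed

lemma flux_gap_nonneg:
  assumes "1 \<le> p"
  shows "0 \<le> flux_gap p \<xi> \<eta>"
proof -
  have "0 \<le> (norm \<xi> powr (p - 1) - norm \<eta> powr (p - 1)) * (norm \<xi> - norm \<eta>)"
  proof (cases "norm \<xi> \<le> norm \<eta>")
    case True
    then show ?thesis using assms by (intro mult_nonpos_nonpos) (auto intro!: powr_mono2)
  next
    case False
    then show ?thesis using assms by (intro mult_nonneg_nonneg) (auto intro!: powr_mono2)
  qed
  moreover have "0 \<le> (norm \<xi> powr (p - 2) + norm \<eta> powr (p - 2)) * (norm \<xi> * norm \<eta> - \<xi> \<bullet> \<eta>)"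
    using norm_cauchy_schwarz[of \<xi> \<eta>] by (intro mult_nonneg_nonneg) auto
  ultimately show ?thesis unfolding flux_gap_eq by linarith
qed

lemma flux_gap_pos:
  assumes "1 < p" "\<xi> \<noteq> \<eta>"
  shows "0 < flux_gap p \<xi> \<eta>"
proof (cases "norm \<xi> = norm \<eta>")
  case True
  then have "0 < norm \<xi>" using assms(2) by auto
  have "(norm (\<xi> - \<eta>))\<^sup>2 = 2 * (norm \<xi> * norm \<eta> - \<xi> \<bullet> \<eta>)"
    using dot_norm_neg[of \<xi> \<eta>] True by (simp add: power2_eq_square)
  moreover have "0 < (norm (\<xi> - \<eta>))\<^sup>2" using assms(2) by simp
  ultimately have "0 < (norm \<xi> powr (p - 2) + norm \<eta> powr (p - 2)) * (norm \<xi> * norm \<eta> - \<xi> \<bullet> \<eta>)"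
    using True \<open>0 < norm \<xi>\<close> by (intro mult_pos_pos add_pos_pos) auto
  then show ?thesis unfolding flux_gap_eq True by simp
next
  case False
  have "0 < (norm \<xi> powr (p - 1) - norm \<eta> powr (p - 1)) * (norm \<xi> - norm \<eta>)"
  proof (cases "norm \<xi> < norm \<eta>")
    case True
    then show ?thesis using assms by (intro mult_neg_neg) (auto intro!: powr_less_mono2)
  next
    case False
    with \<open>norm \<xi> \<noteq> norm \<eta>\<close> show ?thesis using assms by (intro mult_pos_pos) (auto intro!: powr_less_mono2)
  qed
  moreover have "0 \<le> (norm \<xi> powr (p - 2) + norm \<eta> powr (p - 2)) * (norm \<xi> * norm \<eta> - \<xi> \<bullet> \<eta>)"
    using norm_cauchy_schwarz[of \<xi> \<eta>] by (intro mult_nonneg_nonneg) auto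
  ultimately show ?thesis unfolding flux_gap_eq by linarith
qed

lemma flux_gap_scaleR:
  assumes "0 < t" shows "flux_gap p (t *\<^sub>R \<xi>) (t *\<^sub>R \<eta>) = t powr p * flux_gap p \<xi> \<eta>"
proof -
  have "t powr (p - 1) * t = t powr p" using assms powr_mult_base[of t "p - 1"] by (simp add: mult.commute)
  then show ?thesis
    by (simp add: flux_gap_def p_flux_scaleR[OF assms] scaleR_diff_right[symmetric] mult.assoc[symmetric] mult.commute)
qed

text \<open>
By homogeneity it is enough to consider pairs on the unit sphere of the product space.  On the compact
part where the two vectors differ by at least $c$, the gap is bounded below by some $m > 0$, which
yields the first term; where they differ by less than $c$, the second term is large enough by the
choice $2^p c^p = \delta$.
\<close>

lemma norm_diff_powr_le_flux_gap:
  assumes "1 < p" "0 < \<delta>"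
  obtains C where "0 < C"
    "\<And>\<xi> \<eta> :: 'a::euclidean_space. norm (\<xi> - \<eta>) powr p \<le>
        C * flux_gap p \<xi> \<eta> + \<delta> * (norm \<xi> powr p + norm \<eta> powr p)"
proof -
  \<comment> \<open>The factor \<open>2 powr p\<close> comes from comparing the norm of a pair with the sum of the norms.\<close>
  define c where "c = (\<delta> / 2 powr p) powr (1 / p)"
  have c: "0 < c" "c powr p * 2 powr p = \<delta>" using assms by (auto simp: c_def powr_powr)
  let ?gap = "\<lambda>z :: 'a \<times> 'a. flux_gap p (fst z) (snd z)"
  let ?S = "sphere 0 1 \<inter> {z :: 'a \<times> 'a. c \<le> norm (fst z - snd z)}"
  have "compact ?S"
    by (intro compact_Int_closed compact_sphere closed_Collect_le continuous_intros)
  moreover have "continuous_on ?S ?gap"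
  proof -
    have "continuous_on ?S (\<lambda>z. p_flux p (fst z))" "continuous_on ?S (\<lambda>z. p_flux p (snd z))"
      by (rule continuous_on_compose2[OF continuous_p_flux[OF assms(1)]]; auto intro: continuous_intros)+
    then show ?thesis
      unfolding flux_gap_def by (intro continuous_on_inner continuous_on_diff continuous_on_fst continuous_on_snd continuous_on_id)
  qed
  ultimately have "\<exists>m>0. \<forall>z\<in>?S. m \<le> ?gap z"
  proof (cases "?S = {}")
    case False
    assume "compact ?S" "continuous_on ?S ?gap"
    then obtain z0 where z0: "z0 \<in> ?S" "\<forall>z\<in>?S. ?gap z0 \<le> ?gap z"
      using continuous_attains_inf[OF _ False] by blast
    have "fst z0 \<noteq> snd z0" using z0(1) c(1) by auto
    then have "0 < ?gap z0" by (rule flux_gap_pos[OF assms(1)])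
    with z0(2) show ?thesis by blast
  next
    case True
    then show ?thesis by (intro exI[of _ 1]) simp
  qed
  then obtain m where m: "0 < m" "\<And>z. z \<in> ?S \<Longrightarrow> m \<le> ?gap z" by blast
  have le: "norm (\<xi> - \<eta>) \<le> 2 * norm (\<xi>, \<eta>)" for \<xi> \<eta> :: 'a
    using norm_triangle_ineq4[of \<xi> \<eta>] norm_fst_le[where x = \<xi> and y = \<eta>] norm_snd_le[where x = \<xi> and y = \<eta>] by simp
  show ?thesis
  proof (rule that)
    show "0 < 2 powr p / m" using m by simp
    fix \<xi> \<eta> :: 'a
    let ?z = "(\<xi>, \<eta>)"
    have gap0: "0 \<le> flux_gap p \<xi> \<eta>" using assms by (intro flux_gap_nonneg) simp
    show "norm (\<xi> - \<eta>) powr p \<le> 2 powr p / m * flux_gap p \<xi> \<eta> + \<delta> * (norm \<xi> powr p + norm \<eta> powr p)"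
    proof (cases "c * norm ?z \<le> norm (\<xi> - \<eta>) \<and> ?z \<noteq> 0")
      case True
      define t where "t = norm ?z"
      have t: "0 < t" using True by (simp add: t_def)
      define \<xi>' \<eta>' where "\<xi>' = (1 / t) *\<^sub>R \<xi>" and "\<eta>' = (1 / t) *\<^sub>R \<eta>"
      have eq: "\<xi> = t *\<^sub>R \<xi>'" "\<eta> = t *\<^sub>R \<eta>'" using t by (auto simp: \<xi>'_def \<eta>'_def)
      have "(\<xi>', \<eta>') = (1 / t) *\<^sub>R ?z" by (simp add: \<xi>'_def \<eta>'_def)
      then have "norm (\<xi>', \<eta>') = \<bar>1 / t\<bar> * t" unfolding t_def by (simp only: norm_scaleR)
      then have "norm (\<xi>', \<eta>') = 1" using t by simp
      moreover have "c \<le> norm (\<xi>' - \<eta>')"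
      proof -
        have "c * t \<le> t * norm (\<xi>' - \<eta>')"
          using True t unfolding t_def[symmetric] by (simp add: eq scaleR_diff_right[symmetric])
        then show ?thesis using t by simp
      qed
      ultimately have "m \<le> flux_gap p \<xi>' \<eta>'" using m(2)[of "(\<xi>', \<eta>')"] by simp
      then have "t powr p * m \<le> flux_gap p \<xi> \<eta>"
        unfolding eq flux_gap_scaleR[OF t] by (intro mult_left_mono) auto
      then have "2 powr p * t powr p \<le> 2 powr p / m * flux_gap p \<xi> \<eta>"
        using m(1) by (simp add: field_simps)
      moreover have "norm (\<xi> - \<eta>) powr p \<le> (2 * t) powr p"
        using le[of \<xi> \<eta>] assms by (intro powr_mono2) (auto simp: t_def)
      moreover have "(2 * t) powr p = 2 powr p * t powr p" using t by (simp add: powr_mult)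
      moreover have "0 \<le> \<delta> * (norm \<xi> powr p + norm \<eta> powr p)" using assms by simp
      ultimately show ?thesis by linarith
    next
      case False
      have "norm (\<xi> - \<eta>) \<le> c * norm ?z"
        using False by (cases "?z = 0") (auto simp: zero_prod_def)
      also have "\<dots> \<le> c * (norm \<xi> + norm \<eta>)"
        using c(1) norm_Pair_le[of \<xi> \<eta>] by simp
      finally have "norm (\<xi> - \<eta>) \<le> c * (norm \<xi> + norm \<eta>)" .
      then have "norm (\<xi> - \<eta>) powr p \<le> (c * (norm \<xi> + norm \<eta>)) powr p"
        using assms by (intro powr_mono2) auto
      also have "\<dots> = c powr p * (norm \<xi> + norm \<eta>) powr p" using c by (simp add: powr_mult)
      also have "\<dots> \<le> c powr p * (2 powr p * (norm \<xi> powr p + norm \<eta> powr p))"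
        using assms by (intro mult_left_mono powr_add_le) auto
      also have "\<dots> = \<delta> * (norm \<xi> powr p + norm \<eta> powr p)" using c by (simp add: mult.assoc[symmetric])
      finally show ?thesis using m(1) gap0 by (simp add: add_increasing)
    qed
  qed
qed

text \<open>
The error term of the pointwise inequality contributes at most \<open>\<delta> * (2 * A) * B\<close>, uniformly over all
pairs of functions whose $p$-th power integrals are bounded by \<open>A\<close>.
\<close>

lemma weighted_norm_diff_le_flux_gap:
  fixes G1 G2 :: "'a \<Rightarrow> 'b::euclidean_space" and \<phi> :: "'a \<Rightarrow> real"
  assumes "1 < p" and [measurable]: "G1 \<in> borel_measurable M" "G2 \<in> borel_measurable M" "\<phi> \<in> borel_measurable M"
    and G1: "integrable M (\<lambda>x. norm (G1 x) powr p)" "(LINT x|M. norm (G1 x) powr p) \<le> A"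
    and G2: "integrable M (\<lambda>x. norm (G2 x) powr p)" "(LINT x|M. norm (G2 x) powr p) \<le> A"
    and \<phi>: "\<And>x. 0 \<le> \<phi> x" "\<And>x. \<phi> x \<le> B"
    and gap: "integrable M (\<lambda>x. flux_gap p (G1 x) (G2 x) * \<phi> x)"
    and C: "\<And>\<xi> \<eta> :: 'b. norm (\<xi> - \<eta>) powr p \<le> C * flux_gap p \<xi> \<eta> + \<delta> * (norm \<xi> powr p + norm \<eta> powr p)"
    and "0 \<le> \<delta>" "0 \<le> B"
  shows "integrable M (\<lambda>x. norm (G1 x - G2 x) powr p * \<phi> x)"
    and "(LINT x|M. norm (G1 x - G2 x) powr p * \<phi> x) \<le>
      C * (LINT x|M. flux_gap p (G1 x) (G2 x) * \<phi> x) + \<delta> * (2 * A) * B"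
proof -
  let ?R = "\<lambda>x. C * (flux_gap p (G1 x) (G2 x) * \<phi> x) + \<delta> * B * (norm (G1 x) powr p + norm (G2 x) powr p)"
  have R: "integrable M ?R" using gap G1 G2 by simp
  have le: "norm (G1 x - G2 x) powr p * \<phi> x \<le> ?R x" for x
  proof -
    have "norm (G1 x - G2 x) powr p * \<phi> x \<le>
        (C * flux_gap p (G1 x) (G2 x) + \<delta> * (norm (G1 x) powr p + norm (G2 x) powr p)) * \<phi> x"
      by (rule mult_right_mono[OF C \<phi>(1)])
    also have "\<dots> = C * (flux_gap p (G1 x) (G2 x) * \<phi> x) + \<delta> * (norm (G1 x) powr p + norm (G2 x) powr p) * \<phi> x"
      by (simp add: algebra_simps)
    also have "\<delta> * (norm (G1 x) powr p + norm (G2 x) powr p) * \<phi> x \<le> \<delta> * (norm (G1 x) powr p + norm (G2 x) powr p) * B"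
      using assms(13) \<phi>(2) by (intro mult_left_mono) auto
    finally show ?thesis by (simp add: mult_ac)
  qed
  show int: "integrable M (\<lambda>x. norm (G1 x - G2 x) powr p * \<phi> x)"
  proof (rule Bochner_Integration.integrable_bound[OF R])
    show "AE x in M. norm (norm (G1 x - G2 x) powr p * \<phi> x) \<le> norm (?R x)"
      using le \<phi>(1) by (intro AE_I2) (simp add: abs_mult order_trans[OF _ abs_ge_self])
  qed measurable
  have "(LINT x|M. norm (G1 x - G2 x) powr p * \<phi> x) \<le> (LINT x|M. ?R x)"
    by (rule integral_mono[OF int R le])
  also have "\<dots> = C * (LINT x|M. flux_gap p (G1 x) (G2 x) * \<phi> x)
      + \<delta> * B * ((LINT x|M. norm (G1 x) powr p) + (LINT x|M. norm (G2 x) powr p))"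
    using gap G1 G2 by simp
  also have "\<delta> * B * ((LINT x|M. norm (G1 x) powr p) + (LINT x|M. norm (G2 x) powr p)) \<le> \<delta> * B * (2 * A)"
    using assms(13,14) G1 G2 by (intro mult_left_mono) auto
  finally show "(LINT x|M. norm (G1 x - G2 x) powr p * \<phi> x) \<le>
      C * (LINT x|M. flux_gap p (G1 x) (G2 x) * \<phi> x) + \<delta> * (2 * A) * B"
    by (simp add: mult_ac)
qed

section \<open>Local Lebesgue spaces and their completeness\<close>

lemma integrable_lebesgue_on_subset:
  fixes f :: "'a::euclidean_space \<Rightarrow> real"
  assumes "K \<in> sets lebesgue" "L \<in> sets lebesgue" "K \<subseteq> L"
    and f: "integrable (lebesgue_on L) f" and "\<And>x. 0 \<le> f x"
  shows "integrable (lebesgue_on K) f" and "(LINT x|lebesgue_on K. f x) \<le> (LINT x|lebesgue_on L. f x)"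
proof -
  have iL: "integrable lebesgue (\<lambda>x. indicator L x *\<^sub>R f x)"
    using f assms(2) by (simp add: integrable_restrict_space)
  have "integrable lebesgue (\<lambda>x. indicator K x *\<^sub>R (indicator L x *\<^sub>R f x))"
    by (rule integrable_mult_indicator[OF assms(1) iL])
  also have "(\<lambda>x. indicator K x *\<^sub>R (indicator L x *\<^sub>R f x)) = (\<lambda>x. indicator K x *\<^sub>R f x)"
    using assms(3) by (auto simp: indicator_def fun_eq_iff)
  finally have iK: "integrable lebesgue (\<lambda>x. indicator K x *\<^sub>R f x)" .
  then show "integrable (lebesgue_on K) f" using assms(1) by (simp add: integrable_restrict_space)
  have "(LINT x|lebesgue. indicator K x *\<^sub>R f x) \<le> (LINT x|lebesgue. indicator L x *\<^sub>R f x)"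
    using assms(3,5) by (intro integral_mono[OF iK iL]) (auto simp: indicator_def)
  then show "(LINT x|lebesgue_on K. f x) \<le> (LINT x|lebesgue_on L. f x)"
    using assms(1,2) by (simp add: integral_restrict_space)
qed

lemma integrable_powr_norm_diff:
  fixes F G :: "'a \<Rightarrow> 'b::euclidean_space"
  assumes [measurable]: "F \<in> borel_measurable M" "G \<in> borel_measurable M"
    and i: "integrable M (\<lambda>x. norm (F x) powr p)" "integrable M (\<lambda>x. norm (G x) powr p)" and "0 \<le> p"
  shows "integrable M (\<lambda>x. norm (F x - G x) powr p)"
    and "(LINT x|M. norm (F x - G x) powr p) \<le>
      2 powr p * ((LINT x|M. norm (F x) powr p) + (LINT x|M. norm (G x) powr p))"
proof -
  have le: "norm (F x - G x) powr p \<le> 2 powr p * (norm (F x) powr p + norm (G x) powr p)" for x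
  proof -
    have "norm (F x - G x) powr p \<le> (norm (F x) + norm (G x)) powr p"
      using \<open>0 \<le> p\<close> by (intro powr_mono2 norm_triangle_ineq4) auto
    also have "\<dots> \<le> 2 powr p * (norm (F x) powr p + norm (G x) powr p)"
      using \<open>0 \<le> p\<close> by (intro powr_add_le) auto
    finally show ?thesis .
  qed
  show int: "integrable M (\<lambda>x. norm (F x - G x) powr p)"
  proof (rule Bochner_Integration.integrable_bound)
    show "integrable M (\<lambda>x. 2 powr p * (norm (F x) powr p + norm (G x) powr p))"
      using i by simp
    show "AE x in M. norm (norm (F x - G x) powr p) \<le> norm (2 powr p * (norm (F x) powr p + norm (G x) powr p))"
      using le by (intro AE_I2) simp
  qed measurable
  have "(LINT x|M. norm (F x - G x) powr p) \<le> (LINT x|M. 2 powr p * (norm (F x) powr p + norm (G x) powr p))"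
    using le i int by (intro integral_mono) auto
  then show "(LINT x|M. norm (F x - G x) powr p) \<le>
      2 powr p * ((LINT x|M. norm (F x) powr p) + (LINT x|M. norm (G x) powr p))"
    using i by simp
qed

lemma Lp_diff:
  assumes "F \<in> Lp p K" "G \<in> Lp p K" "0 \<le> p"
  shows "(\<lambda>x. F x - G x) \<in> Lp p K"
  using assms integrable_powr_norm_diff(1)[of F "lebesgue_on K" G p]
  by (auto simp: Lp_def intro: borel_measurable_diff)

lemma Lp_norm_powr:
  "0 < s \<Longrightarrow> Lp_norm s K f powr s = (LINT x|lebesgue_on K. norm (f x) powr s)"
  by (simp add: Lp_norm_def powr_powr Bochner_Integration.integral_nonneg)

lemma converges_Lp_loc_imp_Cauchy:
  fixes F :: "nat \<Rightarrow> 'a::euclidean_space \<Rightarrow> 'b::euclidean_space"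
  assumes conv: "converges_Lp_loc p \<Omega> F g" and K: "compact K" "K \<subseteq> \<Omega>" and "0 < p" "0 < e"
  shows "\<exists>N. \<forall>n\<ge>N. \<forall>m\<ge>N. (LINT x|lebesgue_on K. norm (F n x - F m x) powr p) \<le> e"
proof -
  have F: "F n \<in> Lp p K" and g: "g \<in> Lp p K" for n
    using conv K by (auto simp: converges_Lp_loc_def Lp_loc_def)
  have d: "(\<lambda>x. F n x - g x) \<in> Lp p K" for n
    using Lp_diff[OF F g] \<open>0 < p\<close> by simp
  have "(\<lambda>n. Lp_norm p K (\<lambda>x. F n x - g x)) \<longlonglongrightarrow> 0"
    using conv K by (simp add: converges_Lp_loc_def)
  then have "(\<lambda>n. Lp_norm p K (\<lambda>x. F n x - g x) powr p) \<longlonglongrightarrow> 0 powr p"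
    by (rule tendsto_powr'[OF _ tendsto_const]) (use \<open>0 < p\<close> in \<open>simp add: Lp_norm_def\<close>)
  then have "(\<lambda>n. LINT x|lebesgue_on K. norm (F n x - g x) powr p) \<longlonglongrightarrow> 0"
    using \<open>0 < p\<close> by (simp add: Lp_norm_powr)
  moreover have "0 < e / (2 * 2 powr p)" using \<open>0 < e\<close> by simp
  ultimately have "\<forall>\<^sub>F n in sequentially. (LINT x|lebesgue_on K. norm (F n x - g x) powr p) < e / (2 * 2 powr p)"
    by (rule order_tendstoD)
  then obtain N where N: "\<And>n. N \<le> n \<Longrightarrow> (LINT x|lebesgue_on K. norm (F n x - g x) powr p) < e / (2 * 2 powr p)"
    by (auto simp: eventually_sequentially)
  have "(LINT x|lebesgue_on K. norm (F n x - F m x) powr p) \<le> e" if "N \<le> n" "N \<le> m" for n m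
  proof -
    have "(LINT x|lebesgue_on K. norm ((F n x - g x) - (F m x - g x)) powr p) \<le>
        2 powr p * ((LINT x|lebesgue_on K. norm (F n x - g x) powr p) + (LINT x|lebesgue_on K. norm (F m x - g x) powr p))"
      using d[of n] d[of m] \<open>0 < p\<close> by (intro integrable_powr_norm_diff(2)) (auto simp: Lp_def)
    also have "\<dots> \<le> 2 powr p * (e / (2 * 2 powr p) + e / (2 * 2 powr p))"
      using N[OF that(1)] N[OF that(2)] by (intro mult_left_mono) auto
    also have "\<dots> = e" by simp
    finally show ?thesis by simp
  qed
  then show ?thesis by blast
qed

lemma bounded_Lp_loc_integral_bound:
  assumes "bounded_Lp_loc s \<Omega> F" "compact K" "K \<subseteq> \<Omega>" "0 < s"
  obtains A where "\<And>n. (LINT x|lebesgue_on K. norm (F n x) powr s) \<le> A"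
proof -
  have "\<exists>C. \<forall>n. Lp_norm s K (F n) \<le> C"
    using assms by (simp add: bounded_Lp_loc_def)
  then obtain C where C: "\<And>n. Lp_norm s K (F n) \<le> C" by blast
  show ?thesis
  proof (rule that)
    fix n
    have "Lp_norm s K (F n) powr s \<le> C powr s"
      using assms(4) by (intro powr_mono2 C) (auto simp: Lp_norm_def)
    then show "(LINT x|lebesgue_on K. norm (F n x) powr s) \<le> C powr s"
      using assms(4) by (simp add: Lp_norm_powr)
  qed
qed

lemma summable_norm_increments_imp_convergent:
  fixes f :: "nat \<Rightarrow> 'b::banach"
  assumes "summable (\<lambda>j. norm (f (Suc j) - f j))"
  shows "convergent f"
proof -
  have "convergent (\<lambda>n. \<Sum>j<n. f (Suc j) - f j)"
    using summable_norm_cancel[OF assms] by (simp add: summable_iff_convergent)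
  then have "convergent (\<lambda>n. (f n - f 0) + f 0)"
    by (intro convergent_add convergent_const) (simp add: sum_lessThan_telescope)
  then show ?thesis by simp
qed

text \<open>
The series $\sum_j (2^j |G_{j+1} - G_j|)^p$ has a finite integral, hence is finite almost everywhere.
Then its terms are eventually below $1$, so the increments are dominated by $2^{-j}$ and the sequence
converges.
\<close>

lemma fast_Lp_increments_imp_AE_convergent:
  fixes G :: "nat \<Rightarrow> 'a \<Rightarrow> 'b::euclidean_space"
  assumes "0 < p" and [measurable]: "\<And>n. G n \<in> borel_measurable M"
    and int: "\<And>j. j0 \<le> j \<Longrightarrow> integrable M (\<lambda>x. norm (G (Suc j) x - G j x) powr p)"
    and le: "\<And>j. j0 \<le> j \<Longrightarrow> (LINT x|M. norm (G (Suc j) x - G j x) powr p) \<le> ((1 / 4) ^ j) powr p"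
  shows "AE x in M. convergent (\<lambda>j. G j x)"
proof -
  define D where "D j x = norm (G (Suc (j + j0)) x - G (j + j0) x)" for j x
  define f where "f j x = (2 ^ j * D j x) powr p" for j x
  define c where "c = (1 / 2 :: real) powr p"
  have [measurable]: "f j \<in> borel_measurable M" for j
    unfolding f_def[abs_def] D_def by measurable
  have c: "0 < c" "c < 1" using powr_less_mono2[of p "1 / 2" 1] assms(1) by (auto simp: c_def)
  have nn: "(\<integral>\<^sup>+ x. ennreal (f j x) \<partial>M) \<le> ennreal (c ^ j)" for j
  proof -
    have f_eq: "f j x = (2 ^ j) powr p * norm (G (Suc (j + j0)) x - G (j + j0) x) powr p" for x
      by (simp add: f_def D_def powr_mult)
    have "integrable M (\<lambda>x. f j x)" unfolding f_eq using int[of "j + j0"] by simp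
    then have "(\<integral>\<^sup>+ x. ennreal (f j x) \<partial>M) = ennreal (LINT x|M. f j x)"
      by (rule nn_integral_eq_integral) (simp add: f_def)
    also have "(LINT x|M. f j x) \<le> (2 ^ j) powr p * ((1 / 4) ^ (j + j0)) powr p"
      unfolding f_eq using le[of "j + j0"] by simp
    also have "\<dots> = (2 ^ j * (1 / 4) ^ (j + j0)) powr p" by (simp add: powr_mult)
    also have "\<dots> \<le> ((1 / 2) ^ j) powr p"
    proof (rule powr_mono2)
      have "(2::real) ^ j * (1 / 4) ^ (j + j0) = (1 / 2) ^ j * (1 / 4) ^ j0"
        by (simp add: power_add power_mult_distrib[symmetric] mult.assoc[symmetric])
      also have "\<dots> \<le> (1 / 2) ^ j * 1" by (intro mult_left_mono) (auto intro: power_le_one)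
      finally show "(2::real) ^ j * (1 / 4) ^ (j + j0) \<le> (1 / 2) ^ j" by simp
    qed (use assms in auto)
    also have "\<dots> = c ^ j" by (simp add: c_def powr_power powr_realpow[symmetric] powr_powr mult.commute)
    finally show ?thesis by (simp add: ennreal_leI)
  qed
  have "(\<integral>\<^sup>+ x. (\<Sum>j. ennreal (f j x)) \<partial>M) = (\<Sum>j. \<integral>\<^sup>+ x. ennreal (f j x) \<partial>M)"
    by (intro nn_integral_suminf) measurable
  also have "\<dots> \<le> (\<Sum>j. ennreal (c ^ j))" using nn by (intro suminf_le) auto
  also have "\<dots> < \<infinity>"
    using c by (subst suminf_ennreal2) (auto intro: summable_geometric)
  finally have "AE x in M. (\<Sum>j. ennreal (f j x)) \<noteq> \<infinity>"
    by (intro nn_integral_noteq_infinite) auto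
  then show ?thesis
  proof eventually_elim
    case (elim x)
    have f0: "0 \<le> f j x" for j by (simp add: f_def)
    have "summable (\<lambda>j. f j x)" using elim f0 by (intro summable_suminf_not_top) auto
    then have "(\<lambda>j. f j x) \<longlonglongrightarrow> 0" by (rule summable_LIMSEQ_zero)
    then have "\<forall>\<^sub>F j in sequentially. f j x < 1" by (rule order_tendstoD) simp
    then have "\<forall>\<^sub>F j in sequentially. norm (D j x) \<le> (1 / 2) ^ j"
    proof eventually_elim
      case (elim j)
      have D0: "0 \<le> D j x" by (simp add: D_def)
      have "2 ^ j * D j x < 1"
      proof (rule ccontr)
        assume "\<not> 2 ^ j * D j x < 1"
        then have "1 powr p \<le> (2 ^ j * D j x) powr p" using assms(1) by (intro powr_mono2) auto
        then show False using elim by (simp add: f_def)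
      qed
      then show ?case using D0 by (simp add: power_one_over field_simps)
    qed
    then have "summable (\<lambda>j. D j x)"
      by (rule summable_comparison_test_ev) (simp add: summable_geometric)
    then have "convergent (\<lambda>j. G (j + j0) x)"
      unfolding D_def by (intro summable_norm_increments_imp_convergent) simp
    then show ?case by (simp add: convergent_ignore_initial_segment[where f = "\<lambda>j. G j x"])
  qed
qed

lemma Lp_loc_subset:
  "f \<in> Lp_loc p \<Omega> \<Longrightarrow> compact K \<Longrightarrow> K \<subseteq> \<Omega> \<Longrightarrow> f \<in> Lp p K"
  by (simp add: Lp_loc_def)

lemma compact_imp_sets_lebesgue: "compact K \<Longrightarrow> K \<in> sets lebesgue" for K :: "'a::euclidean_space set"
  by (simp add: lmeasurable_compact fmeasurableD)

text \<open>
Riesz--Fischer along a compact exhaustion \<open>C\<close>: from index \<open>\<sigma> j\<close> on, the differences have $p$-th power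
integral over \<open>C j\<close> at most $4^{-jp}$.  One subsequence thus serves every compact set, since each of
them lies in all but finitely many \<open>C j\<close>.  It converges almost everywhere, and Fatou's lemma upgrades
this to convergence in $L^p$.
\<close>

lemma Lp_loc_Cauchy_imp_convergent_subsequence:
  fixes G :: "nat \<Rightarrow> 'a::euclidean_space \<Rightarrow> 'b::euclidean_space"
  assumes "open \<Omega>" "0 < p" and G: "\<And>n. G n \<in> Lp_loc p \<Omega>"
    and cauchy: "\<And>K e. compact K \<Longrightarrow> K \<subseteq> \<Omega> \<Longrightarrow> 0 < e \<Longrightarrow>
      \<exists>N. \<forall>n\<ge>N. \<forall>m\<ge>N. (LINT x|lebesgue_on K. norm (G n x - G m x) powr p) \<le> e"
  obtains \<sigma> V where "strict_mono \<sigma>" "converges_Lp_loc p \<Omega> (\<lambda>n. G (\<sigma> n)) V"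
proof -
  have "\<exists>C :: nat \<Rightarrow> 'a set. (\<forall>n. compact (C n)) \<and> (\<forall>n. C n \<subseteq> \<Omega>) \<and>
      (\<forall>K. compact K \<longrightarrow> K \<subseteq> \<Omega> \<longrightarrow> (\<exists>N. \<forall>n\<ge>N. K \<subseteq> C n))"
  proof (rule open_Union_compact_subsets[OF assms(1)])
    fix C :: "nat \<Rightarrow> 'a set"
    assume "\<And>n. compact (C n)" "\<And>n. C n \<subseteq> \<Omega>"
      and "\<And>K. compact K \<Longrightarrow> K \<subseteq> \<Omega> \<Longrightarrow> \<exists>N. \<forall>n\<ge>N. K \<subseteq> C n"
    then show ?thesis by (intro exI[of _ C]) simp
  qed
  then obtain C :: "nat \<Rightarrow> 'a set" where C: "\<And>n. compact (C n)" "\<And>n. C n \<subseteq> \<Omega>"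
    "\<And>K. compact K \<Longrightarrow> K \<subseteq> \<Omega> \<Longrightarrow> \<exists>N. \<forall>n\<ge>N. K \<subseteq> C n" by blast
  define \<epsilon> where "\<epsilon> j = ((1 / 4) ^ j) powr p" for j :: nat
  have "0 < \<epsilon> j" for j by (simp add: \<epsilon>_def)
  then have "\<exists>N. \<forall>n\<ge>N. \<forall>m\<ge>N. (LINT x|lebesgue_on (C j). norm (G n x - G m x) powr p) \<le> \<epsilon> j" for j
    using cauchy[OF C(1,2)] by blast
  then obtain N where N: "\<And>j n m. N j \<le> n \<Longrightarrow> N j \<le> m \<Longrightarrow>
      (LINT x|lebesgue_on (C j). norm (G n x - G m x) powr p) \<le> \<epsilon> j" by metis
  \<comment> \<open>The smallest strictly increasing choice that stays above \<open>N\<close>.\<close>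
  define \<sigma> where "\<sigma> = rec_nat (N 0) (\<lambda>j s. max (Suc s) (N (Suc j)))"
  have \<sigma>_Suc: "\<sigma> (Suc j) = max (Suc (\<sigma> j)) (N (Suc j))" for j by (simp add: \<sigma>_def)
  have mono: "strict_mono \<sigma>" by (simp add: strict_mono_Suc_iff \<sigma>_Suc less_max_iff_disj)
  have N\<sigma>: "N j \<le> \<sigma> j" for j by (cases j) (simp_all add: \<sigma>_Suc, simp add: \<sigma>_def)
  have \<sigma>le: "\<sigma> j \<le> \<sigma> k" if "j \<le> k" for j k using mono that by (simp add: strict_mono_less_eq)
  define V where "V x = lim (\<lambda>j. G (\<sigma> j) x)" for x
  have local: "V \<in> Lp p K \<and> (\<lambda>n. Lp_norm p K (\<lambda>x. G (\<sigma> n) x - V x)) \<longlonglongrightarrow> 0"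
    if K: "compact K" "K \<subseteq> \<Omega>" for K
  proof -
    obtain j0 where j0: "\<And>j. j0 \<le> j \<Longrightarrow> K \<subseteq> C j" using C(3)[OF K] by blast
    have GK: "G n \<in> Lp p K" for n using G K by (rule Lp_loc_subset)
    then have [measurable]: "G n \<in> borel_measurable (lebesgue_on K)" for n by (simp add: Lp_def)
    have diffK: "integrable (lebesgue_on K) (\<lambda>x. norm (G n x - G m x) powr p)" for n m
      using Lp_diff[OF GK[of n] GK[of m]] assms(2) by (simp add: Lp_def)
    have small: "(LINT x|lebesgue_on K. norm (G (\<sigma> k) x - G (\<sigma> l) x) powr p) \<le> \<epsilon> j"
      if "j0 \<le> j" "j \<le> k" "j \<le> l" for j k l
    proof -
      have "G n \<in> Lp p (C j)" for n using Lp_loc_subset[OF G C(1,2)] .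
      then have "(\<lambda>x. G (\<sigma> k) x - G (\<sigma> l) x) \<in> Lp p (C j)" using assms(2) by (intro Lp_diff) auto
      then have "integrable (lebesgue_on (C j)) (\<lambda>x. norm (G (\<sigma> k) x - G (\<sigma> l) x) powr p)"
        by (simp add: Lp_def)
      then have "(LINT x|lebesgue_on K. norm (G (\<sigma> k) x - G (\<sigma> l) x) powr p)
          \<le> (LINT x|lebesgue_on (C j). norm (G (\<sigma> k) x - G (\<sigma> l) x) powr p)"
        by (intro integrable_lebesgue_on_subset(2) compact_imp_sets_lebesgue K C(1) j0[OF that(1)]) auto
      also have "\<dots> \<le> \<epsilon> j"
        using N\<sigma>[of j] \<sigma>le[OF that(2)] \<sigma>le[OF that(3)] by (intro N) auto
      finally show ?thesis .
    qed
    have conv: "AE x in lebesgue_on K. (\<lambda>l. G (\<sigma> l) x) \<longlonglongrightarrow> V x"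
    proof -
      have "AE x in lebesgue_on K. convergent (\<lambda>l. G (\<sigma> l) x)"
        using small diffK by (intro fast_Lp_increments_imp_AE_convergent[OF assms(2), of _ _ j0]) (auto simp: \<epsilon>_def)
      then show ?thesis
        by eventually_elim (simp add: V_def convergent_LIMSEQ_iff)
    qed
    have [measurable]: "V \<in> borel_measurable (lebesgue_on K)"
      unfolding V_def[abs_def] by measurable
    have fatou: "(\<integral>\<^sup>+ x. ennreal (norm (G (\<sigma> j) x - V x) powr p) \<partial>lebesgue_on K) \<le> ennreal (\<epsilon> j)"
      if j: "j0 \<le> j" for j
    proof -
      let ?u = "\<lambda>l x. ennreal (norm (G (\<sigma> j) x - G (\<sigma> l) x) powr p)"
      have "(\<integral>\<^sup>+ x. ennreal (norm (G (\<sigma> j) x - V x) powr p) \<partial>lebesgue_on K)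
          = (\<integral>\<^sup>+ x. liminf (\<lambda>l. ?u l x) \<partial>lebesgue_on K)"
      proof (rule nn_integral_cong_AE)
        show "AE x in lebesgue_on K. ennreal (norm (G (\<sigma> j) x - V x) powr p) = liminf (\<lambda>l. ?u l x)"
          using conv
        proof eventually_elim
          case (elim x)
          have "(\<lambda>l. norm (G (\<sigma> j) x - G (\<sigma> l) x)) \<longlonglongrightarrow> norm (G (\<sigma> j) x - V x)"
            by (intro tendsto_norm tendsto_diff tendsto_const elim)
          then have "(\<lambda>l. norm (G (\<sigma> j) x - G (\<sigma> l) x) powr p) \<longlonglongrightarrow> norm (G (\<sigma> j) x - V x) powr p"
            by (rule tendsto_powr'[OF _ tendsto_const]) (use assms(2) in simp)
          then have "(\<lambda>l. ?u l x) \<longlonglongrightarrow> ennreal (norm (G (\<sigma> j) x - V x) powr p)"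
            by (rule tendsto_ennrealI)
          then show ?case by (intro lim_imp_Liminf[symmetric]) auto
        qed
      qed
      also have "\<dots> \<le> liminf (\<lambda>l. \<integral>\<^sup>+ x. ?u l x \<partial>lebesgue_on K)"
        by (intro nn_integral_liminf) measurable
      also have "\<dots> \<le> liminf (\<lambda>l. ennreal (\<epsilon> j))"
      proof (rule Liminf_mono, rule eventually_sequentiallyI[of j])
        fix l assume "j \<le> l"
        have "(\<integral>\<^sup>+ x. ?u l x \<partial>lebesgue_on K) = ennreal (LINT x|lebesgue_on K. norm (G (\<sigma> j) x - G (\<sigma> l) x) powr p)"
          using diffK by (intro nn_integral_eq_integral) auto
        also have "\<dots> \<le> ennreal (\<epsilon> j)" using small[OF j] \<open>j \<le> l\<close> by (intro ennreal_leI) auto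
        finally show "(\<integral>\<^sup>+ x. ?u l x \<partial>lebesgue_on K) \<le> ennreal (\<epsilon> j)" .
      qed
      also have "\<dots> = ennreal (\<epsilon> j)" by (simp add: Liminf_const)
      finally show ?thesis .
    qed
    have int: "integrable (lebesgue_on K) (\<lambda>x. norm (G (\<sigma> j) x - V x) powr p)" if "j0 \<le> j" for j
    proof (rule integrableI_bounded)
      show "(\<integral>\<^sup>+ x. ennreal (norm (norm (G (\<sigma> j) x - V x) powr p)) \<partial>lebesgue_on K) < \<infinity>"
        using le_less_trans[OF fatou[OF that] ennreal_less_top] by simp
    qed measurable
    have le: "(LINT x|lebesgue_on K. norm (G (\<sigma> j) x - V x) powr p) \<le> \<epsilon> j" if "j0 \<le> j" for j
      using fatou[OF that] nn_integral_eq_integral[OF int[OF that]] \<open>\<And>j. 0 < \<epsilon> j\<close>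
      by (simp add: ennreal_le_iff less_imp_le)
    have "(\<lambda>x. G (\<sigma> j0) x - V x) \<in> Lp p K" using int[of j0] by (simp add: Lp_def)
    from Lp_diff[OF GK this less_imp_le[OF assms(2)], of "\<sigma> j0"] have V: "V \<in> Lp p K" by simp
    have "(\<lambda>n. Lp_norm p K (\<lambda>x. G (\<sigma> n) x - V x)) \<longlonglongrightarrow> 0"
    proof (rule Lim_null_comparison)
      show "\<forall>\<^sub>F n in sequentially. norm (Lp_norm p K (\<lambda>x. G (\<sigma> n) x - V x)) \<le> (1 / 4) ^ n"
      proof (rule eventually_sequentiallyI[of j0])
        fix n assume "j0 \<le> n"
        have "Lp_norm p K (\<lambda>x. G (\<sigma> n) x - V x) \<le> \<epsilon> n powr (1 / p)"
          unfolding Lp_norm_def using le[OF \<open>j0 \<le> n\<close>] assms(2)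
          by (intro powr_mono2 Bochner_Integration.integral_nonneg) auto
        also have "\<dots> = (1 / 4) ^ n" using assms(2) by (simp add: \<epsilon>_def powr_powr)
        finally show "norm (Lp_norm p K (\<lambda>x. G (\<sigma> n) x - V x)) \<le> (1 / 4) ^ n"
          by (simp add: Lp_norm_def)
      qed
    qed (simp add: LIMSEQ_power_zero)
    with V show ?thesis by simp
  qed
  have "converges_Lp_loc p \<Omega> (\<lambda>n. G (\<sigma> n)) V"
    unfolding converges_Lp_loc_def Lp_loc_def using local G by (auto simp: Lp_loc_def)
  with mono show ?thesis by (rule that)
qed

section \<open>Borel representatives\<close>

lemma lebesgue_on_transfer_lborel:
  fixes h h' :: "'a::euclidean_space \<Rightarrow> 'b::euclidean_space"
  assumes S: "S \<in> sets lebesgue" and h': "h' \<in> borel_measurable borel"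
    and eq: "AE x in lborel. indicator S x *\<^sub>R h x = h' x"
  shows "integrable (lebesgue_on S) h \<longleftrightarrow> integrable lborel h'"
    and "integral\<^sup>L (lebesgue_on S) h = integral\<^sup>L lborel h'"
proof -
  have m': "h' \<in> borel_measurable lebesgue" using h' by (intro measurable_completion) simp
  have AE: "AE x in lebesgue. indicator S x *\<^sub>R h x = h' x" using eq by (rule AE_completion)
  have m: "(\<lambda>x. indicator S x *\<^sub>R h x) \<in> borel_measurable lebesgue"
  proof (rule borel_measurable_AE[OF m'])
    show "AE x in lebesgue. h' x = indicator S x *\<^sub>R h x" using AE by eventually_elim simp
  qed
  show "integrable (lebesgue_on S) h \<longleftrightarrow> integrable lborel h'"
  proof -
    have "integrable (lebesgue_on S) h \<longleftrightarrow> integrable lebesgue (\<lambda>x. indicator S x *\<^sub>R h x)"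
      using S by (simp add: integrable_restrict_space)
    also have "\<dots> \<longleftrightarrow> integrable lebesgue h'" by (rule integrable_cong_AE[OF m m' AE])
    also have "\<dots> \<longleftrightarrow> integrable lborel h'" using h' by (intro integrable_completion) simp
    finally show ?thesis .
  qed
  show "integral\<^sup>L (lebesgue_on S) h = integral\<^sup>L lborel h'"
  proof -
    have "integral\<^sup>L (lebesgue_on S) h = (LINT x|lebesgue. indicator S x *\<^sub>R h x)"
      using S by (simp add: integral_restrict_space)
    also have "\<dots> = integral\<^sup>L lebesgue h'" by (rule integral_cong_AE[OF m m' AE])
    also have "\<dots> = integral\<^sup>L lborel h'" using h' by (intro integral_completion) simp
    finally show ?thesis .
  qed
qed

text \<open>
For such a representative, integrals over \<open>lebesgue_on\<close> of expressions supported in \<open>K\<close> become integrals over \<open>lborel\<close>, where Fubini's theorem is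
at hand.
\<close>

definition borel_version :: "'a::euclidean_space set \<Rightarrow> ('a \<Rightarrow> 'b::euclidean_space) \<Rightarrow> ('a \<Rightarrow> 'b) \<Rightarrow> bool" where
  "borel_version K f g \<longleftrightarrow> g \<in> borel_measurable borel \<and> (\<forall>x. x \<notin> K \<longrightarrow> g x = 0) \<and>
     (AE x in lborel. x \<in> K \<longrightarrow> f x = g x)"

lemma exists_borel_version:
  fixes f :: "'a::euclidean_space \<Rightarrow> 'b::euclidean_space"
  assumes K: "compact K" and f: "f \<in> borel_measurable (lebesgue_on K)"
  shows "\<exists>g. borel_version K f g"
proof -
  have KL: "K \<in> sets lebesgue" using K by (simp add: lmeasurable_compact fmeasurableD)
  have KB: "K \<in> sets borel" using K by (simp add: borel_compact)
  have "(\<lambda>x. indicator K x *\<^sub>R f x) \<in> borel_measurable lebesgue"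
    using f KL by (subst (asm) borel_measurable_restrict_space_iff) auto
  then have "(\<lambda>x. (indicator K x *\<^sub>R f x) \<bullet> b) \<in> borel_measurable lebesgue" for b
    by (intro borel_measurable_inner) auto
  then have "\<exists>g'\<in>borel_measurable lborel. AE x in lborel. (indicator K x *\<^sub>R f x) \<bullet> b = g' x" for b
    by (rule completion_ex_borel_measurable_real)
  then obtain c where c: "\<And>b. c b \<in> borel_measurable lborel"
    "\<And>b. AE x in lborel. (indicator K x *\<^sub>R f x) \<bullet> b = c b x" by metis
  have [measurable]: "c b \<in> borel_measurable borel" for b using c(1) by simp
  define g where "g x = indicator K x *\<^sub>R (\<Sum>b\<in>Basis. c b x *\<^sub>R b)" for x
  have [measurable]: "g \<in> borel_measurable borel"
    unfolding g_def[abs_def] using KB by measurable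
  have "AE x in lborel. \<forall>b\<in>Basis. (indicator K x *\<^sub>R f x) \<bullet> b = c b x"
    by (rule AE_finite_allI) (use c(2) in auto)
  then have "AE x in lborel. x \<in> K \<longrightarrow> f x = g x"
  proof eventually_elim
    case (elim x)
    then show ?case by (auto simp: g_def intro!: euclidean_eqI[where 'a = 'b])
  qed
  moreover have "g x = 0" if "x \<notin> K" for x using that by (simp add: g_def)
  ultimately have "borel_version K f g" unfolding borel_version_def by auto
  then show "\<exists>g. borel_version K f g" by (intro exI[of "borel_version K f" g])
qed

lemma borel_version_diff:
  assumes "borel_version K f1 g1" "borel_version K f2 g2"
  shows "borel_version K (\<lambda>x. f1 x - f2 x) (\<lambda>x. g1 x - g2 x)"
proof -
  have [measurable]: "g1 \<in> borel_measurable borel" "g2 \<in> borel_measurable borel"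
    and "AE x in lborel. x \<in> K \<longrightarrow> f1 x = g1 x" "AE x in lborel. x \<in> K \<longrightarrow> f2 x = g2 x"
    using assms by (auto simp: borel_version_def)
  from this(3,4) have "AE x in lborel. x \<in> K \<longrightarrow> f1 x - f2 x = g1 x - g2 x"
    by eventually_elim simp
  then show ?thesis using assms by (simp add: borel_version_def)
qed

text \<open>
The expression \<open>\<Phi>\<close> may depend on the point as well, in order to cover products with test functions and
their gradients, which are what makes it vanish outside \<open>K\<close>.
\<close>

lemma borel_version_transfer:
  fixes f :: "'a::euclidean_space \<Rightarrow> 'b::euclidean_space" and \<Phi> :: "'a \<Rightarrow> 'b \<Rightarrow> 'c::euclidean_space"
  assumes v: "borel_version K f g" and K: "compact K" "K \<subseteq> S" "S \<in> sets lebesgue"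
    and m: "(\<lambda>x. \<Phi> x (g x)) \<in> borel_measurable borel"
    and 0: "\<And>x y. x \<notin> K \<Longrightarrow> x \<in> S \<Longrightarrow> \<Phi> x y = 0" "\<And>x. x \<notin> K \<Longrightarrow> \<Phi> x 0 = 0"
  shows "integrable (lebesgue_on S) (\<lambda>x. \<Phi> x (f x)) \<longleftrightarrow> integrable lborel (\<lambda>x. \<Phi> x (g x))"
    and "(LINT x|lebesgue_on S. \<Phi> x (f x)) = (LINT x|lborel. \<Phi> x (g x))"
proof -
  have "AE x in lborel. x \<in> K \<longrightarrow> f x = g x" using v by (simp add: borel_version_def)
  then have AE: "AE x in lborel. indicator S x *\<^sub>R \<Phi> x (f x) = \<Phi> x (g x)"
  proof eventually_elim
    case (elim x)
    then show ?case
      using v K(2) 0 by (cases "x \<in> K"; cases "x \<in> S") (auto simp: borel_version_def)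
  qed
  note lebesgue_on_transfer_lborel[OF K(3) m AE]
  then show "integrable (lebesgue_on S) (\<lambda>x. \<Phi> x (f x)) \<longleftrightarrow> integrable lborel (\<lambda>x. \<Phi> x (g x))"
    and "(LINT x|lebesgue_on S. \<Phi> x (f x)) = (LINT x|lborel. \<Phi> x (g x))" by auto
qed

lemma borel_version_Lp:
  fixes f :: "'a::euclidean_space \<Rightarrow> 'b::euclidean_space"
  assumes "borel_version K f g" "compact K" "f \<in> Lp s K" "0 < s"
  shows "integrable lborel (\<lambda>x. norm (g x) powr s)"
    and "(LINT x|lborel. norm (g x) powr s) = (LINT x|lebesgue_on K. norm (f x) powr s)"
proof -
  have [measurable]: "g \<in> borel_measurable borel" using assms by (simp add: borel_version_def)
  have KL: "K \<in> sets lebesgue" using assms(2) by (simp add: lmeasurable_compact fmeasurableD)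
  note * = borel_version_transfer[OF assms(1,2) order_refl KL, of "\<lambda>x y. norm (y::'b) powr s"]
  show "integrable lborel (\<lambda>x. norm (g x) powr s)"
    using *(1) assms(3,4) by (simp add: Lp_def)
  show "(LINT x|lborel. norm (g x) powr s) = (LINT x|lebesgue_on K. norm (f x) powr s)"
    using *(2) assms(4) by simp
qed

text \<open>
On a set of finite measure $L^s \subseteq L^1$, because $t \le 1 + t^s$ for $t \ge 0$ and $s \ge 1$.
\<close>

lemma integrable_compact_support_powr:
  fixes g :: "'a::euclidean_space \<Rightarrow> 'b::euclidean_space"
  assumes [measurable]: "g \<in> borel_measurable borel" and "compact K" "\<And>x. x \<notin> K \<Longrightarrow> g x = 0"
    and int: "integrable lborel (\<lambda>x. norm (g x) powr s)" and "1 \<le> s"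
  shows "integrable lborel g"
proof (rule Bochner_Integration.integrable_bound)
  have "integrable lborel (indicator K :: 'a \<Rightarrow> real)"
    using assms(2) by (intro integrable_real_indicator) (auto simp: borel_compact intro: emeasure_compact_finite[unfolded infinity_ennreal_def])
  then show "integrable lborel (\<lambda>x. indicator K x + norm (g x) powr s)" using int by simp
  show "AE x in lborel. norm (g x) \<le> norm (indicator K x + norm (g x) powr s)"
  proof (rule AE_I2)
    fix x
    have "norm (g x) \<le> indicator K x + norm (g x) powr s"
    proof (cases "x \<in> K")
      case True
      show ?thesis
      proof (cases "norm (g x) \<le> 1")
        case False
        then have "norm (g x) powr 1 \<le> norm (g x) powr s" using assms(5) by (intro powr_mono) auto
        then show ?thesis using False True by simp
      qed (use True in \<open>simp add: add_increasing2\<close>)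
    qed (use assms(3) in simp)
    then show "norm (g x) \<le> norm (indicator K x + norm (g x) powr s)" by simp
  qed
qed measurable

section \<open>Compactness of the gradients\<close>

text \<open>
The energy estimate.  The constants are chosen backwards: \<open>\<delta>\<close> makes the error term of the soft
monotonicity inequality at most $e/2$, which fixes its constant \<open>C\<close>; then \<open>\<eta>\<close> with $2 C \eta = e/2$ is the
size required of each of the two terms on the right of the energy identity.
\<close>

lemma weighted_gradient_Cauchy:
  fixes U f :: "nat \<Rightarrow> 'a::euclidean_space \<Rightarrow> real" and G :: "nat \<Rightarrow> 'a \<Rightarrow> 'a" and \<phi> :: "'a \<Rightarrow> real"
  assumes p: "1 < p" and r: "1 < r" and L: "compact L"
    and m: "\<And>n. U n \<in> borel_measurable borel" "\<And>n. f n \<in> borel_measurable borel" "\<And>n. G n \<in> borel_measurable borel"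
    and 0: "\<And>n x. x \<notin> L \<Longrightarrow> U n x = 0" "\<And>n x. x \<notin> L \<Longrightarrow> f n x = 0" "\<And>n x. x \<notin> L \<Longrightarrow> G n x = 0"
    and U: "\<And>n. integrable lborel (\<lambda>x. \<bar>U n x\<bar> powr p)" "\<And>n. integrable lborel (\<lambda>x. \<bar>U n x\<bar> powr r)"
    and G: "\<And>n. integrable lborel (\<lambda>x. norm (G n x) powr p)" "\<And>n. (LINT x|lborel. norm (G n x) powr p) \<le> A"
    and f: "\<And>n. integrable lborel (\<lambda>x. \<bar>f n x\<bar> powr conj_exp r)" "\<And>n. (LINT x|lborel. \<bar>f n x\<bar> powr conj_exp r) \<le> A"
    and Up: "\<And>e. 0 < e \<Longrightarrow> \<exists>N. \<forall>n\<ge>N. \<forall>m\<ge>N. (LINT x|lborel. \<bar>U n x - U m x\<bar> powr p) \<le> e"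
    and Ur: "\<And>e. 0 < e \<Longrightarrow> \<exists>N. \<forall>n\<ge>N. \<forall>m\<ge>N. (LINT x|lborel. \<bar>U n x - U m x\<bar> powr r) \<le> e"
    and weak: "\<And>n \<psi> b. \<psi> \<in> test_functions L \<Longrightarrow> b \<in> Basis \<Longrightarrow>
      (LINT x|lborel. U n x * (gradient \<psi> x \<bullet> b)) = - (LINT x|lborel. (G n x \<bullet> b) * \<psi> x)"
    and eqn: "\<And>n \<psi>. \<psi> \<in> test_functions L \<Longrightarrow>
      (LINT x|lborel. p_flux p (G n x) \<bullet> gradient \<psi> x) = (LINT x|lborel. f n x * \<psi> x)"
    and \<phi>: "\<phi> \<in> test_functions K" "\<And>x. 0 \<le> \<phi> x"
    and K: "K \<subseteq> L" "0 < e0" "\<And>x. x \<in> K \<Longrightarrow> cball x e0 \<subseteq> L"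
    and "0 < e"
  shows "\<exists>N. \<forall>n\<ge>N. \<forall>m\<ge>N. integrable lborel (\<lambda>x. norm (G n x - G m x) powr p * \<phi> x) \<and>
    (LINT x|lborel. norm (G n x - G m x) powr p * \<phi> x) \<le> e"
proof -
  note [measurable] = m
  let ?p' = "conj_exp p" and ?r' = "conj_exp r"
  note cp = conj_exp_conjugate[OF p] and cr = conj_exp_conjugate[OF r]
  have A0: "0 \<le> A" using G(2)[of 0] by (meson Bochner_Integration.integral_nonneg order_trans powr_ge_zero)
  obtain B where B: "0 < B" "\<And>x. \<bar>\<phi> x\<bar> \<le> B" by (rule test_functions_bounded[OF \<phi>(1)]) blast
  obtain B' where B': "0 < B'" "\<And>x. norm (gradient \<phi> x) \<le> B'" by (rule test_functions_gradient_bounded[OF \<phi>(1)]) blast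
  have [measurable]: "\<phi> \<in> borel_measurable borel" "gradient \<phi> \<in> borel_measurable borel"
    using test_functions_borel[OF \<phi>(1)] by auto
  have [measurable]: "p_flux p \<in> borel_measurable (borel :: 'a measure)"
    by (intro continuous_imp_borel continuous_p_flux p)
  define F where "F n x = p_flux p (G n x)" for n x
  have [measurable]: "F n \<in> borel_measurable borel" for n unfolding F_def[abs_def] by measurable
  have F0: "F n x = 0" if "x \<notin> L" for n x using 0(3)[OF that] by (simp add: F_def p_flux_def)
  have Fp: "integrable lborel (\<lambda>x. norm (F n x) powr ?p')" "(LINT x|lborel. norm (F n x) powr ?p') \<le> A" for n
    using G p by (simp_all add: F_def p_flux_powr_conj_exp)
  have U1: "integrable lborel (U n)" for n
    using U(1) p by (intro integrable_compact_support_powr[OF m(1) L 0(1), where s = p]) auto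
  have f1: "integrable lborel (f n)" for n
    using f(1) cr by (intro integrable_compact_support_powr[OF m(2) L 0(2), where s = ?r']) auto
  have G1: "integrable lborel (G n)" for n
    using G(1) p by (intro integrable_compact_support_powr[OF m(3) L 0(3), where s = p]) auto
  have F1: "integrable lborel (F n)" for n
    using Fp(1) cp by (intro integrable_compact_support_powr[OF _ L F0, where s = ?p']) auto

  define \<delta> where "\<delta> = e / (4 * (A + 1) * B)"
  have \<delta>: "0 < \<delta>" "\<delta> * (2 * A) * B \<le> e / 2"
  proof -
    show "0 < \<delta>" unfolding \<delta>_def using \<open>0 < e\<close> A0 B by (intro divide_pos_pos mult_pos_pos) auto
    have "\<delta> * (2 * A) * B = e / 2 * (A / (A + 1))"
      using B A0 by (simp add: \<delta>_def divide_simps)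
    also have "\<dots> \<le> e / 2 * 1" using \<open>0 < e\<close> A0 by (intro mult_left_mono) auto
    finally show "\<delta> * (2 * A) * B \<le> e / 2" by simp
  qed
  obtain C where C: "0 < C" "\<And>\<xi> \<eta> :: 'a. norm (\<xi> - \<eta>) powr p \<le> C * flux_gap p \<xi> \<eta> + \<delta> * (norm \<xi> powr p + norm \<eta> powr p)"
    by (rule norm_diff_powr_le_flux_gap[OF p \<delta>(1)]) blast
  define \<eta> where "\<eta> = e / (4 * C)"
  have \<eta>: "0 < \<eta> / B" "0 < \<eta> / B'" using \<open>0 < e\<close> C B B' by (auto simp: \<eta>_def)
  have A': "0 \<le> 2 powr ?p' * (2 * A)" "0 \<le> 2 powr ?r' * (2 * A)" using A0 by auto
  obtain d1 where d1: "0 < d1"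
    "\<And>h v :: 'a \<Rightarrow> real. h \<in> borel_measurable lborel \<Longrightarrow> v \<in> borel_measurable lborel \<Longrightarrow>
       integrable lborel (\<lambda>x. \<bar>h x\<bar> powr ?r') \<Longrightarrow> integrable lborel (\<lambda>x. \<bar>v x\<bar> powr r) \<Longrightarrow>
       (LINT x|lborel. \<bar>h x\<bar> powr ?r') \<le> 2 powr ?r' * (2 * A) \<Longrightarrow> (LINT x|lborel. \<bar>v x\<bar> powr r) \<le> d1 \<Longrightarrow>
       (LINT x|lborel. \<bar>h x * v x\<bar>) \<le> \<eta> / B"
    by (rule conjugate_product_small[OF cr(1) r cr(2) A'(2) \<eta>(1), where 'a = 'a]) blast
  obtain d2 where d2: "0 < d2"
    "\<And>h v :: 'a \<Rightarrow> real. h \<in> borel_measurable lborel \<Longrightarrow> v \<in> borel_measurable lborel \<Longrightarrow>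
       integrable lborel (\<lambda>x. \<bar>h x\<bar> powr ?p') \<Longrightarrow> integrable lborel (\<lambda>x. \<bar>v x\<bar> powr p) \<Longrightarrow>
       (LINT x|lborel. \<bar>h x\<bar> powr ?p') \<le> 2 powr ?p' * (2 * A) \<Longrightarrow> (LINT x|lborel. \<bar>v x\<bar> powr p) \<le> d2 \<Longrightarrow>
       (LINT x|lborel. \<bar>h x * v x\<bar>) \<le> \<eta> / B'"
    by (rule conjugate_product_small[OF cp(1) p cp(2) A'(1) \<eta>(2), where 'a = 'a]) blast
  obtain N1 where N1: "\<And>n m. N1 \<le> n \<Longrightarrow> N1 \<le> m \<Longrightarrow> (LINT x|lborel. \<bar>U n x - U m x\<bar> powr r) \<le> d1"
    using Ur[OF d1(1)] by blast
  obtain N2 where N2: "\<And>n m. N2 \<le> n \<Longrightarrow> N2 \<le> m \<Longrightarrow> (LINT x|lborel. \<bar>U n x - U m x\<bar> powr p) \<le> d2"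
    using Up[OF d2(1)] by blast
  have "integrable lborel (\<lambda>x. norm (G n x - G m x) powr p * \<phi> x) \<and>
      (LINT x|lborel. norm (G n x - G m x) powr p * \<phi> x) \<le> e"
    if "max N1 N2 \<le> n" "max N1 N2 \<le> m" for n m
  proof -
    let ?w = "\<lambda>x. U n x - U m x" and ?G = "\<lambda>x. G n x - G m x" and ?f = "\<lambda>x. f n x - f m x" and ?F = "\<lambda>x. F n x - F m x"
    have w: "integrable lborel (\<lambda>x. \<bar>?w x\<bar> powr p)" "integrable lborel (\<lambda>x. \<bar>?w x\<bar> powr r)"
      using integrable_powr_norm_diff(1)[of "U n" lborel "U m"] U p r by auto
    have Gd: "integrable lborel (\<lambda>x. norm (?G x) powr p)"
      using integrable_powr_norm_diff(1)[of "G n" lborel "G m"] G p by auto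
    have fd: "integrable lborel (\<lambda>x. \<bar>?f x\<bar> powr ?r')" "(LINT x|lborel. \<bar>?f x\<bar> powr ?r') \<le> 2 powr ?r' * (2 * A)"
    proof -
      have *: "0 \<le> ?r'" using cr by simp
      show "integrable lborel (\<lambda>x. \<bar>?f x\<bar> powr ?r')"
        using integrable_powr_norm_diff(1)[of "f n" lborel "f m", OF _ _ _ _ *] f by auto
      have "(LINT x|lborel. \<bar>?f x\<bar> powr ?r') \<le> 2 powr ?r' * ((LINT x|lborel. \<bar>f n x\<bar> powr ?r') + (LINT x|lborel. \<bar>f m x\<bar> powr ?r'))"
        using integrable_powr_norm_diff(2)[of "f n" lborel "f m", OF _ _ _ _ *] f by auto
      also have "\<dots> \<le> 2 powr ?r' * (2 * A)" using f(2)[of n] f(2)[of m] by (intro mult_left_mono) auto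
      finally show "(LINT x|lborel. \<bar>?f x\<bar> powr ?r') \<le> 2 powr ?r' * (2 * A)" .
    qed
    have Fd: "integrable lborel (\<lambda>x. norm (?F x) powr ?p')" "(LINT x|lborel. norm (?F x) powr ?p') \<le> 2 powr ?p' * (2 * A)"
    proof -
      have *: "0 \<le> ?p'" using cp by simp
      show "integrable lborel (\<lambda>x. norm (?F x) powr ?p')"
        using integrable_powr_norm_diff(1)[of "F n" lborel "F m", OF _ _ _ _ *] Fp by auto
      have "(LINT x|lborel. norm (?F x) powr ?p') \<le> 2 powr ?p' * ((LINT x|lborel. norm (F n x) powr ?p') + (LINT x|lborel. norm (F m x) powr ?p'))"
        using integrable_powr_norm_diff(2)[of "F n" lborel "F m", OF _ _ _ _ *] Fp by auto
      also have "\<dots> \<le> 2 powr ?p' * (2 * A)" using Fp(2)[of n] Fp(2)[of m] by (intro mult_left_mono) auto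
      finally show "(LINT x|lborel. norm (?F x) powr ?p') \<le> 2 powr ?p' * (2 * A)" .
    qed
    have weakd: "(LINT x|lborel. ?w x * (gradient \<psi> x \<bullet> b)) = - (LINT x|lborel. (?G x \<bullet> b) * \<psi> x)"
      if \<psi>: "\<psi> \<in> test_functions L" and b: "b \<in> Basis" for \<psi> b
    proof -
      obtain c where c: "\<And>x. \<bar>\<psi> x\<bar> \<le> c" by (rule test_functions_bounded[OF \<psi>]) blast
      obtain c' where c': "\<And>x. \<bar>gradient \<psi> x \<bullet> b\<bar> \<le> c'"
        by (rule test_functions_bounded[OF test_functions_gradient_component[OF \<psi> b]]) blast
      have [measurable]: "\<psi> \<in> borel_measurable borel" "gradient \<psi> \<in> borel_measurable borel"
        using test_functions_borel[OF \<psi>] by auto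
      have "integrable lborel (\<lambda>x. U k x * (gradient \<psi> x \<bullet> b))" for k
        by (rule integrable_mult_bounded[OF _ U1 c']) measurable
      moreover have "integrable lborel (\<lambda>x. (G k x \<bullet> b) * \<psi> x)" for k
        by (rule integrable_mult_bounded[OF _ integrable_inner_left[OF G1] c]) measurable
      ultimately show ?thesis
        using weak[OF \<psi> b, of n] weak[OF \<psi> b, of m] by (simp add: left_diff_distrib inner_diff_left)
    qed
    have eqnd: "(LINT x|lborel. ?F x \<bullet> gradient \<psi> x) = (LINT x|lborel. ?f x * \<psi> x)"
      if \<psi>: "\<psi> \<in> test_functions L" for \<psi>
    proof -
      obtain c where c: "\<And>x. \<bar>\<psi> x\<bar> \<le> c" by (rule test_functions_bounded[OF \<psi>]) blast
      obtain c' where c': "\<And>x. norm (gradient \<psi> x) \<le> c'" by (rule test_functions_gradient_bounded[OF \<psi>]) blast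
      have [measurable]: "\<psi> \<in> borel_measurable borel" "gradient \<psi> \<in> borel_measurable borel"
        using test_functions_borel[OF \<psi>] by auto
      have "integrable lborel (\<lambda>x. F k x \<bullet> gradient \<psi> x)" for k
        by (rule integrable_inner_bounded[OF F1 _ c']) measurable
      moreover have "integrable lborel (\<lambda>x. f k x * \<psi> x)" for k
        by (rule integrable_mult_bounded[OF _ f1 c]) measurable
      ultimately show ?thesis
        using eqn[OF \<psi>, of n] eqn[OF \<psi>, of m] by (simp add: left_diff_distrib inner_diff_left F_def)
    qed
    have test: "(LINT x|lborel. (?F x \<bullet> ?G x) * \<phi> x) + (LINT x|lborel. (?F x \<bullet> gradient \<phi> x) * ?w x)
        = (LINT x|lborel. (?f x * \<phi> x) * ?w x)" "integrable lborel (\<lambda>x. (?F x \<bullet> ?G x) * \<phi> x)"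
      by (rule weak_equation_product_test[where p = p and p' = ?p' and r = r and r' = ?r' and K = K and L = L,
            OF p cp(1,2) r cr(1,2) _ _ _ _ _ w _ _ _ fd(1) _ _ \<phi>(1) K(2,3,1) weakd eqnd];
          (use cp cr p U1 G1 f1 F1 in \<open>auto intro!: integrable_powr_inner Gd Fd(1)\<close>))+
    have gap_eq: "(?F x \<bullet> ?G x) = flux_gap p (G n x) (G m x)" for x
      by (simp add: F_def flux_gap_def)
    \<comment> \<open>The two terms on the right of the energy identity.\<close>
    have e1: "\<bar>LINT x|lborel. (?f x * \<phi> x) * ?w x\<bar> \<le> \<eta>"
    proof -
      have i: "integrable lborel (\<lambda>x. ?f x * ?w x)"
        using fd(1) w(2) by (intro integrable_conjugate_product[OF cr(1) r cr(2)]) auto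
      have "\<bar>LINT x|lborel. (?f x * \<phi> x) * ?w x\<bar> \<le> (LINT x|lborel. B * \<bar>?f x * ?w x\<bar>)"
      proof (rule integral_abs_bound[THEN order_trans], rule integral_mono)
        have "integrable lborel (\<lambda>x. (?f x * ?w x) * \<phi> x)"
          by (rule integrable_mult_bounded[OF _ i B(2)]) measurable
        then show "integrable lborel (\<lambda>x. \<bar>(?f x * \<phi> x) * ?w x\<bar>)" by (intro integrable_abs) (simp add: mult_ac)
        show "\<bar>(?f x * \<phi> x) * ?w x\<bar> \<le> B * \<bar>?f x * ?w x\<bar>" for x
          using mult_right_mono[OF B(2), of "\<bar>?f x * ?w x\<bar>" x] by (simp add: abs_mult mult_ac)
      qed (use i in simp)
      also have "\<dots> = B * (LINT x|lborel. \<bar>?f x * ?w x\<bar>)" by simp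
      also have "\<dots> \<le> B * (\<eta> / B)"
        using B that N1 by (intro mult_left_mono d1(2) fd w) auto
      finally show ?thesis using B by simp
    qed
    have e2: "\<bar>LINT x|lborel. (?F x \<bullet> gradient \<phi> x) * ?w x\<bar> \<le> \<eta>"
    proof -
      have i: "integrable lborel (\<lambda>x. norm (?F x) * ?w x)"
        using Fd(1) w(1) by (intro integrable_conjugate_product[OF cp(1) p cp(2)]) auto
      have le: "\<bar>(?F x \<bullet> gradient \<phi> x) * ?w x\<bar> \<le> B' * \<bar>norm (?F x) * ?w x\<bar>" for x
      proof -
        have "\<bar>?F x \<bullet> gradient \<phi> x\<bar> \<le> norm (?F x) * B'"
          using Cauchy_Schwarz_ineq2[of "?F x" "gradient \<phi> x"] mult_left_mono[OF B'(2)[of x], of "norm (?F x)"] by simp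
        then have "\<bar>?F x \<bullet> gradient \<phi> x\<bar> * \<bar>?w x\<bar> \<le> norm (?F x) * B' * \<bar>?w x\<bar>" by (rule mult_right_mono) simp
        then show ?thesis by (simp add: abs_mult mult_ac)
      qed
      have "\<bar>LINT x|lborel. (?F x \<bullet> gradient \<phi> x) * ?w x\<bar> \<le> (LINT x|lborel. B' * \<bar>norm (?F x) * ?w x\<bar>)"
      proof (rule integral_abs_bound[THEN order_trans], rule integral_mono)
        show "integrable lborel (\<lambda>x. \<bar>(?F x \<bullet> gradient \<phi> x) * ?w x\<bar>)"
        proof (rule Bochner_Integration.integrable_bound)
          show "integrable lborel (\<lambda>x. B' * \<bar>norm (?F x) * ?w x\<bar>)" using i by simp
          show "AE x in lborel. norm \<bar>(?F x \<bullet> gradient \<phi> x) * ?w x\<bar> \<le> norm (B' * \<bar>norm (?F x) * ?w x\<bar>)"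
            using le by (intro AE_I2) (simp add: order_trans[OF _ abs_ge_self])
        qed measurable
      qed (use i le in simp_all)
      also have "\<dots> = B' * (LINT x|lborel. \<bar>norm (?F x) * ?w x\<bar>)" by simp
      also have "\<dots> \<le> B' * (\<eta> / B')"
        using B' that N2 Fd w by (intro mult_left_mono d2(2)) auto
      finally show ?thesis using B' by simp
    qed
    have E: "(LINT x|lborel. flux_gap p (G n x) (G m x) * \<phi> x) \<le> 2 * \<eta>"
      using test(1) e1 e2 unfolding gap_eq by linarith
    have \<phi>B: "\<phi> x \<le> B" for x using B(2)[of x] by linarith
    note W = weighted_norm_diff_le_flux_gap[OF p _ _ _ G(1)[of n] G(2)[of n] G(1)[of m] G(2)[of m] \<phi>(2) \<phi>B
        test(2)[unfolded gap_eq] C(2) less_imp_le[OF \<delta>(1)] less_imp_le[OF B(1)]]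
    have "(LINT x|lborel. norm (G n x - G m x) powr p * \<phi> x) \<le>
      C * (LINT x|lborel. flux_gap p (G n x) (G m x) * \<phi> x) + \<delta> * (2 * A) * B"
      by (rule W(2)) auto
    also have "\<dots> \<le> C * (2 * \<eta>) + e / 2"
      using C(1) E \<delta>(2) by (intro add_mono mult_left_mono) auto
    also have "\<dots> = e" using C(1) by (simp add: \<eta>_def)
    finally show ?thesis using W(1) by auto
  qed
  then show ?thesis by blast
qed

text \<open>
The energy estimate for Borel representatives on the compact collar \<open>L\<close>, transferred back.  Since the
cutoff is at least $1$ on \<open>K\<close>, the weighted integral dominates the integral over \<open>K\<close>.
\<close>

lemma p_laplace_gradients_Cauchy:
  fixes \<Omega> :: "'a::euclidean_space set" and u f :: "nat \<Rightarrow> 'a \<Rightarrow> real"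
  assumes \<Omega>: "open \<Omega>" and p: "1 < p" and r: "1 < r"
    and W: "\<And>n. u n \<in> W1p_loc p \<Omega>"
    and sol: "\<And>n. p_laplace_solution p \<Omega> (f n) (u n)"
    and Gb: "bounded_Lp_loc p \<Omega> (\<lambda>n. weak_gradient \<Omega> (u n))"
    and fb: "bounded_Lp_loc (conj_exp r) \<Omega> f"
    and up: "converges_Lp_loc p \<Omega> u v" and ur: "converges_Lp_loc r \<Omega> u v"
    and K: "compact K" "K \<subseteq> \<Omega>" and "0 < e"
  shows "\<exists>N. \<forall>n\<ge>N. \<forall>m\<ge>N.
    (LINT x|lebesgue_on K. norm (weak_gradient \<Omega> (u n) x - weak_gradient \<Omega> (u m) x) powr p) \<le> e"
proof -
  define G where "G n = weak_gradient \<Omega> (u n)" for n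
  note cr = conj_exp_conjugate[OF r]
  have wg: "has_weak_gradient \<Omega> (u n) (G n)" for n
  proof -
    have "\<exists>G. has_weak_gradient \<Omega> (u n) G" using W[of n] by (auto simp: W1p_loc_def)
    then show ?thesis unfolding G_def weak_gradient_def by (rule someI_ex)
  qed
  obtain \<phi> K' L e0 where L: "compact L" "L \<subseteq> \<Omega>" and K': "K \<subseteq> K'" "K' \<subseteq> L"
    and e0: "0 < e0" "\<And>x. x \<in> K' \<Longrightarrow> cball x e0 \<subseteq> L"
    and \<phi>: "\<phi> \<in> test_functions K'" "\<And>x. 0 \<le> \<phi> x" "\<And>x. x \<in> K \<Longrightarrow> 1 \<le> \<phi> x"
    by (rule exists_cutoff_with_collar[OF \<Omega> K]) blast
  have GL: "G n \<in> Lp p L" and fL: "f n \<in> Lp (conj_exp r) L" and uL: "u n \<in> Lp p L" "u n \<in> Lp r L" for n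
    using Gb fb up ur L by (auto simp: bounded_Lp_loc_def converges_Lp_loc_def Lp_loc_def G_def)
  have "\<exists>g. borel_version L (u n) g" "\<exists>g. borel_version L (G n) g" "\<exists>g. borel_version L (f n) g" for n
    using uL[of n] GL[of n] fL[of n] by (auto intro!: exists_borel_version[OF L(1)] simp: Lp_def)
  then obtain U g h where v: "\<And>n. borel_version L (u n) (U n)" "\<And>n. borel_version L (G n) (g n)" "\<And>n. borel_version L (f n) (h n)"
    by metis
  have [measurable]: "U n \<in> borel_measurable borel" "g n \<in> borel_measurable borel" "h n \<in> borel_measurable borel" for n
    using v by (auto simp: borel_version_def)
  have zero: "U n x = 0" "g n x = 0" "h n x = 0" if "x \<notin> L" for n x
    using v that by (auto simp: borel_version_def)
  have \<Omega>s: "\<Omega> \<in> sets lebesgue" using \<Omega> by simp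
  obtain A1 where A1: "\<And>n. (LINT x|lebesgue_on L. norm (G n x) powr p) \<le> A1"
    using bounded_Lp_loc_integral_bound[OF Gb L] p unfolding G_def by auto
  obtain A2 where A2: "\<And>n. (LINT x|lebesgue_on L. norm (f n x) powr conj_exp r) \<le> A2"
    using bounded_Lp_loc_integral_bound[OF fb L] cr by auto
  have cauchy: "\<exists>N. \<forall>n\<ge>N. \<forall>m\<ge>N. (LINT x|lborel. \<bar>U n x - U m x\<bar> powr s) \<le> c"
    if "converges_Lp_loc s \<Omega> u v" "0 < s" "0 < c" for s c
  proof -
    have "u n \<in> Lp s L" for n using that(1) L by (auto simp: converges_Lp_loc_def Lp_loc_def)
    then have "(\<lambda>x. u n x - u m x) \<in> Lp s L" for n m using that by (intro Lp_diff) auto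
    then have "(LINT x|lborel. \<bar>U n x - U m x\<bar> powr s) = (LINT x|lebesgue_on L. norm (u n x - u m x) powr s)" for n m
      using borel_version_Lp(2)[OF borel_version_diff[OF v(1) v(1)] L(1) _ that(2)] by simp
    then show ?thesis using converges_Lp_loc_imp_Cauchy[OF that(1) L that(2,3)] by simp
  qed
  have weak: "(LINT x|lborel. U n x * (gradient \<psi> x \<bullet> b)) = - (LINT x|lborel. (g n x \<bullet> b) * \<psi> x)"
    if \<psi>: "\<psi> \<in> test_functions L" and b: "b \<in> Basis" for n \<psi> b
  proof -
    have [measurable]: "\<psi> \<in> borel_measurable borel" "gradient \<psi> \<in> borel_measurable borel"
      using test_functions_borel[OF \<psi>] by auto
    note z = test_functions_outside[OF \<psi>]
    have "(LINT x|lebesgue_on \<Omega>. u n x * (gradient \<psi> x \<bullet> b)) = - (LINT x|lebesgue_on \<Omega>. (G n x \<bullet> b) * \<psi> x)"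
      using wg[of n] test_functions_mono[OF \<psi> L(2)] b by (auto simp: has_weak_gradient_def)
    moreover have "(LINT x|lebesgue_on \<Omega>. u n x * (gradient \<psi> x \<bullet> b)) = (LINT x|lborel. U n x * (gradient \<psi> x \<bullet> b))"
      by (rule borel_version_transfer(2)[OF v(1) L \<Omega>s]) (use z in auto)
    moreover have "(LINT x|lebesgue_on \<Omega>. (G n x \<bullet> b) * \<psi> x) = (LINT x|lborel. (g n x \<bullet> b) * \<psi> x)"
      by (rule borel_version_transfer(2)[OF v(2) L \<Omega>s, of "\<lambda>x y. (y \<bullet> b) * \<psi> x"]) (use z in auto)
    ultimately show ?thesis by simp
  qed
  have [measurable]: "p_flux p \<in> borel_measurable (borel :: 'a measure)"
    by (intro continuous_imp_borel continuous_p_flux p)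
  have eqn: "(LINT x|lborel. p_flux p (g n x) \<bullet> gradient \<psi> x) = (LINT x|lborel. h n x * \<psi> x)"
    if \<psi>: "\<psi> \<in> test_functions L" for n \<psi>
  proof -
    have [measurable]: "\<psi> \<in> borel_measurable borel" "gradient \<psi> \<in> borel_measurable borel"
      using test_functions_borel[OF \<psi>] by auto
    note z = test_functions_outside[OF \<psi>]
    have "(LINT x|lebesgue_on \<Omega>. p_flux p (G n x) \<bullet> gradient \<psi> x) = (LINT x|lebesgue_on \<Omega>. f n x * \<psi> x)"
      using sol[of n] test_functions_mono[OF \<psi> L(2)] by (auto simp: p_laplace_solution_def G_def p_flux_def)
    moreover have "(LINT x|lebesgue_on \<Omega>. p_flux p (G n x) \<bullet> gradient \<psi> x) = (LINT x|lborel. p_flux p (g n x) \<bullet> gradient \<psi> x)"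
      by (rule borel_version_transfer(2)[OF v(2) L \<Omega>s, of "\<lambda>x y. p_flux p y \<bullet> gradient \<psi> x"]) (use z in auto)
    moreover have "(LINT x|lebesgue_on \<Omega>. f n x * \<psi> x) = (LINT x|lborel. h n x * \<psi> x)"
      by (rule borel_version_transfer(2)[OF v(3) L \<Omega>s, of "\<lambda>x y. y * \<psi> x"]) (use z in auto)
    ultimately show ?thesis by simp
  qed
  have Up: "integrable lborel (\<lambda>x. \<bar>U n x\<bar> powr p)" and Ur: "integrable lborel (\<lambda>x. \<bar>U n x\<bar> powr r)" for n
    using borel_version_Lp(1)[OF v(1) L(1) uL(1)] borel_version_Lp(1)[OF v(1) L(1) uL(2)] p r by auto
  have gp: "integrable lborel (\<lambda>x. norm (g n x) powr p)" "(LINT x|lborel. norm (g n x) powr p) \<le> max A1 A2" for n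
    using borel_version_Lp[OF v(2) L(1) GL, of n] A1[of n] p by auto
  have hr: "integrable lborel (\<lambda>x. \<bar>h n x\<bar> powr conj_exp r)" "(LINT x|lborel. \<bar>h n x\<bar> powr conj_exp r) \<le> max A1 A2" for n
    using borel_version_Lp[OF v(3) L(1) fL, of n] A2[of n] cr by auto
  obtain N where N: "\<And>n m. N \<le> n \<Longrightarrow> N \<le> m \<Longrightarrow> integrable lborel (\<lambda>x. norm (g n x - g m x) powr p * \<phi> x)"
      "\<And>n m. N \<le> n \<Longrightarrow> N \<le> m \<Longrightarrow> (LINT x|lborel. norm (g n x - g m x) powr p * \<phi> x) \<le> e"
    using weighted_gradient_Cauchy[OF p r L(1), where U = U and f = h and G = g and \<phi> = \<phi> and K = K' and A = "max A1 A2",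
        OF _ _ _ zero(1,3,2) Up Ur gp hr cauchy[OF up] cauchy[OF ur] weak eqn \<phi>(1,2) K'(2) e0 \<open>0 < e\<close>] p r
    by auto
  have "(LINT x|lebesgue_on K. norm (G n x - G m x) powr p) \<le> e" if "N \<le> n" "N \<le> m" for n m
  proof -
    have [measurable]: "\<phi> \<in> borel_measurable borel" using test_functions_borel[OF \<phi>(1)] by auto
    have z: "\<phi> x = 0" if "x \<notin> L" for x using test_functions_outside(1)[OF \<phi>(1), of x] that K'(2) by auto
    have KL: "K \<subseteq> L" "K \<in> sets lebesgue" "L \<in> sets lebesgue"
      using K' K(1) L(1) by (auto intro: compact_imp_sets_lebesgue)
    note T = borel_version_transfer[OF borel_version_diff[OF v(2) v(2)] L(1) order_refl KL(3), of "\<lambda>x y. norm y powr p * \<phi> x" n m]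
    have iL: "integrable (lebesgue_on L) (\<lambda>x. norm (G n x - G m x) powr p * \<phi> x)"
      by (subst T(1)) (use z N(1)[OF that] in auto)
    note M = integrable_lebesgue_on_subset[OF KL(2,3,1) iL]
    have "(LINT x|lebesgue_on K. norm (G n x - G m x) powr p) \<le> (LINT x|lebesgue_on K. norm (G n x - G m x) powr p * \<phi> x)"
    proof (rule integral_mono)
      have "G k \<in> Lp p K" for k using Gb K by (auto simp: bounded_Lp_loc_def Lp_loc_def G_def)
      then have "(\<lambda>x. G n x - G m x) \<in> Lp p K" using p by (intro Lp_diff) auto
      then show "integrable (lebesgue_on K) (\<lambda>x. norm (G n x - G m x) powr p)" by (simp add: Lp_def)
      show "integrable (lebesgue_on K) (\<lambda>x. norm (G n x - G m x) powr p * \<phi> x)"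
        by (rule M(1)) (use \<phi>(2) in auto)
      show "norm (G n x - G m x) powr p \<le> norm (G n x - G m x) powr p * \<phi> x" if "x \<in> space (lebesgue_on K)" for x
        using \<phi>(3)[of x] that by (simp add: mult_le_cancel_left1)
    qed
    also have "\<dots> \<le> (LINT x|lebesgue_on L. norm (G n x - G m x) powr p * \<phi> x)"
      by (rule M(2)) (use \<phi>(2) in auto)
    also have "\<dots> = (LINT x|lborel. norm (g n x - g m x) powr p * \<phi> x)"
      by (rule T(2)) (use z in auto)
    also have "\<dots> \<le> e" by (rule N(2)[OF that])
    finally show ?thesis .
  qed
  then show ?thesis unfolding G_def by blast
qed

theorem lemma2p4:
  fixes \<Omega> :: "(real ^ 'n) set"
    and p r :: real
    and u f :: "nat \<Rightarrow> real ^ 'n \<Rightarrow> real"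
    and u_lim :: "real ^ 'n \<Rightarrow> real"
  assumes "CARD('n) \<ge> 2"
    and "open \<Omega>" and "connected \<Omega>" and "\<Omega> \<noteq> {}" and "bounded \<Omega>"
    and "1 < p"
    and "1 < r" and "ereal r < sobolev_exp CARD('n) p"
    and "\<And>n. u n \<in> W1p_loc p \<Omega>"
    and "\<And>n. f n \<in> Lp_loc (conj_exp r) \<Omega>"
    and "\<And>n. p_laplace_solution p \<Omega> (f n) (u n)"
    and "bounded_Lp_loc p \<Omega> (\<lambda>n. weak_gradient \<Omega> (u n))"
    and "bounded_Lp_loc (conj_exp r) \<Omega> f"
    and "u_lim \<in> Lp_loc p \<Omega>" and "u_lim \<in> Lp_loc r \<Omega>"
    and "converges_Lp_loc p \<Omega> u u_lim" and "converges_Lp_loc r \<Omega> u u_lim"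
  shows "\<exists>\<sigma> :: nat \<Rightarrow> nat. strict_mono \<sigma> \<and>
           (\<exists>V. converges_Lp_loc p \<Omega> (\<lambda>n. weak_gradient \<Omega> (u (\<sigma> n))) V)"
proof (rule Lp_loc_Cauchy_imp_convergent_subsequence)
  show "open \<Omega>" "0 < p" using assms(2,6) by auto
  show "weak_gradient \<Omega> (u n) \<in> Lp_loc p \<Omega>" for n
    using assms(12) by (simp add: bounded_Lp_loc_def)
  show "\<exists>N. \<forall>n\<ge>N. \<forall>m\<ge>N.
      (LINT x|lebesgue_on K. norm (weak_gradient \<Omega> (u n) x - weak_gradient \<Omega> (u m) x) powr p) \<le> e"
    if "compact K" "K \<subseteq> \<Omega>" "0 < e" for K e
    by (rule p_laplace_gradients_Cauchy[OF assms(2,6,7,9,11,12,13,16,17) that])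
qed blast

end
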